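(* Let $D = D_1\cup D_2\cup\dots\cup D_n$ be an oriented diagram of an $n$-component virtual link $L$. Then, with respect to the dictionary (lexicographic) order on pairs, $$\Big(\operatorname{span}(D),\ \sum_{1\le i<j\le n}\ell_{D_i\cup D_j}+\frac12\sum_{i=1}^{n}\ \sum_{k\in\mathbb{Z}\setminus\{0\}}|J_k(D_i)|\Big)\ \le\ U(L).$$
   Context: Virtual link diagrams have classical crossings and virtual crossings; two diagrams are equivalent (represent the same virtual link) if related by a finite sequence of classical Reidemeister moves RI, RII, RIII and virtual moves VRI, VRII, VRIII and the semivirtual move SV (one classical and two virtual crossings). A diagram is trivial (represents the unlink) if it is equivalent to a diagram without crossings. Diagrams are oriented. Virtualizing a classical crossing means replacing it by a virtual crossing; a crossing change switches over/under information at a classical crossing. Unknotting index: for non-negative integers $m,n$, a diagram $D$ is $(m,n)$-unknottable if by virtualizing $m$ classical crossings of $D$ and applying crossing changes to $n$ classical crossings of $D$ one obtains a diagram of a trivial link. $U(D)$ is the minimum, in dictionary order, of the pairs $(m,n)$ for which $D$ is $(m,n)$-unknottable, and $U(L)=\min U(D)$ over all diagrams $D$ of $L$. Signs of classical crossings are standard ($\pm1$, right-handed crossing is $+1$). A linking crossing is a classical crossing between two different components. Linking number: $\operatorname{lk}(D)=\frac12\sum \operatorname{sgn}(c)$ over all linking crossings $c$. Span: for a 2-component diagram $D_1\cup D_2$, traverse $D_1$; let $r_+$ (resp. $r_-$) be the number of positive (resp. negative) linking crossings where $D_1$ passes over, and $\ell_+$ (resp. $\ell_-$) the number of positive (resp.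 negative) linking crossings where $D_1$ passes under. Then $\operatorname{span}(D_1\cup D_2)=|r_+-r_--\ell_++\ell_-|$. For an $n$-component diagram, $\operatorname{span}(D)=\sum_{i<j}\operatorname{span}(D_i\cup D_j)$, the sum over unordered pairs of components. Span is a virtual link invariant. The number $\ell_D$: let $C(D)$ be the set of classical crossings of $D$; for $S\subseteq C(D)$ let $D_S$ be the diagram obtained from $D$ by virtualizing all crossings in $S$. Put $\Lambda(D)=\{S\subseteq C(D): |S|=\operatorname{span}(D)\text{ and }\operatorname{span}(D_S)=0\}$ and $\ell_D=\min\{|\operatorname{lk}(D_S)| : S\in\Lambda(D)\}$. Here $\ell_{D_i\cup D_j}$ is this number for the 2-component diagram $D_i\cup D_j$. Writhes $J_k$: for a virtual knot diagram $K$, the Gauss diagram $G(K)$ is an oriented circle with one chord $\gamma_c$ for each classical crossing $c$, directed from the over-passage to the under-passage and carrying the sign of $c$. For a chord $\gamma_c$ let $\mathrm r_\pm$ (resp. $l_\pm$) be the number of chords of sign $\pm$ crossing $\gamma_c$ transversely from right to left (resp. from left to right), and $\operatorname{Ind}(c)=\mathrm r_+-\mathrm r_--l_++l_-$. For $k\in\mathbb Z\setminus\{0\}$, $J_k(K)=\sum_{c:\operatorname{Ind}(c)=k}\operatorname{sgn}(c)$. In the claim $J_k(D_i)$ is computed for the component $D_i$ regarded as a virtual knot diagram by itself (only its self-crossings). *)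

theory Defs
  imports Complex_Main "HOL-Library.Product_Lexorder"
begin

section \<open>Oriented virtual link diagrams\<close>

text \<open>
  A planar diagram in Morse position is a list of elementary pieces, read from bottom to top.
  Piece \<open>(x, i)\<close> is attached to the horizontal row of strands below it, to the right of the
  \<open>i\<close> leftmost strands, which pass vertically, as do all strands to the right of \<open>x\<close>.  Every
  oriented diagram in the plane is of this form up to planar isotopy, and planarity needs no
  separate condition.

  A row is the list of the directions of its strands (\<open>True\<close> is upwards).  \<open>Cup b\<close> is a local
  minimum whose left leg has direction \<open>b\<close>; \<open>Cap\<close> is a local maximum.  In
  \<open>Cross Over\<close> (\<open>Cross Under\<close>) the strand joining lower left to upper right passes over
  (under) the other one; \<open>Cross Virtual\<close> is a virtual crossing.
\<close>

datatype kind = Over | Under | Virtual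

datatype piece = Cup bool | Cap | Cross kind

type_synonym diag = "(piece \<times> nat) list"

fun legs_below :: "piece \<Rightarrow> nat" where
  "legs_below (Cup b) = 0"
| "legs_below Cap = 2"
| "legs_below (Cross k) = 2"

fun legs_above :: "piece \<Rightarrow> nat" where
  "legs_above (Cup b) = 2"
| "legs_above Cap = 0"
| "legs_above (Cross k) = 2"

text \<open>The row above a piece; \<open>None\<close> if the piece does not fit on the row below it.\<close>

fun attach :: "piece \<times> nat \<Rightarrow> bool list \<Rightarrow> bool list option" where
  "attach (Cup b, i) s =
     (if i \<le> length s then Some (take i s @ [b, \<not> b] @ drop i s) else None)"
| "attach (Cap, i) s =
     (if Suc i < length s \<and> s ! i \<noteq> s ! Suc i then Some (take i s @ drop (i + 2) s) else None)"
| "attach (Cross k, i) s =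
     (if Suc i < length s then Some (take i s @ [s ! Suc i, s ! i] @ drop (i + 2) s) else None)"

fun attach_all :: "diag \<Rightarrow> bool list \<Rightarrow> bool list option" where
  "attach_all [] s = Some s"
| "attach_all (x # w) s = Option.bind (attach x s) (attach_all w)"

definition diagram :: "diag \<Rightarrow> bool" where
  "diagram w \<longleftrightarrow> attach_all w [] = Some []"

definition classical :: "diag \<Rightarrow> nat set" where
  "classical w = {c. c < length w \<and> fst (w ! c) \<in> {Cross Over, Cross Under}}"

definition crossingless :: "diag \<Rightarrow> bool" where
  "crossingless w \<longleftrightarrow> (\<forall>x\<in>set w. \<forall>k. fst x \<noteq> Cross k)"


section \<open>Equivalence of diagrams\<close>

text \<open>Reverse the over/under information; virtual crossings have none.\<close>

fun flip :: "kind \<Rightarrow> kind" where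
  "flip Over = Under"
| "flip Under = Over"
| "flip Virtual = Virtual"

text \<open>
  The first five rules generate planar isotopy (Turaev's relations for tangles in Morse
  position): distant pieces change height, a minimum cancels with an adjacent maximum, and a
  strand is pulled across the tip of a minimum or of a maximum.  In the latter two the
  crossing is afterwards seen from the other side, so its kind is flipped although the strand
  that passes over remains the same.

  The kink rules are RI for classical and VRI for virtual \<open>k\<close>; \<open>bigon\<close> is RII for classical
  and VRII for virtual \<open>k\<close>.

  In the triangle rules the kinds \<open>a\<close>, \<open>b\<close>, \<open>c\<close> belong to the strand pairs (1,2), (1,3),
  (2,3), where the strands are numbered from left to right at the bottom.  In RIII the
  condition \<open>a = b \<or> b = c\<close> says that the three strands are stacked: it excludes exactly
  the two cyclic patterns (1 over 2 over 3 over 1, and its opposite).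
\<close>

inductive move :: "diag \<Rightarrow> diag \<Rightarrow> bool" where
  height: "i + legs_above x \<le> j \<Longrightarrow>
     move [(x, i), (y, j)] [(y, j - legs_above x + legs_below x), (x, i)]"
| zigzag_right: "move [(Cup b, i), (Cap, Suc i)] []"
| zigzag_left: "move [(Cup b, Suc i), (Cap, i)] []"
| slide_cup: "move [(Cup b, i), (Cross k, Suc i)] [(Cup b, Suc i), (Cross (flip k), i)]"
| slide_cap: "move [(Cross k, Suc i), (Cap, i)] [(Cross (flip k), i), (Cap, Suc i)]"
| kink_cup: "move [(Cup b, i), (Cross k, i)] [(Cup (\<not> b), i)]"
| kink_cap: "move [(Cross k, i), (Cap, i)] [(Cap, i)]"
| bigon: "move [(Cross k, i), (Cross (flip k), i)] []"
| RIII: "{a, b, c} \<subseteq> {Over, Under} \<Longrightarrow> a = b \<or> b = c \<Longrightarrow>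
     move [(Cross a, i), (Cross b, Suc i), (Cross c, i)]
          [(Cross c, Suc i), (Cross b, i), (Cross a, Suc i)]"
| VRIII: "move [(Cross Virtual, i), (Cross Virtual, Suc i), (Cross Virtual, i)]
               [(Cross Virtual, Suc i), (Cross Virtual, i), (Cross Virtual, Suc i)]"
| SV: "k \<in> {Over, Under} \<Longrightarrow>
     (a, b, c) \<in> {(k, Virtual, Virtual), (Virtual, k, Virtual), (Virtual, Virtual, k)} \<Longrightarrow>
     move [(Cross a, i), (Cross b, Suc i), (Cross c, i)]
          [(Cross c, Suc i), (Cross b, i), (Cross a, Suc i)]"

inductive local_move :: "diag \<Rightarrow> diag \<Rightarrow> bool" where
  "move l r \<Longrightarrow> diagram (u @ l @ v) \<Longrightarrow> diagram (u @ r @ v) \<Longrightarrow>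
     local_move (u @ l @ v) (u @ r @ v)"

definition equivalent :: "diag rel" where
  "equivalent = {(w, w'). diagram w \<and> diagram w' \<and> equivclp local_move w w'}"

definition virtual_links :: "diag set set" where
  "virtual_links = {w. diagram w} // equivalent"

definition trivial :: "diag \<Rightarrow> bool" where
  "trivial w \<longleftrightarrow> (\<exists>w'. (w, w') \<in> equivalent \<and> crossingless w')"


section \<open>Unknotting index\<close>

fun make_virtual :: "piece \<Rightarrow> piece" where
  "make_virtual (Cross k) = Cross Virtual"
| "make_virtual x = x"

fun change_crossing :: "piece \<Rightarrow> piece" where
  "change_crossing (Cross k) = Cross (flip k)"
| "change_crossing x = x"

definition at_pieces :: "(piece \<Rightarrow> piece) \<Rightarrow> nat set \<Rightarrow> diag \<Rightarrow> diag" where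
  "at_pieces f S w =
     map (\<lambda>t. (if t \<in> S then f (fst (w ! t)) else fst (w ! t), snd (w ! t))) [0..<length w]"

abbreviation virtualize :: "nat set \<Rightarrow> diag \<Rightarrow> diag" where
  "virtualize \<equiv> at_pieces make_virtual"

abbreviation change_crossings :: "nat set \<Rightarrow> diag \<Rightarrow> diag" where
  "change_crossings \<equiv> at_pieces change_crossing"

definition unknottable :: "nat \<Rightarrow> nat \<Rightarrow> diag \<Rightarrow> bool" where
  "unknottable m n w \<longleftrightarrow>
     (\<exists>S T. S \<subseteq> classical w \<and> T \<subseteq> classical w - S \<and> card S = m \<and> card T = n \<and>
        trivial (change_crossings T (virtualize S w)))"

text \<open>Pairs are ordered lexicographically (\<^theory>\<open>HOL-Library.Product_Lexorder\<close>).\<close>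

definition diag_unknotting_index :: "diag \<Rightarrow> nat \<times> nat" where
  "diag_unknotting_index w = (LEAST u. unknottable (fst u) (snd u) w)"

definition unknotting_index :: "diag set \<Rightarrow> nat \<times> nat" where
  "unknotting_index L = (LEAST u. \<exists>w\<in>L. u = diag_unknotting_index w)"


section \<open>Components\<close>

text \<open>
  The point \<open>(t, p)\<close> is the \<open>p\<close>-th strand, from the left, of the row below the \<open>t\<close>-th piece.
  \<open>next_point\<close> follows the orientation from a point to the next one, through the piece above
  the point on an upward strand and through the piece below it on a downward strand.
\<close>

definition row :: "diag \<Rightarrow> nat \<Rightarrow> bool list" where
  "row w t = the (attach_all (take t w) [])"

definition points :: "diag \<Rightarrow> (nat \<times> nat) set" where
  "points w = {(t, p). t \<le> length w \<and> p < length (row w t)}"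

text \<open>
  \<open>ascend x t p\<close> enters piece \<open>x\<close>, which lies between rows \<open>t\<close> and \<open>Suc t\<close>, at the point
  \<open>(t, p)\<close>; \<open>descend x t p\<close> enters it at \<open>(Suc t, p)\<close>.
\<close>

fun ascend :: "piece \<times> nat \<Rightarrow> nat \<Rightarrow> nat \<Rightarrow> nat \<times> nat" where
  "ascend (Cup b, i) t p = (Suc t, if p < i then p else p + 2)"
| "ascend (Cap, i) t p =
     (if p = i then (t, Suc i) else if p = Suc i then (t, i)
      else (Suc t, if p < i then p else p - 2))"
| "ascend (Cross k, i) t p =
     (Suc t, if p = i then Suc i else if p = Suc i then i else p)"

fun descend :: "piece \<times> nat \<Rightarrow> nat \<Rightarrow> nat \<Rightarrow> nat \<times> nat" where
  "descend (Cup b, i) t p =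
     (if p = i then (Suc t, Suc i) else if p = Suc i then (Suc t, i)
      else (t, if p < i then p else p - 2))"
| "descend (Cap, i) t p = (t, if p < i then p else p + 2)"
| "descend (Cross k, i) t p =
     (t, if p = i then Suc i else if p = Suc i then i else p)"

definition next_point :: "diag \<Rightarrow> nat \<times> nat \<Rightarrow> nat \<times> nat" where
  "next_point w = (\<lambda>(t, p).
     if row w t ! p then ascend (w ! t) t p else descend (w ! (t - 1)) (t - 1) p)"

definition component :: "diag \<Rightarrow> nat \<times> nat \<Rightarrow> (nat \<times> nat) set" where
  "component w x = range (\<lambda>k. (next_point w ^^ k) x)"

definition components :: "diag \<Rightarrow> (nat \<times> nat) set set" where
  "components w = component w ` points w"


section \<open>Signs, linking number, span\<close>

text \<open>
  The two passages of a crossing are represented by the points at its two lower ends.  As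
  each strand of a crossing has exactly one lower end, distinct passages have distinct
  representatives, and these occur along a component in the same cyclic order as the
  passages themselves.
\<close>

definition over_point :: "diag \<Rightarrow> nat \<Rightarrow> nat \<times> nat" where
  "over_point w c = (c, if fst (w ! c) = Cross Over then snd (w ! c) else Suc (snd (w ! c)))"

definition under_point :: "diag \<Rightarrow> nat \<Rightarrow> nat \<times> nat" where
  "under_point w c = (c, if fst (w ! c) = Cross Over then Suc (snd (w ! c)) else snd (w ! c))"

text \<open>
  If both strands point upwards, then \<open>Over\<close> is the right-handed crossing; reversing one
  strand changes the sign.
\<close>

definition crossing_sign :: "diag \<Rightarrow> nat \<Rightarrow> int" where
  "crossing_sign w c =
     (if fst (w ! c) = Cross Over then 1 else - 1) *
     (if row w c ! snd (w ! c) = row w c ! Suc (snd (w ! c)) then 1 else - 1)"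

text \<open>
  The subdiagram formed by some components of \<open>w\<close>, with union \<open>X\<close>, is not built as a diagram
  of its own: its classical crossings are the following crossings of \<open>w\<close>, with the same signs
  and met in the same cyclic order.  Likewise, virtualizing crossings does not affect
  \<open>next_point\<close>, so a component of \<open>w\<close> is also a component of \<open>virtualize S w\<close>.
\<close>

definition crossings_on :: "diag \<Rightarrow> (nat \<times> nat) set \<Rightarrow> nat set" where
  "crossings_on w X = {c \<in> classical w. over_point w c \<in> X \<and> under_point w c \<in> X}"

definition passes_over :: "diag \<Rightarrow> (nat \<times> nat) set \<Rightarrow> (nat \<times> nat) set \<Rightarrow> nat set" where
  "passes_over w P Q = {c \<in> classical w. over_point w c \<in> P \<and> under_point w c \<in> Q}"

definition linking_number :: "diag \<Rightarrow> (nat \<times> nat) set \<Rightarrow> (nat \<times> nat) set \<Rightarrow> real" where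
  "linking_number w P Q =
     (\<Sum>c \<in> passes_over w P Q \<union> passes_over w Q P. real_of_int (crossing_sign w c)) / 2"

definition pair_span :: "diag \<Rightarrow> (nat \<times> nat) set \<Rightarrow> (nat \<times> nat) set \<Rightarrow> nat" where
  "pair_span w P Q =
    (let r_pos = int (card {c \<in> passes_over w P Q. crossing_sign w c = 1});
         r_neg = int (card {c \<in> passes_over w P Q. crossing_sign w c = - 1});
         l_pos = int (card {c \<in> passes_over w Q P. crossing_sign w c = 1});
         l_neg = int (card {c \<in> passes_over w Q P. crossing_sign w c = - 1})
     in nat \<bar>r_pos - r_neg - l_pos + l_neg\<bar>)"

text \<open>Here \<open>C\<close> enumerates the components of \<open>w\<close> by the numbers \<open>1, \<dots>, n\<close>.\<close>

definition diag_span :: "diag \<Rightarrow> nat \<Rightarrow> (nat \<Rightarrow> (nat \<times> nat) set) \<Rightarrow> nat" where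
  "diag_span w n C = (\<Sum>(i, j) \<in> {(i, j). 1 \<le> i \<and> i < j \<and> j \<le> n}. pair_span w (C i) (C j))"

text \<open>The set \<open>\<Lambda>\<close> and the number \<open>\<ell>\<close> of the two-component subdiagram formed by \<open>P\<close> and \<open>Q\<close>.\<close>

definition Lambda :: "diag \<Rightarrow> (nat \<times> nat) set \<Rightarrow> (nat \<times> nat) set \<Rightarrow> nat set set" where
  "Lambda w P Q =
     {S. S \<subseteq> crossings_on w (P \<union> Q) \<and> card S = pair_span w P Q \<and>
         pair_span (virtualize S w) P Q = 0}"

definition ell :: "diag \<Rightarrow> (nat \<times> nat) set \<Rightarrow> (nat \<times> nat) set \<Rightarrow> real" where
  "ell w P Q = Min ((\<lambda>S. \<bar>linking_number (virtualize S w) P Q\<bar>) ` Lambda w P Q)"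


section \<open>Writhes of a component\<close>

text \<open>
  \<open>open_arc w x y\<close> consists of the points met strictly after \<open>x\<close> and strictly before the next
  visit to \<open>y\<close> when following the orientation from \<open>x\<close>.
\<close>

definition open_arc :: "diag \<Rightarrow> nat \<times> nat \<Rightarrow> nat \<times> nat \<Rightarrow> (nat \<times> nat) set" where
  "open_arc w x y =
     {(next_point w ^^ k) x | k. 0 < k \<and> (\<forall>j. 0 < j \<and> j \<le> k \<longrightarrow> (next_point w ^^ j) x \<noteq> y)}"

text \<open>
  In the Gauss diagram the circle is oriented counterclockwise, so the arc from the tail
  (over-passage) to the head (under-passage) of a chord lies on its right.
\<close>

definition right_to_left :: "diag \<Rightarrow> nat \<Rightarrow> nat \<Rightarrow> bool" where
  "right_to_left w c d \<longleftrightarrow>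
     over_point w d \<in> open_arc w (over_point w c) (under_point w c) \<and>
     under_point w d \<in> open_arc w (under_point w c) (over_point w c)"

definition left_to_right :: "diag \<Rightarrow> nat \<Rightarrow> nat \<Rightarrow> bool" where
  "left_to_right w c d \<longleftrightarrow>
     over_point w d \<in> open_arc w (under_point w c) (over_point w c) \<and>
     under_point w d \<in> open_arc w (over_point w c) (under_point w c)"

definition Ind :: "diag \<Rightarrow> (nat \<times> nat) set \<Rightarrow> nat \<Rightarrow> int" where
  "Ind w P c =
    (let r_pos = int (card {d \<in> crossings_on w P. crossing_sign w d = 1 \<and> right_to_left w c d});
         r_neg = int (card {d \<in> crossings_on w P. crossing_sign w d = - 1 \<and> right_to_left w c d});
         l_pos = int (card {d \<in> crossings_on w P. crossing_sign w d = 1 \<and> left_to_right w c d});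
         l_neg = int (card {d \<in> crossings_on w P. crossing_sign w d = - 1 \<and> left_to_right w c d})
     in r_pos - r_neg - l_pos + l_neg)"

definition writhe :: "int \<Rightarrow> diag \<Rightarrow> (nat \<times> nat) set \<Rightarrow> int" where
  "writhe k w P = (\<Sum>c \<in> {c \<in> crossings_on w P. Ind w P c = k}. crossing_sign w c)"

text \<open>
  The sum of \<open>\<bar>J\<^sub>k\<bar>\<close> over all \<open>k \<noteq> 0\<close> is restricted to the finitely many nonzero terms,
  because \<^const>\<open>sum\<close> vanishes on infinite sets.
\<close>

definition total_writhe :: "diag \<Rightarrow> (nat \<times> nat) set \<Rightarrow> int" where
  "total_writhe w P = (\<Sum>k \<in> {k. k \<noteq> 0 \<and> writhe k w P \<noteq> 0}. \<bar>writhe k w P\<bar>)"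

end

theory Submission
  imports Defs
begin

text \<open>
  Colour the strands of a diagram by its components and label them by integers such that the label
  of a strand changes by 1 or \<open>-1\<close> at each classical crossing with its own component, according to
  the side from which it crosses the other strand.  The label difference at a self-crossing is
  then its index.  Such a decoration is a local datum: across a move it can be continued from the
  outside, and the signed number of crossings with given colours and given label difference is
  the same on both sides of the move.  Hence the one-sided linking numbers of any two components
  and the writhes \<open>J\<^sub>k\<close> of every component are invariants, and they vanish for a trivial diagram.

  Virtualizing or changing a crossing alters these numbers in a controlled way.  To reach 0 from a
  pair with one-sided linking numbers \<open>x\<close> and \<open>y\<close> one has to virtualize at least \<open>\<bar>x - y\<bar>\<close>
  crossings, and if no more are virtualized, the remaining linking number lies between \<open>x\<close> and
  \<open>y\<close> and must be removed by crossing changes; the number \<open>\<ell>\<close> is the distance of 0 from this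
  interval.  Each change of a self-crossing lowers the sum of the \<open>\<bar>J\<^sub>k\<bar>\<close> by at most 2.

  The minimum defining the unknotting index is taken over a nonempty set because a diagram with
  virtual crossings only is trivial: its lowest maximum can be pushed down until it cancels a
  minimum or closes a circle.
\<close>

section \<open>Decorated strands\<close>

text \<open>The index of a crossing is defined by arcs, hence globally, and the two sides of a move
  have different points and components. Labels turn the index into a difference read at the crossing
  itself. They exist because following a component meets each self-crossing once with change 1 and
  once with change -1, so the label returns to its initial value. Colours replace an explicit
  matching of components. The delicate point is that distinct components keep distinct colours
  across a move; it rests on the fact that no move contains a closed circle. The span enters because
  a changed linking crossing leaves one of the two one-sided sums and joins the other with the
  opposite sign: both sums fall by the same amount and their difference stays. Only virtualizing can
  close that gap, by at most 1 per crossing. The factor 1/2 enters because a changed self-crossing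
  of index k reappears with the opposite sign and index -k, which affects two of the writhes at
  once. If exactly span many crossings are virtualized, all of them are linking crossings, so
  crossing changes alone must deal with the self-crossings.\<close>

type_synonym 'c strand = "bool \<times> 'c \<times> int"

definition updown :: "bool \<Rightarrow> int" where "updown b = (if b then 1 else -1)"

definition interact :: "kind \<Rightarrow> 'c strand \<Rightarrow> 'c strand \<Rightarrow> bool" where
  "interact k A B \<longleftrightarrow> k \<noteq> Virtual \<and> fst (snd A) = fst (snd B)"

definition relabel :: "int \<Rightarrow> 'c strand \<Rightarrow> 'c strand" where
  "relabel d A = (fst A, fst (snd A), snd (snd A) + d)"

text \<open>Following a strand, the label grows by 1 where the other strand passes from right to
  left and drops by 1 where it passes from left to right. The two shifts record this change read
  upwards, for the strands from the lower left and from the lower right. Over and under do not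
  enter, so a crossing change keeps all labels.\<close>

definition left_shift :: "kind \<Rightarrow> 'c strand \<Rightarrow> 'c strand \<Rightarrow> int" where
  "left_shift k A B = (if interact k A B then updown (fst B) else 0)"

definition right_shift :: "kind \<Rightarrow> 'c strand \<Rightarrow> 'c strand \<Rightarrow> int" where
  "right_shift k A B = (if interact k A B then - updown (fst A) else 0)"

text \<open>The argument \<open>e\<close> is the colour and label of the legs of a minimum, which
  the row below cannot determine. It is quantified in \<open>exec\<close>, so a minimum can absorb
  any common shift of its legs.\<close>

fun dstep :: "'c \<times> int \<Rightarrow> piece \<times> nat \<Rightarrow> 'c strand list \<Rightarrow> 'c strand list option" where
  "dstep e (Cup b, i) s =
     (if i \<le> length s then Some (take i s @ [(b, e), (\<not> b, e)] @ drop i s) else None)"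
| "dstep e (Cap, i) s =
     (if Suc i < length s \<and> fst (s ! i) \<noteq> fst (s ! Suc i) \<and> snd (s ! i) = snd (s ! Suc i)
      then Some (take i s @ drop (i + 2) s) else None)"
| "dstep e (Cross k, i) s =
     (if Suc i < length s
      then Some (take i s @ [relabel (right_shift k (s ! i) (s ! Suc i)) (s ! Suc i),
                  relabel (left_shift k (s ! i) (s ! Suc i)) (s ! i)] @ drop (i + 2) s)
      else None)"

definition over_strand :: "kind \<Rightarrow> 'a \<Rightarrow> 'a \<Rightarrow> 'a" where
  "over_strand k A B = (if k = Over then A else B)"

definition ssign :: "kind \<Rightarrow> 'c strand \<Rightarrow> 'c strand \<Rightarrow> int" where
  "ssign k A B = (if k = Over then 1 else -1) * (if fst A = fst B then 1 else -1)"

text \<open>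
  The label before the under-passage minus the label after the over-passage.  The strands are
  those below the crossing, so on a downward strand the passage has already taken place.
\<close>

definition sindex :: "int \<Rightarrow> 'c strand \<Rightarrow> 'c strand \<Rightarrow> int" where
  "sindex g X Y = (if fst (snd X) = fst (snd Y)
     then snd (snd Y) + (if fst Y then 0 else g) - (snd (snd X) - (if fst X then 0 else g)) - g else 0)"

text \<open>Self-crossings of index 0 are not counted, since RI creates and removes them.\<close>

definition event :: "kind \<Rightarrow> 'c strand \<Rightarrow> 'c strand \<Rightarrow> 'c \<times> 'c \<times> int \<Rightarrow> int" where
  "event k A B key = (let X = over_strand k A B; Y = over_strand k B A; g = ssign k A B;
       c = fst (snd X); d = fst (snd Y); n = sindex g X Y
     in if k \<noteq> Virtual \<and> \<not> (c = d \<and> n = 0) \<and> key = (c, d, n) then g else 0)"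

fun weight :: "piece \<times> nat \<Rightarrow> 'c strand list \<Rightarrow> 'c \<times> 'c \<times> int \<Rightarrow> int" where
  "weight (Cross k, i) s = event k (s ! i) (s ! Suc i)"
| "weight (Cup b, i) s = (\<lambda>_. 0)"
| "weight (Cap, i) s = (\<lambda>_. 0)"

text \<open>A relation between outer rows and total weight: the two sides of a move agree once the
  labels chosen at inner minima are quantified away.\<close>

fun exec :: "diag \<Rightarrow> 'c strand list \<Rightarrow> ('c \<times> 'c \<times> int \<Rightarrow> int) \<Rightarrow> 'c strand list \<Rightarrow> bool" where
  "exec [] s f s' \<longleftrightarrow> s' = s \<and> f = (\<lambda>_. 0)"
| "exec (x # w) s f s' \<longleftrightarrow> (\<exists>e s1 g. dstep e x s = Some s1 \<and> exec w s1 g s' \<and>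
      f = (\<lambda>k. weight x s k + g k))"

lemmas strand_defs = left_shift_def right_shift_def interact_def relabel_def updown_def
  event_def over_strand_def ssign_def sindex_def Let_def

section \<open>Splitting a row around the legs of a piece\<close>

lemma nth_length[simp]: "(p @ a # q) ! length p = a" "(p @ a # b # q) ! Suc (length p) = b"
  "(p @ a # b # c # q) ! Suc (Suc (length p)) = c"
  by (simp_all add: nth_append)

lemma split_at_1: "i < length s \<Longrightarrow> \<exists>p a q. s = p @ a # q \<and> i = length p"
  by (metis id_take_nth_drop length_take min.absorb4)

lemma split_at_2: "Suc i < length s \<Longrightarrow> \<exists>p a b q. s = p @ a # b # q \<and> i = length p"
  by (metis Cons_nth_drop_Suc Suc_lessD append_take_drop_id length_take min.absorb4)

lemma split_at_3: "Suc (Suc i) < length s \<Longrightarrow> \<exists>p a b c q. s = p @ a # b # c # q \<and> i = length p"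
  by (metis Cons_nth_drop_Suc Suc_lessD append_take_drop_id length_take min.absorb4)


lemma attach_decompose [consumes 1, case_names Cup Cap Cross]:
  assumes "attach (x, i) s = Some t"
  obtains b p q where "x = Cup b" "i = length p" "s = p @ q" "t = p @ b # (\<not> b) # q"
    | a b p q where "x = Cap" "i = length p" "s = p @ a # b # q" "a \<noteq> b" "t = p @ q"
    | k a b p q where "x = Cross k" "i = length p" "s = p @ a # b # q" "t = p @ b # a # q"
proof (cases x)
  case (Cup b)
  then have "i \<le> length s" using assms by (auto split: if_splits)
  then obtain p q where s: "s = p @ q" and i: "i = length p"
    by (metis append_take_drop_id length_take min.absorb2)
  show ?thesis using assms by (intro that(1)[OF Cup i s]) (simp add: Cup s i)
next
  case Cap
  then obtain p a b q where s: "s = p @ a # b # q" and i: "i = length p"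
    using split_at_2[of i s] assms by (auto split: if_splits)
  show ?thesis using assms by (intro that(2)[OF Cap i s]) (auto simp: Cap s i split: if_splits)
next
  case (Cross k)
  then obtain p a b q where s: "s = p @ a # b # q" and i: "i = length p"
    using split_at_2[of i s] assms by (auto split: if_splits)
  show ?thesis using assms by (intro that(3)[OF Cross i s]) (simp add: Cross s i)
qed

lemma dstep_decompose [consumes 1, case_names Cup Cap Cross]:
  assumes "dstep e (x, i) s = Some t"
  obtains b p q where "x = Cup b" "i = length p" "s = p @ q" "t = p @ (b, e) # (\<not> b, e) # q"
    | a b p q where "x = Cap" "i = length p" "s = p @ a # b # q" "fst a \<noteq> fst b" "snd a = snd b" "t = p @ q"
    | k a b p q where "x = Cross k" "i = length p" "s = p @ a # b # q"
        "t = p @ relabel (right_shift k a b) b # relabel (left_shift k a b) a # q"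
proof (cases x)
  case (Cup b)
  then have "i \<le> length s" using assms by (auto split: if_splits)
  then obtain p q where s: "s = p @ q" and i: "i = length p"
    by (metis append_take_drop_id length_take min.absorb2)
  show ?thesis using assms by (intro that(1)[OF Cup i s]) (simp add: Cup s i)
next
  case Cap
  then obtain p a b q where s: "s = p @ a # b # q" and i: "i = length p"
    using split_at_2[of i s] assms by (auto split: if_splits)
  show ?thesis using assms by (intro that(2)[OF Cap i s]) (auto simp: Cap s i split: if_splits)
next
  case (Cross k)
  then obtain p a b q where s: "s = p @ a # b # q" and i: "i = length p"
    using split_at_2[of i s] assms by (auto split: if_splits)
  show ?thesis using assms by (intro that(3)[OF Cross i s]) (simp add: Cross s i)
qed

section \<open>Relabelling strands and its effect on shifts and events\<close>

lemma relabel_simps [simp]: "fst (relabel d A) = fst A" "fst (snd (relabel d A)) = fst (snd A)"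
  "snd (snd (relabel d A)) = snd (snd A) + d" "relabel d (relabel e A) = relabel (e + d) A"
  "relabel 0 A = A"
  by (simp_all add: relabel_def)

lemma interact_relabel [simp]: "interact k (relabel d A) B = interact k A B"
  "interact k A (relabel d B) = interact k A B"
  by (simp_all add: interact_def)

lemma shift_relabel [simp]: "left_shift k (relabel d A) B = left_shift k A B"
  "left_shift k A (relabel d B) = left_shift k A B"
  "right_shift k (relabel d A) B = right_shift k A B"
  "right_shift k A (relabel d B) = right_shift k A B"
  by (simp_all add: left_shift_def right_shift_def)

text \<open>Labels enter an event only through their difference, and only on strands of equal
  colour.\<close>

lemma event_relabel: "(fst (snd A) = fst (snd B) \<Longrightarrow> d = e) \<Longrightarrow>
   event k (relabel d A) (relabel e B) = event k A B"
  by (auto simp: event_def over_strand_def ssign_def sindex_def Let_def fun_eq_iff)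

lemma event_Virtual [simp]: "event Virtual A B = (\<lambda>_. 0)"
  by (simp add: event_def fun_eq_iff Let_def)

lemma shift_Virtual [simp]: "left_shift Virtual A B = 0" "right_shift Virtual A B = 0"
  by (simp_all add: left_shift_def right_shift_def interact_def)

lemma shift_flip [simp]: "left_shift (flip k) A B = left_shift k A B"
  "right_shift (flip k) A B = right_shift k A B"
  by (cases k; simp add: left_shift_def right_shift_def interact_def)+

section \<open>Decorated execution is the same on both sides of each move\<close>

lemma exec_kink_cup: "exec [(Cup b, i), (Cross k, i)] s f s' \<longleftrightarrow> exec [(Cup (\<not> b), i)] s f s'"
proof (cases "i \<le> length s")
  case True
  then obtain p q where s: "s = p @ q" and i: "i = length p"
    by (metis append_take_drop_id length_take min.absorb2)
  \<comment> \<open>One leg points up and the other down, so the two corrections by the sign in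
    \<open>sindex\<close> add up to one sign and leave index 0, which is not counted.\<close>
  have ev: "event k (b, e) (\<not> b, e) = (\<lambda>_. 0)" for e :: "'a \<times> int"
    by (cases k; cases b; simp add: event_def over_strand_def ssign_def sindex_def Let_def fun_eq_iff)
  \<comment> \<open>Both legs are shifted by the same \<open>d\<close>, which the free label of the
    minimum on the other side absorbs.\<close>
  define d where "d = (if k = Virtual then 0 else updown (\<not> b))"
  have sh: "left_shift k (b, e) (\<not> b, e) = d" "right_shift k (b, e) (\<not> b, e) = d" for e :: "'a \<times> int"
    by (cases b; simp add: d_def left_shift_def right_shift_def interact_def updown_def)+
  have "exec [(Cup b, i), (Cross k, i)] s f s' \<longleftrightarrow> 
      (\<exists>c l. s' = p @ (\<not> b, c, l + d) # (b, c, l + d) # q) \<and> f = (\<lambda>_. 0)"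
    by (auto simp add: s i ev sh relabel_def)
  also have "\<dots> \<longleftrightarrow> (\<exists>c l. s' = p @ (\<not> b, c, l) # (b, c, l) # q) \<and> f = (\<lambda>_. 0)"
    by (metis diff_add_cancel)
  also have "\<dots> \<longleftrightarrow> exec [(Cup (\<not> b), i)] s f s'"
    by (auto simp add: s i)
  finally show ?thesis .
qed auto

lemma exec_kink_cap: "exec [(Cross k, i), (Cap, i)] s f s' \<longleftrightarrow> exec [(Cap, i)] s f s'"
proof (cases "Suc i < length s")
  case True
  then obtain p a b q where s: "s = p @ a # b # q" and i: "i = length p" using split_at_2 by blast
  have sh: "right_shift k a b = left_shift k a b" if "fst a \<noteq> fst b"
    using that by (auto simp: left_shift_def right_shift_def interact_def updown_def)
  have sh': "snd (relabel d b) = snd (relabel d a) \<longleftrightarrow> snd a = snd b" for d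
    by (cases a; cases b) (auto simp: relabel_def)
  have ev: "event k a b = (\<lambda>_. 0)" if "fst a \<noteq> fst b" "snd a = snd b"
    using that by (cases a; cases b; cases k) (auto simp add: event_def sindex_def ssign_def over_strand_def Let_def fun_eq_iff)
  have "exec [(Cross k, i), (Cap, i)] s f s' \<longleftrightarrow> 
      fst a \<noteq> fst b \<and> snd a = snd b \<and> s' = p @ q \<and> f = event k a b"
    by (simp add: s i) (metis sh sh')
  also have "\<dots> \<longleftrightarrow> exec [(Cap, i)] s f s'"
    using ev by (auto simp add: s i)
  finally show ?thesis .
qed auto

text \<open>Only the leg that is crossed gets shifted, so the labels of the two legs above differ by
  \<open>d c\<close> whichever leg it is. Starting the minimum with a label changed by
  \<open>d c\<close> yields the same upper row.\<close>

lemma exec_slide_cup: "exec [(Cup b, i), (Cross k, Suc i)] s f s' \<longleftrightarrow>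
   exec [(Cup b, Suc i), (Cross (flip k), i)] s f s'"
proof (cases "i < length s")
  case True
  then obtain p a q where s: "s = p @ a # q" and i: "i = length p" using split_at_1 by blast
  define A where "A = (\<lambda>e. (b, e) :: 'a strand)"
  define B where "B = (\<lambda>e. (\<not> b, e) :: 'a strand)"
  define d where "d = (\<lambda>c. if k \<noteq> Virtual \<and> c = fst (snd a) then updown (fst a) else 0)"
  define r where "r = (\<lambda>c. if k \<noteq> Virtual \<and> c = fst (snd a) then - updown (\<not> b) else 0)"
  have sh: "left_shift k (\<not> b, c, l) a = d c" "right_shift k (\<not> b, c, l) a = r c"
     "left_shift k a (b, c, l) = r c" "right_shift k a (b, c, l) = - d c" for c l
    by (auto simp: left_shift_def right_shift_def d_def r_def interact_def updown_def)
  have re: "relabel x (y, c, l) = (y, c, l + x)" for x y and c :: 'a and l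
    by (simp add: relabel_def)
  have ev: "event (flip k) a (b, c, l) = event k (\<not> b, c, l - d c) a" for c l
    unfolding event_def
    apply (rule ext)
    apply (cases k; cases b; cases "fst a"; cases "c = fst (snd a)")
    by (simp_all add: d_def over_strand_def ssign_def sindex_def updown_def Let_def)
  have 1: "exec [(Cup b, i), (Cross k, Suc i)] s f s' \<longleftrightarrow>
      (\<exists>c l. s' = p @ (b, c, l) # relabel (r c) a # (\<not> b, c, l + d c) # q \<and>
          f = event k (\<not> b, c, l) a)"
    by (simp add: s i nth_append split_paired_Ex sh re) blast
  have 2: "exec [(Cup b, Suc i), (Cross (flip k), i)] s f s' \<longleftrightarrow>
      (\<exists>c l. s' = p @ (b, c, l - d c) # relabel (r c) a # (\<not> b, c, l) # q \<and>
          f = event k (\<not> b, c, l - d c) a)"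
    by (simp add: s i nth_append split_paired_Ex sh re ev) blast
  show ?thesis unfolding 1 2
    apply (rule iff_exI)
    apply safe
    subgoal for c l by (rule exI[of _ "l + d c"]) simp
    subgoal for c l by (rule exI[of _ "l - d c"]) simp
    done
qed auto

lemma exec_slide_cap: "exec [(Cross k, Suc i), (Cap, i)] s f s' \<longleftrightarrow>
   exec [(Cross (flip k), i), (Cap, Suc i)] s f s'"
proof (cases "Suc (Suc i) < length s")
  case True
  then obtain p a b c q where s: "s = p @ a # b # c # q" and i: "i = length p" using split_at_3 by blast
  have 1: "snd a = snd (relabel (right_shift k b c) c) \<longleftrightarrow> snd (relabel (left_shift k a b) a) = snd c"
    if "fst a \<noteq> fst c"
    using that by (cases a; cases b; cases c) (auto simp: strand_defs)
  have 2: "left_shift k b c = right_shift k a b" if "fst a \<noteq> fst c" "snd a = snd (relabel (right_shift k b c) c)"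
    using that by (cases a; cases b; cases c) (auto simp: strand_defs)
  have 3: "event k b c = event (flip k) a b" if "fst a \<noteq> fst c" "snd a = snd (relabel (right_shift k b c) c)"
    using that by (cases k; cases a; cases b; cases c) (auto simp: strand_defs fun_eq_iff)
  show ?thesis
    using 1 2 3 by (auto simp add: s i nth_append)
qed auto

text \<open>The same strand passes over at both crossings, with equal index and opposite signs: the
  events cancel, and the second crossing undoes the label shifts of the first.\<close>

lemma exec_bigon: "Suc i < length s \<Longrightarrow> exec [(Cross k, i), (Cross (flip k), i)] s f s' \<longleftrightarrow> exec [] s f s'"
proof -
  assume "Suc i < length s"
  then obtain p a b q where s: "s = p @ a # b # q" and i: "i = length p" using split_at_2 by blast
  define A where "A = relabel (left_shift k a b) a"
  define B where "B = relabel (right_shift k a b) b"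
  have g: "ssign (flip k) B A = - ssign k a b" if "k \<noteq> Virtual"
    using that by (cases k) (auto simp: ssign_def A_def B_def)
  have ind: "sindex (- ssign k a b) (over_strand (flip k) B A) (over_strand (flip k) A B)
      = sindex (ssign k a b) (over_strand k a b) (over_strand k b a)" if "k \<noteq> Virtual"
    using that
    by (cases k; cases "fst a"; cases "fst b")
       (auto simp: A_def B_def sindex_def over_strand_def ssign_def left_shift_def right_shift_def
          interact_def updown_def)
  have col: "fst (snd (over_strand (flip k) B A)) = fst (snd (over_strand k a b))"
     "fst (snd (over_strand (flip k) A B)) = fst (snd (over_strand k b a))" if "k \<noteq> Virtual"
    using that by (cases k; simp add: over_strand_def A_def B_def)+
  have 1: "event k a b key + event (flip k) B A key = 0" for key
  proof (cases "k = Virtual")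
    case False
    then have "flip k \<noteq> Virtual" by (cases k) auto
    then show ?thesis
      using False unfolding event_def Let_def g[OF False] ind[OF False] col[OF False] by simp
  qed simp
  have 2: "right_shift k a b + left_shift k b a = 0" "left_shift k a b + right_shift k b a = 0"
    by (auto simp: left_shift_def right_shift_def interact_def)
  have 3: "left_shift (flip k) B A = left_shift k b a" "right_shift (flip k) B A = right_shift k b a"
    by (simp_all add: A_def B_def)
  have "exec [(Cross k, i), (Cross (flip k), i)] s f s' \<longleftrightarrow> s' =
      p @ relabel (right_shift (flip k) B A) A # relabel (left_shift (flip k) B A) B # q \<and>
      f = (\<lambda>key. event k a b key + event (flip k) B A key)"
    by (auto simp: s i A_def B_def simp del: relabel_simps shift_relabel shift_flip)
  also have "\<dots> \<longleftrightarrow> exec [] s f s'"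
    unfolding 1 3 by (simp add: A_def B_def 2 s)
  finally show ?thesis .
qed

lemma event_relabel':
  assumes "k \<noteq> Virtual \<Longrightarrow> fst (snd A) = fst (snd B) \<Longrightarrow> d + e' = d' + e"
  shows "event k (relabel d A) (relabel e B) = event k (relabel d' A) (relabel e' B)"
proof (cases "k = Virtual")
  case False
  have "event k (relabel (d' - d) (relabel d A)) (relabel (e' - e) (relabel e B))
      = event k (relabel d A) (relabel e B)"
    using assms False by (intro event_relabel) (simp add: algebra_simps)
  then show ?thesis by simp
qed simp

text \<open>On the two sides of the move, a crossing sees its strands before or after they meet the
  third strand. For strands of equal colour the label difference at the crossing is the same both
  times, provided the other two crossings are both classical or both virtual. The facts
  \<open>V\<close> express this proviso for the three crossings; a triangle with exactly one virtual
  crossing, as in the forbidden moves, violates it.\<close>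

lemma exec_triangle: assumes "{a, b, c} \<subseteq> {Over, Under} \<or>
   (a,b,c) \<in> {(k, Virtual, Virtual), (Virtual, k, Virtual), (Virtual, Virtual, k)}"
  shows "exec [(Cross a, i), (Cross b, Suc i), (Cross c, i)] s f s' \<longleftrightarrow>
          exec [(Cross c, Suc i), (Cross b, i), (Cross a, Suc i)] s f s'"
proof (cases "Suc (Suc i) < length s")
  case True
  then obtain p A B C q where s: "s = p @ A # B # C # q" and i: "i = length p" using split_at_3 by blast
  have V: "a = Virtual \<or> (b = Virtual \<longleftrightarrow> c = Virtual)" "b = Virtual \<or> (a = Virtual \<longleftrightarrow> c = Virtual)"
     "c = Virtual \<or> (b = Virtual \<longleftrightarrow> a = Virtual)" using assms by auto
  have 1: "event a (relabel (left_shift b A C) A) (relabel (left_shift c B C) B) = event a A B"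
    using V(1) event_relabel'[of a A B "left_shift b A C" 0 0 "left_shift c B C"]
    by (auto simp: left_shift_def interact_def)
  have 2: "event b (relabel (left_shift a A B) A) C = event b A (relabel (right_shift c B C) C)"
    using V(2) event_relabel'[of b A C "left_shift a A B" "right_shift c B C" 0 0]
    by (auto simp: left_shift_def right_shift_def interact_def)
  have 3: "event c (relabel (right_shift a A B) B) (relabel (right_shift b A C) C) = event c B C"
    using V(3) event_relabel'[of c B C "right_shift a A B" 0 0 "right_shift b A C"]
    by (auto simp: right_shift_def interact_def)
  show ?thesis
    by (simp add: s i nth_append 1 2 3 add.commute[of "left_shift a A B"] add.commute[of "right_shift b A C"]
      add.commute[of "right_shift a A B"] del: split_paired_Ex) (auto simp: ac_simps fun_eq_iff)
qed auto
text \<open>Abstracts from the entries of a row: the exchange of heights is used for decorated rows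
  and again for plain rows of directions.\<close>

definition acts_locally :: "(nat \<Rightarrow> 'a list \<Rightarrow> 'a list \<Rightarrow> bool) \<Rightarrow> nat \<Rightarrow> nat \<Rightarrow> bool" where
  "acts_locally F a b \<longleftrightarrow> (\<forall>i s t. F i s t \<longrightarrow> (\<exists>p m m' q. s = p @ m @ q \<and> t = p @ m' @ q \<and> length p = i \<and>
     length m = a \<and> length m' = b \<and> (\<forall>p q. F (length p) (p @ m @ q) (p @ m' @ q))))"

lemma acts_locallyE:
  assumes "acts_locally F a b" "F i s t"
  obtains p m m' q where "s = p @ m @ q" "t = p @ m' @ q" "length p = i" "length m = a" "length m' = b"
    "\<And>p q. F (length p) (p @ m @ q) (p @ m' @ q)"
proof -
  have "\<exists>p m m' q. s = p @ m @ q \<and> t = p @ m' @ q \<and> length p = i \<and>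
     length m = a \<and> length m' = b \<and> (\<forall>p q. F (length p) (p @ m @ q) (p @ m' @ q))"
    using assms unfolding acts_locally_def by simp
  then obtain p m m' q where "s = p @ m @ q \<and> t = p @ m' @ q \<and> length p = i \<and>
     length m = a \<and> length m' = b \<and> (\<forall>p q. F (length p) (p @ m @ q) (p @ m' @ q))"
    by (elim exE) (rule that)
  then show ?thesis by (intro that[of p m q m']) simp_all
qed

lemma height_swap:
  assumes F: "acts_locally F a b" and G: "acts_locally G a' b'" and le: "i + b \<le> j"
  shows "(\<exists>s1. F i s s1 \<and> G j s1 t) \<longleftrightarrow> (\<exists>s1. G (j - b + a) s s1 \<and> F i s1 t)"
proof safe
  fix s1 assume "F i s s1" "G j s1 t"
  obtain p m m' q where p: "s = p @ m @ q" "s1 = p @ m' @ q" "length p = i" "length m = a" "length m' = b"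
      "\<And>p q. F (length p) (p @ m @ q) (p @ m' @ q)"
    by (rule acts_locallyE[OF F \<open>F i s s1\<close>]) (rule that)
  obtain p2 n n' q2 where p2: "s1 = p2 @ n @ q2" "t = p2 @ n' @ q2" "length p2 = j" "length n = a'" "length n' = b'"
      "\<And>p q. G (length p) (p @ n @ q) (p @ n' @ q)"
    by (rule acts_locallyE[OF G \<open>G j s1 t\<close>]) (rule that)
  have "(p @ m') @ q = p2 @ n @ q2" "length (p @ m') \<le> length p2" using p p2 le by simp_all
  then obtain r where r: "p2 = p @ m' @ r" "q = r @ n @ q2" by (auto simp: append_eq_append_conv2)
  have "j - b + a = length (p @ m @ r)" using p(3-5) p2(3) r(1) by auto
  then show "\<exists>s1. G (j - b + a) s s1 \<and> F i s1 t"
    using p(6)[of p "r @ n' @ q2"] p2(6)[of "p @ m @ r" q2] unfolding p(1) p(3)[symmetric] p2(2) r by auto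
next
  fix s1 assume "G (j - b + a) s s1" "F i s1 t"
  obtain p m m' q where p: "s1 = p @ m @ q" "t = p @ m' @ q" "length p = i" "length m = a" "length m' = b"
      "\<And>p q. F (length p) (p @ m @ q) (p @ m' @ q)"
    by (rule acts_locallyE[OF F \<open>F i s1 t\<close>]) (rule that)
  obtain p2 n n' q2 where p2: "s = p2 @ n @ q2" "s1 = p2 @ n' @ q2" "length p2 = j - b + a"
      "length n = a'" "length n' = b'" "\<And>p q. G (length p) (p @ n @ q) (p @ n' @ q)"
    by (rule acts_locallyE[OF G \<open>G (j - b + a) s s1\<close>]) (rule that)
  have "(p @ m) @ q = p2 @ n' @ q2" "length (p @ m) \<le> length p2" using p p2 le by simp_all
  then obtain r where r: "p2 = p @ m @ r" "q = r @ n' @ q2" by (auto simp: append_eq_append_conv2)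
  have "j = length (p @ m' @ r)" using p(3-5) p2(3) r(1) le by auto
  then show "\<exists>s1. F i s s1 \<and> G j s1 t"
    using p(6)[of p "r @ n @ q2"] p2(6)[of "p @ m' @ r" q2] unfolding p(2) p(3)[symmetric] p2(1) r by auto
qed

lemma dstep_local:
  assumes "dstep e (x, i) s = Some t"
  shows "\<exists>p m m' q. s = p @ m @ q \<and> t = p @ m' @ q \<and> length p = i \<and>
    length m = legs_below x \<and> length m' = legs_above x \<and>
    (\<forall>p q. dstep e (x, length p) (p @ m @ q) = Some (p @ m' @ q) \<and>
      weight (x, length p) (p @ m @ q) = weight (x, i) s)"
  using assms
proof (cases rule: dstep_decompose)
  case (Cup b p q)
  then show ?thesis
    by (intro exI[of _ p] exI[of _ "[]"] exI[of _ "[(b, e), (\<not> b, e)]"] exI[of _ q]) simp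
next
  case (Cap a b p q)
  then show ?thesis by (intro exI[of _ p] exI[of _ "[a, b]"] exI[of _ "[]"] exI[of _ q]) simp
next
  case (Cross k a b p q)
  then show ?thesis
    by (intro exI[of _ p] exI[of _ "[a, b]"] exI[of _ q]
        exI[of _ "[relabel (right_shift k a b) b, relabel (left_shift k a b) a]"]) simp
qed

lemma exec_two: "exec [x, y] s f t \<longleftrightarrow> (\<exists>e e' s1. dstep e x s = Some s1 \<and> dstep e' y s1 = Some t \<and>
    f = (\<lambda>k. weight x s k + weight y s1 k))"
  by (simp del: split_paired_Ex) blast

lemma exec_height:
  assumes "i + legs_above x \<le> j"
  shows "exec [(x, i), (y, j)] s f t \<longleftrightarrow> exec [(y, j - legs_above x + legs_below x), (x, i)] s f t"
proof -
  define F where "F e g z i s t \<longleftrightarrow> dstep e (z, i) s = Some t \<and> weight (z, i) s = g"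
    for e :: "'a \<times> int" and g z i s t
  have local: "acts_locally (F e g z) (legs_below z) (legs_above z)" for e g z
    unfolding acts_locally_def
  proof (intro allI impI)
    fix i s t assume "F e g z i s t"
    then have "dstep e (z, i) s = Some t" "weight (z, i) s = g" by (simp_all add: F_def)
    then show "\<exists>p m m' q. s = p @ m @ q \<and> t = p @ m' @ q \<and> length p = i \<and> length m = legs_below z \<and>
        length m' = legs_above z \<and> (\<forall>p q. F e g z (length p) (p @ m @ q) (p @ m' @ q))"
      using dstep_local[of e z i s t] by (simp add: F_def)
  qed
  have two: "exec [(z, k), (z', k')] s f t \<longleftrightarrow> (\<exists>e g e' g'. (\<exists>s1. F e g z k s s1 \<and> F e' g' z' k' s1 t) \<and>
      f = (\<lambda>key. g key + g' key))" for z z' k k'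
    unfolding exec_two F_def by blast
  have swap: "(\<exists>s1. F e g x i s s1 \<and> F e' g' y j s1 t) \<longleftrightarrow>
      (\<exists>s1. F e' g' y (j - legs_above x + legs_below x) s s1 \<and> F e g x i s1 t)" for e g e' g'
    by (rule height_swap[OF local local assms])
  have comm: "(\<lambda>key. g key + g' key) = (\<lambda>key. g' key + g key)" for g g' :: "'a \<times> 'a \<times> int \<Rightarrow> int"
    by (simp add: add.commute)
  show ?thesis
  proof
    assume "exec [(x, i), (y, j)] s f t"
    then obtain e g e' g' where "\<exists>s1. F e' g' y (j - legs_above x + legs_below x) s s1 \<and> F e g x i s1 t"
      and "f = (\<lambda>key. g key + g' key)" unfolding two swap by blast
    with comm[of g g'] show "exec [(y, j - legs_above x + legs_below x), (x, i)] s f t"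
      unfolding two by (metis (no_types))
  next
    assume "exec [(y, j - legs_above x + legs_below x), (x, i)] s f t"
    then obtain e g e' g' where "\<exists>s1. F e' g' y (j - legs_above x + legs_below x) s s1 \<and> F e g x i s1 t"
      and "f = (\<lambda>key. g' key + g key)" unfolding two by blast
    with comm[of g' g] show "exec [(x, i), (y, j)] s f t"
      unfolding two swap by (metis (no_types))
  qed
qed

lemma exec_zigzag_right: "i < length s \<Longrightarrow> fst (s ! i) = b \<Longrightarrow> exec [(Cup b, i), (Cap, Suc i)] s f t \<longleftrightarrow> exec [] s f t"
proof -
  assume a: "i < length s" "fst (s ! i) = b"
  then obtain p a q where s: "s = p @ a # q" and i: "i = length p" using split_at_1 by blast
  show ?thesis
    using a by (cases a) (auto simp add: s i nth_append)
qed

lemma exec_zigzag_left: "i < length s \<Longrightarrow> fst (s ! i) \<noteq> b \<Longrightarrow> exec [(Cup b, Suc i), (Cap, i)] s f t \<longleftrightarrow> exec [] s f t"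
proof -
  assume a: "i < length s" "fst (s ! i) \<noteq> b"
  then obtain p a q where s: "s = p @ a # q" and i: "i = length p" using split_at_1 by blast
  show ?thesis
    using a by (cases a) (auto simp add: s i nth_append)
qed

lemma zigzag_fits: 
  "attach_all [(Cup b, i), (Cap, Suc i)] s \<noteq> None \<Longrightarrow> i < length s \<and> s ! i = b"
  "attach_all [(Cup b, Suc i), (Cap, i)] s \<noteq> None \<Longrightarrow> i < length s \<and> s ! i \<noteq> b"
  by (auto split: if_splits simp: nth_append)

lemma bigon_fits: "attach_all [(Cross k, i), (Cross l, i)] s \<noteq> None \<Longrightarrow> Suc i < length s"
  by (auto split: if_splits)

text \<open>The second premise concerns moves with an empty side: the empty tangle executes on every
  row, whereas a bigon asks for two strands and a zigzag for a strand of the right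
  direction.\<close>

lemma move_exec:
  assumes "move l r" "attach_all l (map fst s) \<noteq> None"
  shows "exec l s f t \<longleftrightarrow> exec r s f t"
  using assms
proof (induction l r rule: move.induct)
  case (height i x j y)
  show ?case by (rule exec_height) (fact height(1))
next
  case (zigzag_right b i)
  from zigzag_fits(1)[OF this] show ?case by (intro exec_zigzag_right) auto
next
  case (zigzag_left b i)
  from zigzag_fits(2)[OF this] show ?case by (intro exec_zigzag_left) auto
next
  case (bigon k i)
  from bigon_fits[OF this] show ?case by (intro exec_bigon) auto
next
  case (RIII a b c i)
  show ?case by (rule exec_triangle) (use RIII in blast)
next
  case (VRIII i)
  show ?case by (rule exec_triangle) blast
next
  case (SV k a b c i)
  show ?case by (rule exec_triangle) (use SV in blast)
qed (rule exec_slide_cup exec_slide_cap exec_kink_cup exec_kink_cap)+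

section \<open>Decorations of whole diagrams\<close>

declare split_paired_Ex [simp del]

definition run :: "diag \<Rightarrow> (nat \<Rightarrow> 'c strand list) \<Rightarrow> bool" where
  "run w \<rho> \<longleftrightarrow> (\<forall>t<length w. \<exists>e. dstep e (w ! t) (\<rho> t) = Some (\<rho> (Suc t)))"

definition total_weight :: "diag \<Rightarrow> (nat \<Rightarrow> 'c strand list) \<Rightarrow> 'c \<times> 'c \<times> int \<Rightarrow> int" where
  "total_weight w \<rho> k = (\<Sum>t<length w. weight (w ! t) (\<rho> t) k)"

lemma run_step:
  assumes "run w \<rho>" "t < length w" obtains e where "dstep e (w ! t) (\<rho> t) = Some (\<rho> (Suc t))"
  using assms unfolding run_def by blast

lemma run_Nil [simp]: "run [] \<rho>" by (simp add: run_def)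

lemma run_append: "run (u @ v) \<rho> \<longleftrightarrow> run u \<rho> \<and> run v (\<lambda>t. \<rho> (length u + t))"
proof -
  have "(\<forall>t<length u + length v. P t) \<longleftrightarrow> (\<forall>t<length u. P t) \<and> (\<forall>t<length v. P (length u + t))" for P
  proof safe
    fix t assume "\<forall>t<length u. P t" "\<forall>t<length v. P (length u + t)" "t < length u + length v"
    then show "P t" by (cases "t < length u") (auto dest: spec[of _ "t - length u"])
  qed auto
  then show ?thesis by (simp add: run_def nth_append)
qed

lemma total_append: "total_weight (u @ v) \<rho> k = total_weight u \<rho> k + total_weight v (\<lambda>t. \<rho> (length u + t)) k"
proof -
  have "sum g {..<length u + length v} = sum g {..<length u} + (\<Sum>t<length v. g (length u + t))" for g :: "nat \<Rightarrow> int"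
    by (induction v) (simp_all add: add.assoc)
  then show ?thesis by (simp add: total_weight_def nth_append)
qed

lemma run_cong: "(\<And>t. t \<le> length w \<Longrightarrow> \<rho> t = \<rho>' t) \<Longrightarrow> run w \<rho> = run w \<rho>'"
  by (simp add: run_def)

lemma total_cong: "(\<And>t. t \<le> length w \<Longrightarrow> \<rho> t = \<rho>' t) \<Longrightarrow> total_weight w \<rho> k = total_weight w \<rho>' k"
  by (simp add: total_weight_def)

lemma run_Cons: "run (x # w) \<rho> \<longleftrightarrow> (\<exists>e. dstep e x (\<rho> 0) = Some (\<rho> 1)) \<and> run w (\<lambda>t. \<rho> (Suc t))"
  using run_append[of "[x]" w \<rho>] by (simp add: run_def)

lemma total_Cons: "total_weight (x # w) \<rho> k = weight x (\<rho> 0) k + total_weight w (\<lambda>t. \<rho> (Suc t)) k"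
  using total_append[of "[x]" w \<rho>] by (simp add: total_weight_def)

text \<open>Local comparison of tangles is done with \<open>exec\<close>; \<open>run\<close> gives
  access to the single rows, hence to points and components.\<close>

lemma exec_iff_run: "exec w s f t \<longleftrightarrow> (\<exists>\<rho>. run w \<rho> \<and> \<rho> 0 = s \<and> \<rho> (length w) = t \<and> f = total_weight w \<rho>)"
proof (induction w arbitrary: s f)
  case Nil
  then show ?case by (auto simp: total_weight_def fun_eq_iff intro: exI[of _ "\<lambda>_. s"])
next
  case (Cons x w)
  show ?case
  proof
    assume "exec (x # w) s f t"
    then obtain e s1 g where 1: "dstep e x s = Some s1" "exec w s1 g t" "f = (\<lambda>k. weight x s k + g k)"
      by auto
    then obtain \<rho> where "run w \<rho>" "\<rho> 0 = s1" "\<rho> (length w) = t" "g = total_weight w \<rho>"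
      unfolding Cons by blast
    then show "\<exists>\<rho>. run (x # w) \<rho> \<and> \<rho> 0 = s \<and> \<rho> (length (x # w)) = t \<and> f = total_weight (x # w) \<rho>"
      using 1 by (intro exI[of _ "case_nat s \<rho>"]) (simp add: run_Cons total_Cons fun_eq_iff del: split_paired_Ex, blast)
  next
    assume "\<exists>\<rho>. run (x # w) \<rho> \<and> \<rho> 0 = s \<and> \<rho> (length (x # w)) = t \<and> f = total_weight (x # w) \<rho>"
    then obtain \<rho> where r: "run (x # w) \<rho>" "\<rho> 0 = s" "\<rho> (length (x # w)) = t" "f = total_weight (x # w) \<rho>"
      by blast
    then obtain e where "dstep e x s = Some (\<rho> 1)" by (auto simp: run_Cons)
    moreover have "exec w (\<rho> 1) (total_weight w (\<lambda>t. \<rho> (Suc t))) t"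
      unfolding Cons using r by (intro exI[of _ "\<lambda>t. \<rho> (Suc t)"]) (simp add: run_Cons)
    ultimately show "exec (x # w) s f t"
      using r(2,4) by (auto simp: total_Cons fun_eq_iff simp del: split_paired_Ex)
  qed
qed

lemma dstep_attach: "dstep e x s = Some t \<Longrightarrow> attach x (map fst s) = Some (map fst t)"
  by (cases "(e, x, s)" rule: dstep.cases) (auto split: if_splits simp: take_map drop_map)

lemma attach_all_append: "attach_all (u @ v) s = Option.bind (attach_all u s) (attach_all v)"
  by (induction u arbitrary: s) (auto split: Option.bind_split)

lemma run_attach: "run w \<rho> \<Longrightarrow> t \<le> length w \<Longrightarrow> attach_all (take t w) (map fst (\<rho> 0)) = Some (map fst (\<rho> t))"
proof (induction t)
  case (Suc t)
  then obtain e where "dstep e (w ! t) (\<rho> t) = Some (\<rho> (Suc t))" using run_step[of w \<rho> t] by auto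
  from dstep_attach[OF this] Suc show ?case
    by (simp add: take_Suc_conv_app_nth attach_all_append)
qed simp

lemma run_row: "run w \<rho> \<Longrightarrow> \<rho> 0 = [] \<Longrightarrow> t \<le> length w \<Longrightarrow> row w t = map fst (\<rho> t)"
  using run_attach[of w \<rho> t] by (simp add: row_def)

section \<open>Colours that occur inside a move\<close>

definition cols :: "'c strand list \<Rightarrow> 'c set" where
  "cols s = (\<lambda>a. fst (snd a)) ` set s"

lemma cols_simps [simp]: "cols [] = {}" "cols (a # s) = insert (fst (snd a)) (cols s)"
  "cols (s @ t) = cols s \<union> cols t"
  by (simp_all add: cols_def image_Un)

lemma cols_Cross: assumes "dstep e (Cross k, i) s = Some t" shows "cols t = cols s"
  using assms by (cases rule: dstep_decompose) auto

lemma cols_Cap: assumes "dstep e (Cap, i) s = Some t" shows "cols t \<subseteq> cols s"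
  using assms by (cases rule: dstep_decompose) auto

lemma cols_Cup: assumes "dstep e (Cup b, i) s = Some t" shows "cols t = insert (fst e) (cols s)"
  using assms by (cases rule: dstep_decompose) auto

text \<open>For \<open>i = j\<close> the pieces close a circle, whose colour may occur neither below
  nor above. Otherwise at least one leg of the minimum survives the maximum.\<close>

lemma cols_Cup_Cap: 
  assumes "dstep e (Cup b, i) s = Some s1" "dstep e' (Cap, j) s1 = Some t" "i \<noteq> j"
  shows "cols s1 \<subseteq> cols s \<union> cols t"
proof -
  from assms have "i \<le> length s" by (auto split: if_splits)
  then obtain p q where s: "s = p @ q" and i: "i = length p"
    by (metis append_take_drop_id length_take min.absorb2)
  have s1: "s1 = p @ [(b, e), (\<not> b, e)] @ q" using assms by (simp add: s i)
  have t: "t = take j s1 @ drop (j + 2) s1" using assms(2) by (auto split: if_splits)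
  have "(b, e) \<in> set t \<or> (\<not> b, e) \<in> set t"
  proof (cases "j < i")
    case True
    then have "(\<not> b, e) \<in> set (drop (j + 2) s1)" unfolding s1 by (auto simp: i drop_Cons')
    then show ?thesis by (simp add: t)
  next
    case False
    then have "(b, e) \<in> set (take j s1)" using assms(3) unfolding s1 by (auto simp: i take_Cons')
    then show ?thesis by (simp add: t)
  qed
  then have "fst e \<in> cols t" by (force simp: cols_def)
  then show ?thesis using cols_Cup[OF assms(1)] by auto
qed

lemma cols_two: 
  assumes "dstep e (x, i) s = Some s1" "dstep e' (y, j) s1 = Some t" "\<And>b. x = Cup b \<Longrightarrow> y = Cap \<Longrightarrow> i \<noteq> j"
  shows "cols s1 \<subseteq> cols s \<union> cols t"
proof (cases x)
  case (Cup b)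
  show ?thesis
  proof (cases y)
    case (Cup b')
    have "cols s1 \<subseteq> cols t" using cols_Cup[OF assms(2)[unfolded Cup]] by blast
    then show ?thesis by blast
  next
    case Cap
    show ?thesis using cols_Cup_Cap[of e b i s s1 e' j t] assms Cup Cap by simp
  next
    case (Cross k)
    show ?thesis using cols_Cross[OF assms(2)[unfolded Cross]] by blast
  qed
next
  case Cap
  show ?thesis using cols_Cap[OF assms(1)[unfolded Cap]] by blast
next
  case (Cross k)
  show ?thesis using cols_Cross[OF assms(1)[unfolded Cross]] by blast
qed

definition smove :: "diag \<Rightarrow> diag \<Rightarrow> bool" where "smove l r \<longleftrightarrow> move l r \<or> move r l"

lemma run_inner_two:
  assumes "run [(x, i), (y, j)] \<rho>" "t \<le> 2" "\<And>b. x = Cup b \<Longrightarrow> y = Cap \<Longrightarrow> i \<noteq> j"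
  shows "cols (\<rho> t) \<subseteq> cols (\<rho> 0) \<union> cols (\<rho> 2)"
proof -
  have "t = 0 \<or> t = 1 \<or> t = 2" using assms(2) by auto
  moreover have "cols (\<rho> 1) \<subseteq> cols (\<rho> 0) \<union> cols (\<rho> 2)"
    using assms(1,3) cols_two[of _ x i "\<rho> 0" "\<rho> 1" _ y j "\<rho> 2"] by (simp add: run_Cons eval_nat_numeral) blast
  ultimately show ?thesis by auto
qed

lemma run_inner_Cross:
  assumes "run w \<rho>" "\<forall>x\<in>set w. \<exists>k. fst x = Cross k" "t \<le> length w"
  shows "cols (\<rho> t) = cols (\<rho> 0)"
  using assms(3)
proof (induction t)
  case (Suc t)
  then obtain e where d: "dstep e (w ! t) (\<rho> t) = Some (\<rho> (Suc t))" using run_step[OF assms(1), of t] by auto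
  obtain k where "fst (w ! t) = Cross k" using assms(2) Suc(2) nth_mem[of t w] by (meson Suc_le_lessD)
  then show ?case using d cols_Cross[of e k "snd (w ! t)"] Suc by (cases "w ! t") auto
qed simp

lemma smove_shape:
  assumes "smove l r"
  shows "length l \<le> 1 \<or> (\<forall>x\<in>set l. \<exists>k. fst x = Cross k) \<or>
    (\<exists>x i y j. l = [(x, i), (y, j)] \<and> (\<forall>b. x = Cup b \<longrightarrow> y = Cap \<longrightarrow> i \<noteq> j))"
  using assms unfolding smove_def by (elim disjE move.cases) auto

text \<open>No side of a move contains a closed circle, so every strand inside it reaches one of the
  two boundary rows. Components can therefore be recognised on the rows that the move leaves
  unchanged.\<close>

lemma run_inner:
  assumes "smove l r" "run l \<rho>" "t \<le> length l"
  shows "cols (\<rho> t) \<subseteq> cols (\<rho> 0) \<union> cols (\<rho> (length l))"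
proof -
  consider "length l \<le> 1" | "\<forall>x\<in>set l. \<exists>k. fst x = Cross k" 
    | x i y j where "l = [(x, i), (y, j)]" "\<forall>b. x = Cup b \<longrightarrow> y = Cap \<longrightarrow> i \<noteq> j"
    using smove_shape[OF assms(1)] by blast
  then show ?thesis
  proof cases
    case 1
    then have "t = 0 \<or> t = length l" using assms(3) by linarith
    then show ?thesis by auto
  next
    case 2
    then show ?thesis using run_inner_Cross[OF assms(2) 2 assms(3)] by blast
  next
    case 3
    have "length l = 2" using 3(1) by simp
    then show ?thesis using run_inner_two[of x i y j \<rho> t] 3 assms(2,3) \<open>length l = 2\<close> by metis
  qed
qed

definition point_col :: "(nat \<Rightarrow> 'c strand list) \<Rightarrow> nat \<times> nat \<Rightarrow> 'c" where
  "point_col \<rho> x = fst (snd (\<rho> (fst x) ! snd x))"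

lemma cols_eq_point_col: "cols (\<rho> t) = point_col \<rho> ` {x. fst x = t \<and> snd x < length (\<rho> t)}"
proof -
  have "{x. fst x = t \<and> snd x < length (\<rho> t)} = Pair t ` {..<length (\<rho> t)}" by force
  moreover have "set (\<rho> t) = (!) (\<rho> t) ` {..<length (\<rho> t)}"
    by (auto simp: set_conv_nth)
  ultimately show ?thesis by (simp add: cols_def image_image point_col_def)
qed

text \<open>The rows common to both sides of a move, the two boundary rows included;
  \<open>transfer_row\<close> gives their numbers on the other side.\<close>

definition outer :: "diag \<Rightarrow> diag \<Rightarrow> nat \<Rightarrow> bool" where
  "outer u l t \<longleftrightarrow> t \<le> length u \<or> length u + length l \<le> t"

definition transfer_row :: "diag \<Rightarrow> diag \<Rightarrow> diag \<Rightarrow> nat \<Rightarrow> nat" where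
  "transfer_row u l r t = (if t \<le> length u then t else t - length l + length r)"

lemma smove_sym: "smove l r \<Longrightarrow> smove r l" by (auto simp: smove_def)

lemma smove_exec:
  assumes "smove l r" "attach_all l (map fst s) \<noteq> None" "attach_all r (map fst s) \<noteq> None"
  shows "exec l s f t \<longleftrightarrow> exec r s f t"
  using assms move_exec[of l r s f t] move_exec[of r l s f t] by (auto simp: smove_def)

lemma transport:
  assumes "smove l r" "diagram (u @ r @ v)" "run (u @ l @ v) \<rho>" "\<rho> 0 = []"
  obtains \<rho>' where "run (u @ r @ v) \<rho>'" "\<rho>' 0 = []" "total_weight (u @ r @ v) \<rho>' = total_weight (u @ l @ v) \<rho>"
    "\<And>t. t \<le> length u \<Longrightarrow> \<rho>' t = \<rho> t" 
    "\<And>t. \<rho>' (length u + length r + t) = \<rho> (length u + length l + t)"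
proof -
  have runs: "run u \<rho>" "run l (\<lambda>t. \<rho> (length u + t))" "run v (\<lambda>t. \<rho> (length u + length l + t))"
    using assms(3) by (simp_all add: run_append add.assoc)
  have u: "attach_all u [] = Some (map fst (\<rho> (length u)))"
    using run_attach[OF runs(1), of "length u"] assms(4) by simp
  have l: "attach_all l (map fst (\<rho> (length u))) \<noteq> None"
    using run_attach[OF runs(2), of "length l"] by simp
  have r: "attach_all r (map fst (\<rho> (length u))) \<noteq> None"
    using assms(2) by (auto simp: diagram_def attach_all_append u split: Option.bind_splits)
  have "exec l (\<rho> (length u)) (total_weight l (\<lambda>t. \<rho> (length u + t))) (\<rho> (length u + length l))"
    unfolding exec_iff_run using runs(2) by (intro exI[of _ "\<lambda>t. \<rho> (length u + t)"]) simp
  then have "exec r (\<rho> (length u)) (total_weight l (\<lambda>t. \<rho> (length u + t))) (\<rho> (length u + length l))"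
    using smove_exec[OF assms(1) l r] by simp
  then obtain \<sigma> where s: "run r \<sigma>" "\<sigma> 0 = \<rho> (length u)" "\<sigma> (length r) = \<rho> (length u + length l)"
    "total_weight r \<sigma> = total_weight l (\<lambda>t. \<rho> (length u + t))"
    unfolding exec_iff_run by metis
  define \<rho>' where "\<rho>' t = (if t \<le> length u then \<rho> t else if t \<le> length u + length r then \<sigma> (t - length u)
     else \<rho> (t - length r + length l))" for t
  have 1: "\<rho>' t = \<rho> t" if "t \<le> length u" for t using that by (simp add: \<rho>'_def)
  have 2: "\<rho>' (length u + t) = \<sigma> t" if "t \<le> length r" for t using that s by (simp add: \<rho>'_def)
  have 3: "\<rho>' (length u + length r + t) = \<rho> (length u + length l + t)" for t
    using s 2 by (cases "t = 0") (auto simp: \<rho>'_def ac_simps)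
  have "run (u @ r @ v) \<rho>'"
    using runs s(1) 1 2 3 run_cong[of u \<rho> \<rho>'] run_cong[of r \<sigma> "\<lambda>t. \<rho>' (length u + t)"]
    by (simp add: run_append add.assoc[symmetric])
  moreover have "total_weight (u @ r @ v) \<rho>' k = total_weight (u @ l @ v) \<rho> k" for k
    using 1 2 3 total_cong[of u \<rho> \<rho>' k] total_cong[of r \<sigma> "\<lambda>t. \<rho>' (length u + t)" k] s(4)
    by (simp add: total_append add.assoc[symmetric])
  ultimately show ?thesis using 1 3 assms(4) by (intro that[of \<rho>']) (auto simp: fun_eq_iff)
qed

lemma run_points: "run w \<rho> \<Longrightarrow> \<rho> 0 = [] \<Longrightarrow> points w = {(t, p). t \<le> length w \<and> p < length (\<rho> t)}"
  using run_row[of w \<rho>] by (force simp: points_def)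

lemma inner_point:
  assumes "smove l r" "run (u @ l @ v) \<rho>" "\<rho> 0 = []" "x \<in> points (u @ l @ v)"
  obtains y where "y \<in> points (u @ l @ v)" "outer u l (fst y)" "point_col \<rho> y = point_col \<rho> x"
proof (cases "outer u l (fst x)")
  case True
  then show ?thesis using that assms(4) by blast
next
  case False
  then obtain t where t: "fst x = length u + t" "t \<le> length l"
    unfolding outer_def by (metis le_add_diff_inverse nat_le_linear nat_add_left_cancel_le)
  have pts: "points (u @ l @ v) = {(t, p). t \<le> length (u @ l @ v) \<and> p < length (\<rho> t)}"
    by (rule run_points) fact+
  have "point_col \<rho> x \<in> cols (\<rho> (length u + t))"
    unfolding cols_eq_point_col using assms(4) t unfolding pts by auto
  moreover have "run l (\<lambda>t. \<rho> (length u + t))" using assms(2) by (simp add: run_append)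
  ultimately have "point_col \<rho> x \<in> cols (\<rho> (length u)) \<union> cols (\<rho> (length u + length l))"
    using run_inner[OF assms(1), of "\<lambda>t. \<rho> (length u + t)" t] t by auto
  then obtain t' where t': "t' = length u \<or> t' = length u + length l" "point_col \<rho> x \<in> cols (\<rho> t')" by blast
  from t'(2) obtain y where "fst y = t'" "snd y < length (\<rho> t')" "point_col \<rho> y = point_col \<rho> x"
    unfolding cols_eq_point_col by force
  then show ?thesis using t'(1) by (intro that[of y]) (auto simp: outer_def pts case_prod_beta)
qed

section \<open>Following a strand\<close>

lemma position_cases:
  fixes p i :: nat
  obtains "p < i" | "p = i" | "p = Suc i" | r where "p = Suc (Suc (i + r))"
proof -
  have "p = Suc (Suc (i + (p - i - 2)))" if "\<not> p < i" "p \<noteq> i" "p \<noteq> Suc i" using that by linarith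
  then show ?thesis using that by blast
qed

text \<open>A strand either passes through with its direction kept or turns at a maximum with its
  direction reversed. The retracing equation in each alternative is what makes
  \<open>next_point\<close> invertible.\<close>

lemma ascend_cases:
  assumes "attach (x, i) s = Some s'" "p < length s" "ascend (x, i) t p = (t', p')"
  shows "t' = Suc t \<and> p' < length s' \<and> s' ! p' = s ! p \<and> descend (x, i) t p' = (t, p) \<or>
     t' = t \<and> x = Cap \<and> p' < length s \<and> s ! p' \<noteq> s ! p \<and> ascend (x, i) t p' = (t, p)"
  using assms(1)
proof (cases rule: attach_decompose)
  case Cap
  then show ?thesis using assms(2,3)
    by (cases rule: position_cases[of p i]) (auto simp: nth_append nth_Cons' split: if_splits)
qed (use assms(2,3) in \<open>auto simp: nth_append nth_Cons' split: if_splits\<close>)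

lemma descend_cases:
  assumes "attach (x, i) s = Some s'" "p' < length s'" "descend (x, i) t p' = (t0, p)"
  shows "t0 = t \<and> p < length s \<and> s ! p = s' ! p' \<and> ascend (x, i) t p = (Suc t, p') \<or>
     t0 = Suc t \<and> (\<exists>b. x = Cup b) \<and> p < length s' \<and> s' ! p \<noteq> s' ! p' \<and> descend (x, i) t p = (Suc t, p')"
  using assms(1)
proof (cases rule: attach_decompose)
  case Cup
  then show ?thesis using assms(2,3)
    by (cases rule: position_cases[of p' i]) (auto simp: nth_append nth_Cons' split: if_splits)
qed (use assms(2,3) in \<open>auto simp: nth_append nth_Cons' split: if_splits\<close>)

fun shift :: "piece \<times> nat \<Rightarrow> 'c strand list \<Rightarrow> nat \<Rightarrow> int" where
  "shift (Cross k, i) s p = (if p = i then left_shift k (s ! i) (s ! Suc i)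
     else if p = Suc i then right_shift k (s ! i) (s ! Suc i) else 0)"
| "shift (Cup b, i) s p = 0"
| "shift (Cap, i) s p = 0"

lemma dstep_ascend:
  assumes "dstep e (x, i) s = Some s'" "p < length s" "ascend (x, i) t p = (Suc t, p')"
  shows "s' ! p' = relabel (shift (x, i) s p) (s ! p)"
  using assms(1)
  by (cases rule: dstep_decompose)
     (use assms(2,3) in \<open>auto simp: nth_append nth_Cons' split: if_splits\<close>)

lemma dstep_turn:
  assumes "dstep e (x, i) s = Some s'"
  shows "p < length s \<Longrightarrow> ascend (x, i) t p = (t, p') \<Longrightarrow> snd (s ! p') = snd (s ! p)"
    "p' < length s' \<Longrightarrow> descend (x, i) t p' = (Suc t, p) \<Longrightarrow> snd (s' ! p) = snd (s' ! p')"
  using assms by (cases rule: dstep_decompose; auto split: if_splits)+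

text \<open>Replaces the comparison of whole rows by conditions along single strands, the form in
  which labels given by a potential on points can be checked.\<close>

lemma dstepI:
  assumes at: "attach (x, i) (map fst s) = Some (map fst s')"
    and through: "\<And>p p'. p < length s \<Longrightarrow> ascend (x, i) t p = (Suc t, p') \<Longrightarrow> 
       snd (s' ! p') = snd (relabel (shift (x, i) s p) (s ! p))"
    and cap: "\<And>p p'. p < length s \<Longrightarrow> ascend (x, i) t p = (t, p') \<Longrightarrow> snd (s ! p') = snd (s ! p)"
    and cup: "\<And>p p'. p' < length s' \<Longrightarrow> descend (x, i) t p' = (Suc t, p) \<Longrightarrow> snd (s' ! p) = snd (s' ! p')"
  shows "\<exists>e. dstep e (x, i) s = Some s'"
proof (cases x)
  case (Cup b)
  then have "i \<le> length s" using at by (auto split: if_splits)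
  then obtain a q where s: "s = a @ q" and i: "i = length a"
    by (metis append_take_drop_id length_take min.absorb2)
  have m: "map fst s' = map fst a @ b # (\<not> b) # map fst q" using at by (simp add: Cup s i)
  have l: "length s' = Suc (Suc (length s))" using arg_cong[OF m, of length] by (simp add: s)
  define e where "e = snd (s' ! i)"
  have e: "snd (s' ! Suc i) = e" using cup[of i "Suc i"] l by (simp add: e_def Cup s i)
  have f: "fst (s' ! p) = (map fst a @ b # (\<not> b) # map fst q) ! p" if "p < length s'" for p
    using that m by (metis nth_map)
  have lo: "snd (s' ! p) = snd (s ! p)" if "p < i" for p
    using through[of p p] that by (simp add: Cup s i)
  have hi: "snd (s' ! (p + 2)) = snd (s ! p)" if "p < length s" "\<not> p < i" for p
    using through[of p "p + 2"] that by (simp add: Cup s i)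
  have "s' = a @ [(b, e), (\<not> b, e)] @ q"
  proof (rule nth_equalityI)
    fix p assume p: "p < length s'"
    then have "fst (s' ! p) = fst ((a @ [(b, e), (\<not> b, e)] @ q) ! p) \<and> snd (s' ! p) = snd ((a @ [(b, e), (\<not> b, e)] @ q) ! p)"
    proof (cases rule: position_cases[of p i])
      case 1 then show ?thesis using f[OF p] lo by (simp add: s i nth_append)
    next
      case 2 then show ?thesis using f[OF p] by (simp add: i e_def nth_append)
    next
      case 3 then show ?thesis using f[OF p] e by (simp add: i nth_append)
    next
      case (4 r) then show ?thesis using f[OF p] hi[of "i + r"] p l by (auto simp add: s i nth_append)
    qed
    then show "s' ! p = (a @ [(b, e), (\<not> b, e)] @ q) ! p" by (simp add: prod_eq_iff)
  qed (simp add: l s)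
  then show ?thesis by (intro exI[of _ e]) (simp add: Cup s i)
next
  case Cap
  then obtain a b c q where s: "s = a @ b # c # q" and i: "i = length a"
    using split_at_2[of i s] at by (auto split: if_splits)
  have bc: "fst b \<noteq> fst c" and m: "map fst s' = map fst a @ map fst q"
    using at by (auto simp add: Cap s i nth_append split: if_splits)
  have l: "length s' + 2 = length s" using arg_cong[OF m, of length] by (simp add: s)
  have "snd b = snd c" using cap[of i "Suc i"] by (simp add: Cap s i)
  moreover have "s' = a @ q"
  proof (rule nth_equalityI)
    fix p assume p: "p < length s'"
    have "fst (s' ! p) = fst ((a @ q) ! p)"
      using p m l by (metis length_map map_append nth_map)
    moreover have "snd (s' ! p) = snd ((a @ q) ! p)"
    proof (cases "p < i")
      case True
      then show ?thesis using through[of p p] by (simp add: Cap s i nth_append)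
    next
      case False
      then show ?thesis using through[of "p + 2" p] p l by (auto simp add: Cap s i nth_append nth_Cons')
    qed
    ultimately show "s' ! p = (a @ q) ! p" by (rule prod_eqI)
  qed (use l s in simp)
  ultimately show ?thesis using bc by (simp add: Cap s i)
next
  case (Cross k)
  then obtain a b c q where s: "s = a @ b # c # q" and i: "i = length a"
    using split_at_2[of i s] at by (auto split: if_splits)
  have m: "map fst s' = map fst a @ fst c # fst b # map fst q"
    using at by (auto simp add: Cross s i nth_append split: if_splits)
  have l: "length s' = length s" using arg_cong[OF m, of length] by (simp add: s)
  let ?r = "a @ [relabel (right_shift k b c) c, relabel (left_shift k b c) b] @ q"
  have "s' = ?r"
  proof (rule nth_equalityI)
    fix p assume p: "p < length s'"
    have f: "fst (s' ! p) = (map fst a @ fst c # fst b # map fst q) ! p" using m p by (metis nth_map)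
    consider "p < i" | "p = i" | "p = Suc i" | "p > Suc i" by linarith
    then have "fst (s' ! p) = fst (?r ! p) \<and> snd (s' ! p) = snd (?r ! p)"
    proof cases
      case 1 then show ?thesis using f through[of p p] by (simp add: Cross s i nth_append)
    next
      case 2 then show ?thesis using f through[of "Suc i" i] by (simp add: Cross s i nth_append)
    next
      case 3 then show ?thesis using f through[of i "Suc i"] by (simp add: Cross s i nth_append)
    next
      case 4 then show ?thesis using f through[of p p] p l by (auto simp add: Cross s i nth_append nth_Cons')
    qed
    then show "s' ! p = ?r ! p" by (simp add: prod_eq_iff)
  qed (use l s in simp)
  then show ?thesis by (simp add: Cross s i)
qed

lemma row_0 [simp]: "row w 0 = []"
  by (simp add: row_def)

lemma diagram_rows:
  assumes "diagram w"
  shows "t < length w \<Longrightarrow> attach (w ! t) (row w t) = Some (row w (Suc t))" "row w (length w) = []"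
proof -
  show "row w (length w) = []" using assms by (simp add: row_def diagram_def)
  assume t: "t < length w"
  have "take t w @ w ! t # drop (Suc t) w = w" by (metis id_take_nth_drop t)
  then have "Option.bind (attach_all (take t w) []) (attach_all (w ! t # drop (Suc t) w)) = Some []"
    using assms by (metis attach_all_append diagram_def)
  then obtain s where s: "attach_all (take t w) [] = Some s"
    and "Option.bind (attach (w ! t) s) (attach_all (drop (Suc t) w)) = Some []"
    by (auto split: Option.bind_splits)
  then obtain s' where s': "attach (w ! t) s = Some s'" by (auto split: Option.bind_splits)
  have "attach_all (take (Suc t) w) [] = Some s'"
    using t s s' by (simp add: take_Suc_conv_app_nth attach_all_append)
  then show "attach (w ! t) (row w t) = Some (row w (Suc t))" using s s' by (simp add: row_def)
qed

text \<open>Following the orientation backwards. It shows that \<open>next_point\<close> is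
  injective, so that its orbits in the finite set of points are cycles.\<close>

definition previous_point :: "diag \<Rightarrow> nat \<times> nat \<Rightarrow> nat \<times> nat" where
  "previous_point w = (\<lambda>(t, p).
     if row w t ! p then descend (w ! (t - 1)) (t - 1) p else ascend (w ! t) t p)"

lemma next_point_up:
  assumes "diagram w" "(t, p) \<in> points w" "row w t ! p"
  obtains p' where "t < length w" "next_point w (t, p) = (Suc t, p')" "ascend (w ! t) t p = (Suc t, p')"
      "(Suc t, p') \<in> points w" "row w (Suc t) ! p'" "previous_point w (Suc t, p') = (t, p)"
    | p' i where "t < length w" "next_point w (t, p) = (t, p')" "ascend (w ! t) t p = (t, p')" "w ! t = (Cap, i)"
      "(t, p') \<in> points w" "\<not> row w t ! p'" "previous_point w (t, p') = (t, p)"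
proof -
  have "t \<noteq> length w" using assms diagram_rows(2)[OF assms(1)] by (auto simp: points_def)
  then have t: "t < length w" using assms by (auto simp: points_def)
  obtain x i where x: "w ! t = (x, i)" by force
  obtain t' p' where a: "ascend (x, i) t p = (t', p')" by force
  have n: "next_point w (t, p) = (t', p')" using assms(3) x a by (simp add: next_point_def)
  have at: "attach (x, i) (row w t) = Some (row w (Suc t))" using diagram_rows(1)[OF assms(1) t] x by simp
  have p: "p < length (row w t)" using assms by (auto simp: points_def)
  from ascend_cases[OF at p a] show ?thesis
  proof
    assume "t' = Suc t \<and> p' < length (row w (Suc t)) \<and> row w (Suc t) ! p' = row w t ! p \<and> descend (x, i) t p' = (t, p)"
    then show ?thesis using assms t n a x by (intro that(1)[of p']) (auto simp: points_def previous_point_def simp del: ascend.simps descend.simps)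
  next
    assume "t' = t \<and> x = Cap \<and> p' < length (row w t) \<and> row w t ! p' \<noteq> row w t ! p \<and> ascend (x, i) t p' = (t, p)"
    then show ?thesis using assms t n a x by (intro that(2)[of p' i]) (auto simp: points_def previous_point_def simp del: ascend.simps descend.simps)
  qed
qed

lemma next_point_down:
  assumes "diagram w" "(t, p) \<in> points w" "\<not> row w t ! p"
  obtains t' p' where "t = Suc t'" "t' < length w" "next_point w (t, p) = (t', p')" "ascend (w ! t') t' p' = (t, p)"
      "(t', p') \<in> points w" "\<not> row w t' ! p'" "previous_point w (t', p') = (t, p)"
    | t' p' b i where "t = Suc t'" "t' < length w" "next_point w (t, p) = (t, p')" "descend (w ! t') t' p = (t, p')" "w ! t' = (Cup b, i)"
      "(t, p') \<in> points w" "row w t ! p'" "previous_point w (t, p') = (t, p)"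
proof -
  have "t \<noteq> 0" using assms by (cases t) (simp_all add: points_def)
  then obtain t' where t: "t = Suc t'" "t' < length w" using assms by (cases t) (auto simp: points_def)
  obtain x i where x: "w ! t' = (x, i)" by force
  obtain t0 p' where a: "descend (x, i) t' p = (t0, p')" by force
  have n: "next_point w (t, p) = (t0, p')" using assms(3) x a t by (simp add: next_point_def)
  have at: "attach (x, i) (row w t') = Some (row w (Suc t'))" using diagram_rows(1)[OF assms(1) t(2)] x by simp
  have p: "p < length (row w (Suc t'))" using assms t by (auto simp: points_def)
  from descend_cases[OF at p a] show ?thesis
  proof
    assume "t0 = t' \<and> p' < length (row w t') \<and> row w t' ! p' = row w (Suc t') ! p \<and> ascend (x, i) t' p' = (Suc t', p)"
    then show ?thesis using assms t n a x by (intro that(1)[of t' p']) (auto simp: points_def previous_point_def simp del: ascend.simps descend.simps)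
  next
    assume "t0 = Suc t' \<and> (\<exists>b. x = Cup b) \<and> p' < length (row w (Suc t')) \<and> row w (Suc t') ! p' \<noteq> row w (Suc t') ! p \<and> descend (x, i) t' p' = (Suc t', p)"
    then show ?thesis using assms t n a x by (elim conjE exE) (rule that(2)[of t' p'], auto simp: points_def previous_point_def simp del: ascend.simps descend.simps)
  qed
qed

lemma next_point_points: "diagram w \<Longrightarrow> x \<in> points w \<Longrightarrow> next_point w x \<in> points w"
  by (cases x; cases "row w (fst x) ! snd x") (auto elim: next_point_up next_point_down)

lemma previous_next_point: "diagram w \<Longrightarrow> x \<in> points w \<Longrightarrow> previous_point w (next_point w x) = x"
  by (cases x; cases "row w (fst x) ! snd x") (auto elim: next_point_up next_point_down)

lemma inj_next_point: "diagram w \<Longrightarrow> inj_on (next_point w) (points w)"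
  using previous_next_point inj_on_inverseI by metis

lemma finite_points: "finite (points w)"
proof (rule finite_subset)
  show "points w \<subseteq> (SIGMA t:{..length w}. {..<length (row w t)})" by (auto simp: points_def)
qed simp

section \<open>Arcs of a cyclic permutation\<close>

definition arc :: "('a \<Rightarrow> 'a) \<Rightarrow> 'a \<Rightarrow> 'a \<Rightarrow> 'a set" where
  "arc f x y = {(f ^^ k) x | k. 0 < k \<and> (\<forall>j. 0 < j \<and> j \<le> k \<longrightarrow> (f ^^ j) x \<noteq> y)}"

lemma open_arc_eq_arc: "open_arc w x y = arc (next_point w) x y"
  by (simp add: open_arc_def arc_def)

context
  fixes f :: "'a \<Rightarrow> 'a" and A :: "'a set"
  assumes fin: "finite A" and inj: "inj_on f A" and clos: "\<And>x. x \<in> A \<Longrightarrow> f x \<in> A"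
begin

lemma funpow_mem: "x \<in> A \<Longrightarrow> (f ^^ k) x \<in> A"
  by (induction k) (auto intro: clos)

lemma funpow_inj: "x \<in> A \<Longrightarrow> y \<in> A \<Longrightarrow> (f ^^ k) x = (f ^^ k) y \<Longrightarrow> x = y"
proof (induction k)
  case (Suc k)
  then show ?case using inj funpow_mem by (auto dest: inj_onD)
qed simp

lemma period:
  assumes "x \<in> A"
  obtains N where "0 < N" "(f ^^ N) x = x" "inj_on (\<lambda>k. (f ^^ k) x) {..<N}"
proof -
  have "\<not> inj (\<lambda>k. (f ^^ k) x)"
    using fin funpow_mem[OF assms] by (meson finite_subset image_subsetI infinite_UNIV_nat finite_imageD)
  then obtain a b where ab: "a < b" "(f ^^ a) x = (f ^^ b) x"
    unfolding inj_def by (metis linorder_neqE_nat)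
  have ex: "\<exists>n. 0 < n \<and> (f ^^ n) x = x"
  proof (intro exI conjI)
    show "0 < b - a" using ab by simp
    have "(f ^^ a) ((f ^^ (b - a)) x) = (f ^^ a) x"
      using ab by (metis comp_apply funpow_add le_add_diff_inverse less_imp_le_nat)
    then show "(f ^^ (b - a)) x = x" using funpow_inj funpow_mem assms by metis
  qed
  define N where "N = (LEAST n. 0 < n \<and> (f ^^ n) x = x)"
  have N: "0 < N" "(f ^^ N) x = x" using LeastI_ex[OF ex] by (auto simp: N_def)
  have "(f ^^ a) x \<noteq> (f ^^ b) x" if "a < b" "b < N" for a b
  proof
    assume "(f ^^ a) x = (f ^^ b) x"
    then have "(f ^^ a) ((f ^^ (b - a)) x) = (f ^^ a) x"
      using that by (metis comp_apply funpow_add le_add_diff_inverse less_imp_le_nat)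
    then have "(f ^^ (b - a)) x = x" using funpow_inj funpow_mem assms by metis
    moreover have "b - a < N" "0 < b - a" using that by auto
    ultimately show False using not_less_Least[of "b - a" "\<lambda>n. 0 < n \<and> (f ^^ n) x = x"] by (auto simp: N_def)
  qed
  then have "inj_on (\<lambda>k. (f ^^ k) x) {..<N}"
    by (intro inj_onI) (metis lessThan_iff linorder_neqE_nat)
  then show ?thesis using that N by blast
qed

lemma funpow_period: "(f ^^ N) x = x \<Longrightarrow> (f ^^ (m * N)) x = x"
  by (induction m) (simp_all add: funpow_add)

lemma funpow_mod: "(f ^^ N) x = x \<Longrightarrow> (f ^^ (k mod N)) x = (f ^^ k) x"
proof -
  assume "(f ^^ N) x = x"
  then have "(f ^^ (k mod N)) ((f ^^ (k div N * N)) x) = (f ^^ (k mod N)) x"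
    by (simp add: funpow_period)
  then show ?thesis by (metis comp_apply funpow_add mod_div_mult_eq)
qed

lemma range_funpow:
  assumes "0 < N" "(f ^^ N) x = x" shows "range (\<lambda>k. (f ^^ k) x) = (\<lambda>k. (f ^^ k) x) ` {..<N}"
proof -
  have "(f ^^ k) x \<in> (\<lambda>k. (f ^^ k) x) ` {..<N}" for k
    using funpow_mod[OF assms(2), of k] assms(1) by (metis imageI lessThan_iff mod_less_divisor)
  then show ?thesis by auto
qed

lemma range_funpow_eq:
  assumes "x \<in> A" "y \<in> range (\<lambda>k. (f ^^ k) x)"
  shows "range (\<lambda>k. (f ^^ k) y) = range (\<lambda>k. (f ^^ k) x)"
proof -
  obtain N where N: "0 < N" "(f ^^ N) x = x" using period[OF assms(1)] by metis
  obtain a where a: "a < N" "y = (f ^^ a) x" using assms(2) range_funpow[OF N] by auto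
  have y: "(f ^^ k) y = (f ^^ (k + a)) x" for k by (simp add: a funpow_add)
  have "(f ^^ k) x = (f ^^ (k + (N - a))) y" for k
  proof -
    have "(f ^^ (k + (N - a))) y = (f ^^ (k + (N - a) + a)) x" by (rule y)
    also have "k + (N - a) + a = k + N" using a by simp
    finally have "(f ^^ (k + (N - a))) y = (f ^^ (k + N)) x" .
    then show ?thesis using N by (simp add: funpow_add)
  qed
  then show ?thesis using y by (metis (no_types, lifting) rangeI image_subsetI subset_antisym)
qed

lemma arcs:
  assumes "x \<in> A" "y \<in> range (\<lambda>k. (f ^^ k) x)" "x \<noteq> y"
  obtains N a where "0 < a" "a < N" "(f ^^ N) x = x" "y = (f ^^ a) x" "inj_on (\<lambda>k. (f ^^ k) x) {..<N}"
    "range (\<lambda>k. (f ^^ k) x) = (\<lambda>k. (f ^^ k) x) ` {..<N}"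
    "arc f x y = (\<lambda>k. (f ^^ k) x) ` {0<..<a}" "arc f y x = (\<lambda>k. (f ^^ k) x) ` {a<..<N}"
proof -
  obtain N where N: "0 < N" "(f ^^ N) x = x" "inj_on (\<lambda>k. (f ^^ k) x) {..<N}" using period[OF assms(1)] by metis
  obtain a where a: "a < N" "y = (f ^^ a) x" using assms(2) range_funpow[OF N(1,2)] by auto
  have a0: "0 < a" using assms(3) a by (cases a) auto
  have ne: "(f ^^ k) x \<noteq> (f ^^ l) x" if "k < N" "l < N" "k \<noteq> l" for k l
    using N(3) that by (auto dest: inj_onD)
  have y: "(f ^^ k) y = (f ^^ (k + a)) x" for k by (simp add: a funpow_add)
  have "arc f x y = (\<lambda>k. (f ^^ k) x) ` {0<..<a}"
  proof safe
    fix z assume "z \<in> arc f x y"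
    then obtain k where k: "z = (f ^^ k) x" "0 < k" "\<And>j. 0 < j \<Longrightarrow> j \<le> k \<Longrightarrow> (f ^^ j) x \<noteq> y" 
      by (auto simp: arc_def)
    have "k < a" using k(3)[of a] a0 a by (meson not_le)
    then show "z \<in> (\<lambda>k. (f ^^ k) x) ` {0<..<a}" using k by simp
  next
    fix k assume "k \<in> {0<..<a}"
    then have "0 < k \<and> (\<forall>j. 0 < j \<and> j \<le> k \<longrightarrow> (f ^^ j) x \<noteq> y)"
      unfolding a(2) using a(1) ne[of _ a] by (metis greaterThanLessThan_iff le_less_trans less_irrefl less_trans)
    then show "(f ^^ k) x \<in> arc f x y" unfolding arc_def by blast
  qed
  moreover have "arc f y x = (\<lambda>k. (f ^^ k) x) ` {a<..<N}"
  proof safe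
    fix z assume "z \<in> arc f y x"
    then obtain k where k: "z = (f ^^ k) y" "0 < k" "\<And>j. 0 < j \<Longrightarrow> j \<le> k \<Longrightarrow> (f ^^ j) y \<noteq> x" 
      by (auto simp: arc_def)
    have "(f ^^ (N - a)) y = x" using y[of "N - a"] a N(2) by simp
    then have "k < N - a" using k(3)[of "N - a"] a(1) by (meson not_le zero_less_diff)
    then show "z \<in> (\<lambda>k. (f ^^ k) x) ` {a<..<N}" using k by (auto simp: y)
  next
    fix k assume k: "k \<in> {a<..<N}"
    have "(f ^^ j) y \<noteq> x" if "0 < j" "j \<le> k - a" for j
    proof -
      have "j + a < N" "j + a \<noteq> 0" using that k by auto
      then show ?thesis using ne[of "j + a" 0] N(1) by (simp add: y)
    qed
    moreover have "(f ^^ k) x = (f ^^ (k - a)) y" using k by (simp add: y)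
    ultimately show "(f ^^ k) x \<in> arc f y x" unfolding arc_def
      using k by (auto intro!: exI[of _ "k - a"])
  qed
  ultimately show ?thesis using that[OF a0 a(1) N(2) a(2) N(3)] range_funpow[OF N(1,2)] by blast
qed

lemma telescope:
  fixes J L :: "'a \<Rightarrow> int"
  assumes "\<And>z. z \<in> A \<Longrightarrow> L (f z) = L z + J z" "x \<in> A"
  shows "L ((f ^^ n) x) = L x + (\<Sum>k<n. J ((f ^^ k) x))"
  by (induction n) (simp_all add: assms funpow_mem)

text \<open>Telescoping from \<open>x\<close> to \<open>y\<close> includes the jump at
  \<open>x\<close>, which is no point of the open arc; hence the term \<open>J x\<close>.\<close>

lemma arc_telescope:
  fixes J L :: "'a \<Rightarrow> int"
  assumes L: "\<And>z. z \<in> A \<Longrightarrow> L (f z) = L z + J z"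
    and "x \<in> A" "y \<in> range (\<lambda>k. (f ^^ k) x)" "x \<noteq> y"
  shows "(\<Sum>z\<in>arc f x y. J z) = L y - L x - J x"
proof -
  obtain N a where a: "0 < a" "a < N" "y = (f ^^ a) x" "inj_on (\<lambda>k. (f ^^ k) x) {..<N}"
    "arc f x y = (\<lambda>k. (f ^^ k) x) ` {0<..<a}"
    using arcs[OF assms(2-4)] by metis
  have "inj_on (\<lambda>k. (f ^^ k) x) {0<..<a}" by (rule inj_on_subset[OF a(4)]) (use a in auto)
  then have "(\<Sum>z\<in>arc f x y. J z) = (\<Sum>k\<in>{0<..<a}. J ((f ^^ k) x))" by (simp add: a(5) sum.reindex)
  moreover have "{..<a} = insert 0 {0<..<a}" using a by auto
  ultimately show ?thesis using telescope[of L J x a] L assms(2) a(3) by simp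
qed

lemma sum_two_arcs:
  fixes J :: "'a \<Rightarrow> int"
  assumes "x \<in> A" "y \<in> range (\<lambda>k. (f ^^ k) x)" "x \<noteq> y"
  shows "(\<Sum>z\<in>range (\<lambda>k. (f ^^ k) x). J z) = J x + J y + (\<Sum>z\<in>arc f x y. J z) + (\<Sum>z\<in>arc f y x. J z)"
    "arc f x y \<inter> arc f y x = {}" "x \<notin> arc f x y" "y \<notin> arc f x y" "x \<notin> arc f y x" "y \<notin> arc f y x"
    "range (\<lambda>k. (f ^^ k) x) = {x, y} \<union> arc f x y \<union> arc f y x"
proof -
  obtain N a where a: "0 < a" "a < N" "y = (f ^^ a) x" "inj_on (\<lambda>k. (f ^^ k) x) {..<N}"
    "range (\<lambda>k. (f ^^ k) x) = (\<lambda>k. (f ^^ k) x) ` {..<N}"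
    "arc f x y = (\<lambda>k. (f ^^ k) x) ` {0<..<a}" "arc f y x = (\<lambda>k. (f ^^ k) x) ` {a<..<N}"
    using arcs[OF assms] by metis
  have ne: "(f ^^ k) x \<noteq> (f ^^ l) x" if "k < N" "l < N" "k \<noteq> l" for k l
    using a(4) that by (auto dest: inj_onD)
  have x: "x = (f ^^ 0) x" by simp
  show 1: "arc f x y \<inter> arc f y x = {}" using ne a(2) by (auto simp: a(6,7))
  show 2: "x \<notin> arc f x y" "y \<notin> arc f x y" "x \<notin> arc f y x" "y \<notin> arc f y x"
  proof -
    have *: "x \<notin> (\<lambda>k. (f ^^ k) x) ` {0<..<N}" "y \<notin> (\<lambda>k. (f ^^ k) x) ` ({..<N} - {a})"
      using ne[of 0] ne[of a] a(2) by (auto simp: a(3))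
    then show "x \<notin> arc f x y" "y \<notin> arc f x y" "x \<notin> arc f y x" "y \<notin> arc f y x"
      unfolding a(6,7) using a(2) by auto
  qed
  have "{..<N} = {0, a} \<union> {0<..<a} \<union> {a<..<N}" using a(1,2) by auto
  then show 3: "range (\<lambda>k. (f ^^ k) x) = {x, y} \<union> arc f x y \<union> arc f y x"
    unfolding a(5,6,7) using a(3) by (simp add: image_Un)
  show "(\<Sum>z\<in>range (\<lambda>k. (f ^^ k) x). J z) = J x + J y + (\<Sum>z\<in>arc f x y. J z) + (\<Sum>z\<in>arc f y x. J z)"
    unfolding 3 using 1 2 assms(3) by (subst sum.union_disjoint) (auto simp: a(6,7) sum.union_disjoint)
qed

text \<open>\<open>L\<close> sums the jumps from a base point. The hypothesis is used at the one
  step that returns to the base point.\<close>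

lemma potential_exists:
  fixes J :: "'a \<Rightarrow> int"
  assumes "x \<in> A" "(\<Sum>z\<in>range (\<lambda>k. (f ^^ k) x). J z) = 0"
  shows "\<exists>L. \<forall>z\<in>range (\<lambda>k. (f ^^ k) x). L (f z) = L z + J z"
proof -
  obtain N where N: "0 < N" "(f ^^ N) x = x" "inj_on (\<lambda>k. (f ^^ k) x) {..<N}" using period[OF assms(1)] by metis
  define S where "S k = (\<Sum>j<k. J ((f ^^ j) x))" for k
  define L where "L z = S (the_inv_into {..<N} (\<lambda>k. (f ^^ k) x) z)" for z
  have SN: "S N = 0"
    using assms(2) by (simp add: range_funpow[OF N(1,2)] sum.reindex[OF N(3)] S_def)
  have L: "L ((f ^^ k) x) = S k" if "k < N" for k
    using that by (simp add: L_def the_inv_into_f_f[OF N(3)])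
  have "L (f ((f ^^ k) x)) = L ((f ^^ k) x) + J ((f ^^ k) x)" if "k < N" for k
  proof (cases "Suc k < N")
    case True
    then show ?thesis using L[of "Suc k"] L[of k] by (simp add: S_def)
  next
    case False
    then have "Suc k = N" using that by simp
    then have "f ((f ^^ k) x) = (f ^^ 0) x" using N(2) by auto
    moreover have "S k + J ((f ^^ k) x) = S N" unfolding \<open>Suc k = N\<close>[symmetric] by (simp add: S_def)
    ultimately show ?thesis using L[of k] L[of 0] that N(1) SN by (simp add: S_def)
  qed
  then show ?thesis unfolding range_funpow[OF N(1,2)] by (intro exI[of _ L]) auto
qed

end

section \<open>Labels with prescribed jumps\<close>

text \<open>The change of label, along the orientation, at the passage with lower end
  \<open>z\<close>. At a positive crossing the under-strand passes the over-strand from right to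
  left, hence the sign at the over-passage and its negative at the under-passage. The set
  \<open>X\<close> selects the crossings that count.\<close>

definition jump :: "diag \<Rightarrow> nat set \<Rightarrow> nat \<times> nat \<Rightarrow> int" where
  "jump w X z = (\<Sum>d\<in>X. crossing_sign w d * (of_bool (z = over_point w d) - of_bool (z = under_point w d)))"

lemma finite_classical [simp]: "finite (classical w)"
  by (simp add: classical_def)

lemma fst_over_under_point [simp]: "fst (over_point w d) = d" "fst (under_point w d) = d"
  by (simp_all add: over_point_def under_point_def)

lemma over_neq_under: "over_point w c \<noteq> under_point w c"
  by (simp add: over_point_def under_point_def)

lemma jump_at:
  assumes "X \<subseteq> classical w"
  shows "jump w X (t, p) = (if t \<in> X then crossing_sign w t *
     (of_bool (p = snd (over_point w t)) - of_bool (p = snd (under_point w t))) else 0)"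
proof -
  have "finite X" using assms finite_subset finite_classical by blast
  have "jump w X (t, p) = (\<Sum>d\<in>X. if t = d then crossing_sign w t *
     (of_bool (p = snd (over_point w t)) - of_bool (p = snd (under_point w t))) else 0)"
    unfolding jump_def by (intro sum.cong) (auto simp: prod_eq_iff of_bool_def)
  then show ?thesis using \<open>finite X\<close> by simp
qed

lemma component_refl: "x \<in> component w x"
  unfolding component_def by (rule range_eqI[of _ _ 0]) simp

context
  fixes w :: diag
  assumes dia: "diagram w"
begin

lemmas orbit_facts = finite_points[of w] inj_next_point[OF dia] next_point_points[OF dia]

lemma component_subset: "x \<in> points w \<Longrightarrow> component w x \<subseteq> points w"
  unfolding component_def using funpow_mem[OF orbit_facts] by (metis image_subsetI)

lemma component_eq: "x \<in> points w \<Longrightarrow> y \<in> component w x \<Longrightarrow> component w y = component w x"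
  using range_funpow_eq[OF orbit_facts, of x y] by (simp add: component_def)

lemma component_next: "x \<in> points w \<Longrightarrow> component w (next_point w x) = component w x"
  by (rule component_eq) (auto simp: component_def intro: range_eqI[of _ _ 1])

lemma constant_on_component:
  assumes "\<And>x. x \<in> points w \<Longrightarrow> g (next_point w x) = g x" "x \<in> points w" "y \<in> component w x"
  shows "g y = g x"
proof -
  have "g ((next_point w ^^ k) x) = g x" for k
    by (induction k) (simp_all add: assms funpow_mem[OF orbit_facts])
  then show ?thesis using assms(3) by (auto simp: component_def)
qed

lemma classical_piece:
  assumes "c \<in> classical w"
  obtains k i where "w ! c = (Cross k, i)" "k \<noteq> Virtual" "c < length w" "Suc i < length (row w c)"
proof -
  have c: "c < length w" using assms by (simp add: classical_def)
  obtain k i where k: "w ! c = (Cross k, i)" "k \<noteq> Virtual" using assms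
    by (cases "w ! c") (auto simp: classical_def)
  then have "Suc i < length (row w c)" using diagram_rows(1)[OF dia c] by (auto split: if_splits)
  then show ?thesis using that k c by blast
qed

lemma over_under_points: "c \<in> classical w \<Longrightarrow> over_point w c \<in> points w \<and> under_point w c \<in> points w"
  by (erule classical_piece) (auto simp: over_point_def under_point_def points_def)

end

definition same_col :: "diag \<Rightarrow> (nat \<times> nat \<Rightarrow> 'c) \<Rightarrow> nat set" where
  "same_col w col = {d \<in> classical w. col (over_point w d) = col (under_point w d)}"

lemma same_col_subset: "same_col w col \<subseteq> classical w"
  by (auto simp: same_col_def)

lemma jump_not_classical: "t \<notin> classical w \<Longrightarrow> jump w (same_col w col) (t, q) = 0"
  by (simp add: jump_at[OF same_col_subset]) (simp add: same_col_def)

text \<open>\<open>shift\<close> is read upwards and \<open>jump\<close> along the orientation,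
  which accounts for the sign on downward strands.\<close>

lemma shift_eq_jump:
  assumes "diagram w" "map fst (\<rho> t) = row w t" "t < length w"
  shows "shift (w ! t) (\<rho> t) p = (if row w t ! p then 1 else - 1) * jump w (same_col w (point_col \<rho>)) (t, p)"
proof (cases "t \<in> classical w")
  case False
  then have "t \<notin> same_col w (point_col \<rho>)" by (simp add: same_col_def)
  moreover have "shift (w ! t) (\<rho> t) p = 0"
  proof -
    obtain x i where "w ! t = (x, i)" by force
    moreover have "k = Virtual" if "x = Cross k" for k
      using False assms(3) \<open>w ! t = (x, i)\<close> that by (cases k) (auto simp: classical_def)
    ultimately show ?thesis by (cases x) auto
  qed
  ultimately show ?thesis by (simp add: jump_at[OF same_col_subset])
next
  case True
  then obtain k i where k: "w ! t = (Cross k, i)" "k \<noteq> Virtual" "Suc i < length (row w t)"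
    using classical_piece[OF assms(1)] by metis
  have l: "length (\<rho> t) = length (row w t)" using arg_cong[OF assms(2), of length] by simp
  have r: "row w t ! i = fst (\<rho> t ! i)" "row w t ! Suc i = fst (\<rho> t ! Suc i)"
    unfolding assms(2)[symmetric] using k(3) l by simp_all
  have int: "interact k (\<rho> t ! i) (\<rho> t ! Suc i) \<longleftrightarrow> t \<in> same_col w (point_col \<rho>)"
    using k True by (auto simp: same_col_def interact_def point_col_def over_point_def under_point_def)
  have sgn: "crossing_sign w t = (if k = Over then 1 else -1) *
     (if fst (\<rho> t ! i) = fst (\<rho> t ! Suc i) then 1 else -1)"
    using k r by (simp add: crossing_sign_def)
  show ?thesis
  proof (cases "t \<in> same_col w (point_col \<rho>)")
    case True
    then show ?thesis unfolding jump_at[OF same_col_subset] sgn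
      using k int r by (auto simp: left_shift_def right_shift_def updown_def over_point_def under_point_def)
  next
    case False
    then show ?thesis unfolding jump_at[OF same_col_subset]
      using k int by (auto simp: left_shift_def right_shift_def)
  qed
qed

text \<open>
  A passage is represented by its lower end, which a downward strand meets after the passage.
  The potential is the label before the passage in either case.
\<close>

definition potential :: "diag \<Rightarrow> (nat \<Rightarrow> 'c strand list) \<Rightarrow> nat \<times> nat \<Rightarrow> int" where
  "potential w \<rho> x = snd (snd (\<rho> (fst x) ! snd x)) -
     (if row w (fst x) ! snd x then 0 else jump w (same_col w (point_col \<rho>)) x)"

text \<open>Together with \<open>run_exists\<close> this identifies decorations with colourings that
  are constant along strands and potentials that have the prescribed jumps.\<close>

lemma run_next:
  assumes d: "diagram w" and run: "run w \<rho>" "\<rho> 0 = []" and x: "x \<in> points w"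
  shows "point_col \<rho> (next_point w x) = point_col \<rho> x"
    "potential w \<rho> (next_point w x) = potential w \<rho> x + jump w (same_col w (point_col \<rho>)) x"
proof -
  let ?C = "same_col w (point_col \<rho>)"
  have rows: "map fst (\<rho> t) = row w t" if "t \<le> length w" for t using run_row[OF run that] by simp
  have len: "length (\<rho> t) = length (row w t)" if "t \<le> length w" for t
    using arg_cong[OF rows[OF that], of length] by simp
  obtain t p where tp: "x = (t, p)" by force
  have pts: "t \<le> length w" "p < length (row w t)" using x tp by (auto simp: points_def)
  have noj: "jump w ?C (t, q) = 0" if "w ! t = (Cap, i)" for t q i
    using that by (intro jump_not_classical) (simp add: classical_def)
  have "point_col \<rho> (next_point w x) = point_col \<rho> x \<and>
     potential w \<rho> (next_point w x) = potential w \<rho> x + jump w ?C x"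
  proof (cases "row w t ! p")
    case True
    from next_point_up[OF d x[unfolded tp] True] show ?thesis
    proof cases
      case (1 p')
      obtain y i where y: "w ! t = (y, i)" by force
      obtain e where e: "dstep e (y, i) (\<rho> t) = Some (\<rho> (Suc t))" using run_step[OF run(1) 1(1)] y by metis
      have "\<rho> (Suc t) ! p' = relabel (shift (y, i) (\<rho> t) p) (\<rho> t ! p)"
        by (rule dstep_ascend[OF e, of p t]) (use pts len 1 y in auto)
      then show ?thesis using 1 True shift_eq_jump[where \<rho> = \<rho>, OF d rows 1(1), of p] y pts
        by (simp add: tp point_col_def potential_def)
    next
      case (2 p' i)
      obtain e where e: "dstep e (Cap, i) (\<rho> t) = Some (\<rho> (Suc t))" using run_step[OF run(1) 2(1)] 2(4) by metis
      have "snd (\<rho> t ! p') = snd (\<rho> t ! p)"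
        by (rule dstep_turn(1)[OF e, of p t]) (use pts len 2 in auto)
      then show ?thesis using 2 True noj[OF 2(4)]
        by (simp add: tp point_col_def potential_def)
    qed
  next
    case False
    from next_point_down[OF d x[unfolded tp] False] show ?thesis
    proof cases
      case (1 t' p')
      obtain y i where y: "w ! t' = (y, i)" by force
      obtain e where e: "dstep e (y, i) (\<rho> t') = Some (\<rho> (Suc t'))" using run_step[OF run(1) 1(2)] y by metis
      have "p' < length (\<rho> t')" using 1 len by (auto simp: points_def)
      then have "\<rho> (Suc t') ! p = relabel (shift (y, i) (\<rho> t') p') (\<rho> t' ! p')"
        by (intro dstep_ascend[OF e, of p' t']) (use 1 y in auto)
      then show ?thesis using 1 False shift_eq_jump[where \<rho> = \<rho>, OF d rows 1(2), of p'] y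
        by (simp add: tp point_col_def potential_def)
    next
      case (2 t' p' b i)
      obtain e where e: "dstep e (Cup b, i) (\<rho> t') = Some (\<rho> (Suc t'))" using run_step[OF run(1) 2(2)] 2(5) by metis
      have "snd (\<rho> (Suc t') ! p') = snd (\<rho> (Suc t') ! p)"
        by (rule dstep_turn(2)[OF e, of p t']) (use pts len 2 in auto)
      then show ?thesis using 2 False
        by (simp add: tp point_col_def potential_def)
    qed
  qed
  then show "point_col \<rho> (next_point w x) = point_col \<rho> x"
    "potential w \<rho> (next_point w x) = potential w \<rho> x + jump w ?C x" by auto
qed

lemma run_exists:
  assumes d: "diagram w" and col: "\<And>x. x \<in> points w \<Longrightarrow> col (next_point w x) = col x"
    and L: "\<And>x. x \<in> points w \<Longrightarrow> L (next_point w x) = L x + jump w (same_col w col) x"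
  obtains \<rho> where "run w \<rho>" "\<rho> 0 = []" "\<And>x. x \<in> points w \<Longrightarrow> point_col \<rho> x = col x"
proof -
  let ?C = "same_col w col"
  define \<rho> where "\<rho> t = map (\<lambda>p. (row w t ! p, col (t, p), L (t, p) + (if row w t ! p then 0 else jump w ?C (t, p))))
     [0..<length (row w t)]" for t
  have len: "length (\<rho> t) = length (row w t)" for t by (simp add: \<rho>_def)
  have rows: "map fst (\<rho> t) = row w t" for t by (rule nth_equalityI) (simp_all add: \<rho>_def)
  have nth: "\<rho> t ! p = (row w t ! p, col (t, p), L (t, p) + (if row w t ! p then 0 else jump w ?C (t, p)))"
    if "p < length (row w t)" for t p using that by (simp add: \<rho>_def)
  have pc: "point_col \<rho> x = col x" if "x \<in> points w" for x
    using that nth by (auto simp: points_def point_col_def)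
  have C: "same_col w (point_col \<rho>) = ?C"
    unfolding same_col_def using pc[OF conjunct1[OF over_under_points[OF d]]]
      pc[OF conjunct2[OF over_under_points[OF d]]] by auto
  have noj: "jump w ?C (t, q) = 0" if "w ! t = (Cap, i)" for t q i
    using that by (intro jump_not_classical) (simp add: classical_def)
  have "\<exists>e. dstep e (w ! t) (\<rho> t) = Some (\<rho> (Suc t))" if t: "t < length w" for t
  proof -
    obtain y i where y: "w ! t = (y, i)" by force
    have sh: "shift (y, i) (\<rho> t) p = (if row w t ! p then 1 else - 1) * jump w ?C (t, p)" for p
      using shift_eq_jump[where \<rho> = \<rho>, OF d rows t, of p] C y by simp
    have "\<exists>e. dstep e (y, i) (\<rho> t) = Some (\<rho> (Suc t))"
    proof (rule dstepI[where t = t])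
      show at: "attach (y, i) (map fst (\<rho> t)) = Some (map fst (\<rho> (Suc t)))"
        unfolding rows using diagram_rows(1)[OF d t] y by simp
      fix p p'
      {
        assume p: "p < length (\<rho> t)" and a: "ascend (y, i) t p = (Suc t, p')"
        from ascend_cases[OF at, of p t "Suc t" p'] p a
        have p': "p' < length (row w (Suc t))" "row w (Suc t) ! p' = row w t ! p" "descend (y, i) t p' = (t, p)"
          unfolding rows by (simp_all add: len)
        have pts: "(t, p) \<in> points w" "(Suc t, p') \<in> points w" using p p' t len by (auto simp: points_def)
        show "snd (\<rho> (Suc t) ! p') = snd (relabel (shift (y, i) (\<rho> t) p) (\<rho> t ! p))"
        proof (cases "row w t ! p")
          case True
          then have "next_point w (t, p) = (Suc t, p')" using a y by (simp add: next_point_def)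
          then show ?thesis using col[OF pts(1)] L[OF pts(1)] True p p' len
            by (simp add: nth relabel_def sh)
        next
          case False
          then have "next_point w (Suc t, p') = (t, p)" using p' y by (simp add: next_point_def)
          then show ?thesis using col[OF pts(2)] L[OF pts(2)] False p p' len
            by (simp add: nth relabel_def sh)
        qed
      }
      {
        assume p: "p < length (\<rho> t)" and a: "ascend (y, i) t p = (t, p')"
        from ascend_cases[OF at, of p t t p'] p a
        have p': "p' < length (row w t)" "row w t ! p' \<noteq> row w t ! p" "ascend (y, i) t p' = (t, p)" "y = Cap"
          unfolding rows by (auto simp add: len simp del: ascend.simps descend.simps)
        have pts: "(t, p) \<in> points w" "(t, p') \<in> points w" using p p' t len by (auto simp: points_def)
        have j: "jump w ?C (t, q) = 0" for q using noj y p'(4) by simp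
        show "snd (\<rho> t ! p') = snd (\<rho> t ! p)"
        proof (cases "row w t ! p")
          case True
          then have "next_point w (t, p) = (t, p')" using a y by (simp add: next_point_def)
          then show ?thesis using col[OF pts(1)] L[OF pts(1)] True p p' len j
            by (simp add: nth)
        next
          case False
          then have "next_point w (t, p') = (t, p)" using p' y by (simp add: next_point_def)
          then show ?thesis using col[OF pts(2)] L[OF pts(2)] False p p' len j
            by (simp add: nth)
        qed
      }
      {
        assume p: "p' < length (\<rho> (Suc t))" and a: "descend (y, i) t p' = (Suc t, p)"
        from descend_cases[OF at, of p' t "Suc t" p] p a
        have p': "p < length (row w (Suc t))" "row w (Suc t) ! p' \<noteq> row w (Suc t) ! p" "descend (y, i) t p = (Suc t, p')"
          unfolding rows by (auto simp add: len simp del: ascend.simps descend.simps)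
        have pts: "(Suc t, p) \<in> points w" "(Suc t, p') \<in> points w" using p p' t len by (auto simp: points_def)
        show "snd (\<rho> (Suc t) ! p) = snd (\<rho> (Suc t) ! p')"
        proof (cases "row w (Suc t) ! p'")
          case False
          then have "next_point w (Suc t, p') = (Suc t, p)" using a y by (simp add: next_point_def)
          then show ?thesis using col[OF pts(2)] L[OF pts(2)] False p p' len
            by (simp add: nth)
        next
          case True
          then have "next_point w (Suc t, p) = (Suc t, p')" using p' y by (simp add: next_point_def)
          then show ?thesis using col[OF pts(1)] L[OF pts(1)] True p p' len
            by (simp add: nth)
        qed
      }
    qed
    then show ?thesis using y by simp
  qed
  then have "run w \<rho>" by (simp add: run_def)
  moreover have "\<rho> 0 = []" by (simp add: \<rho>_def)
  ultimately show ?thesis using pc that by blast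
qed

lemma sum_jump:
  assumes "finite P" "X \<subseteq> classical w"
  shows "(\<Sum>z\<in>P. jump w X z) = (\<Sum>d\<in>X. crossing_sign w d * (of_bool (over_point w d \<in> P) - of_bool (under_point w d \<in> P)))"
proof -
  have fin: "finite X" using assms finite_subset finite_classical by blast
  have delta: "(\<Sum>z\<in>P. of_bool (z = y)) = (of_bool (y \<in> P) :: int)" for y
    using assms(1) by (simp add: of_bool_def)
  have "(\<Sum>z\<in>P. jump w X z) = (\<Sum>d\<in>X. \<Sum>z\<in>P. crossing_sign w d * (of_bool (z = over_point w d) - of_bool (z = under_point w d)))"
    unfolding jump_def by (rule sum.swap)
  then show ?thesis by (simp add: sum_distrib_left[symmetric] sum_subtractf delta)
qed

lemma run_by_components:
  assumes d: "diagram w"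
  obtains \<rho> where "run w \<rho>" "\<rho> 0 = []" "\<And>x. x \<in> points w \<Longrightarrow> point_col \<rho> x = component w x"
proof -
  let ?C = "same_col w (component w)"
  \<comment> \<open>Both passages of a crossing in \<open>?C\<close> lie on the same component, so
    its two jumps cancel in the sum.\<close>
  have sum0: "(\<Sum>z\<in>component w x. jump w ?C z) = 0" if x: "x \<in> points w" for x
  proof -
    have "over_point w c \<in> component w x \<longleftrightarrow> under_point w c \<in> component w x" if "c \<in> ?C" for c
    proof -
      have c: "c \<in> classical w" "component w (over_point w c) = component w (under_point w c)"
        using that by (auto simp: same_col_def)
      then show ?thesis using component_eq[OF d x] component_refl by metis
    qed
    then show ?thesis
      using sum_jump[OF finite_subset[OF component_subset[OF d x] finite_points], of ?C]
      by (simp add: same_col_subset)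
  qed
  have "\<exists>L. \<forall>z\<in>component w x. L (next_point w z) = L z + jump w ?C z" if x: "x \<in> points w" for x
    using potential_exists[OF orbit_facts[OF d] x, of "jump w ?C"] sum0[OF x] by (simp add: component_def)
  then have "\<exists>L. \<forall>z\<in>P. L (next_point w z) = L z + jump w ?C z" if "P \<in> components w" for P
    using that by (auto simp: components_def)
  then obtain L where L: "\<And>P z. P \<in> components w \<Longrightarrow> z \<in> P \<Longrightarrow> L P (next_point w z) = L P z + jump w ?C z"
    by metis
  define M where "M z = L (component w z) z" for z
  have M: "M (next_point w z) = M z + jump w ?C z" if "z \<in> points w" for z
    using L[of "component w z" z] that component_refl by (simp add: M_def component_next[OF d that] components_def)
  show ?thesis
    using run_exists[OF d component_next[OF d] M] that by metis
qed

section \<open>Invariance of the linking data and of the writhes\<close>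

text \<open>Every run is constant on components; this adds that no two components share a colour.
  Colours are arbitrary values, so they can outlive the diagram whose components they first
  named.\<close>

definition separating :: "diag \<Rightarrow> (nat \<Rightarrow> 'c strand list) \<Rightarrow> bool" where
  "separating w \<rho> \<longleftrightarrow> (\<forall>x\<in>points w. \<forall>y\<in>points w. point_col \<rho> x = point_col \<rho> y \<longrightarrow> component w x = component w y)"

lemma separatingD: "separating w \<rho> \<Longrightarrow> x \<in> points w \<Longrightarrow> y \<in> points w \<Longrightarrow>
   point_col \<rho> x = point_col \<rho> y \<Longrightarrow> component w x = component w y"
  unfolding separating_def by blast

definition component_run :: "diag \<Rightarrow> (nat \<Rightarrow> 'c strand list) \<Rightarrow> bool" where
  "component_run w \<rho> \<longleftrightarrow> run w \<rho> \<and> \<rho> 0 = [] \<and> separating w \<rho>"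

lemma col_constant:
  assumes "diagram w" "run w \<rho>" "\<rho> 0 = []" "x \<in> points w" "component w y = component w x"
  shows "point_col \<rho> y = point_col \<rho> x"
proof (rule constant_on_component[OF assms(1) _ assms(4), of "point_col \<rho>" y])
  show "y \<in> component w x" using component_refl[of y w] assms(5) by simp
qed (rule run_next(1)[OF assms(1-3)])

definition transfer :: "diag \<Rightarrow> diag \<Rightarrow> diag \<Rightarrow> nat \<times> nat \<Rightarrow> nat \<times> nat" where
  "transfer u l r x = (transfer_row u l r (fst x), snd x)"

lemma transfer_point:
  assumes runs: "run (u @ l @ v) \<rho>" "\<rho> 0 = []" "run (u @ r @ v) \<rho>'" "\<rho>' 0 = []"
    and eq: "\<And>t. t \<le> length u \<Longrightarrow> \<rho>' t = \<rho> t"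
      "\<And>t. \<rho>' (length u + length r + t) = \<rho> (length u + length l + t)"
    and x: "x \<in> points (u @ l @ v)" "outer u l (fst x)"
  shows "transfer u l r x \<in> points (u @ r @ v)" "point_col \<rho>' (transfer u l r x) = point_col \<rho> x"
proof -
  have pl: "points (u @ l @ v) = {(t, p). t \<le> length (u @ l @ v) \<and> p < length (\<rho> t)}"
    and pr: "points (u @ r @ v) = {(t, p). t \<le> length (u @ r @ v) \<and> p < length (\<rho>' t)}"
    by (rule run_points; fact)+
  have "\<rho>' (transfer_row u l r (fst x)) = \<rho> (fst x) \<and> transfer_row u l r (fst x) \<le> length (u @ r @ v)"
  proof (cases "fst x \<le> length u")
    case True
    then show ?thesis by (simp add: transfer_row_def eq(1))
  next
    case False
    then have le: "length u + length l \<le> fst x" using x(2) by (simp add: outer_def)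
    define t where "t = fst x - (length u + length l)"
    have t: "fst x = length u + length l + t" using le by (simp add: t_def)
    have "transfer_row u l r (fst x) = length u + length r + t"
      unfolding transfer_row_def using False t by (simp only: if_False)
    moreover have "t \<le> length v" using x(1) t unfolding pl by auto
    ultimately show ?thesis using eq(2)[of t] t by simp
  qed
  then show "transfer u l r x \<in> points (u @ r @ v)" "point_col \<rho>' (transfer u l r x) = point_col \<rho> x"
    using x(1) unfolding pl pr by (auto simp: transfer_def point_col_def)
qed

lemma local_transport:
  assumes sm: "smove l r" and dl: "diagram (u @ l @ v)" and dr: "diagram (u @ r @ v)"
    and cr: "component_run (u @ l @ v) \<rho>"
  obtains \<rho>' where "component_run (u @ r @ v) \<rho>'" "total_weight (u @ r @ v) \<rho>' = total_weight (u @ l @ v) \<rho>"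
    "point_col \<rho>' ` points (u @ r @ v) = point_col \<rho> ` points (u @ l @ v)"
proof -
  let ?w = "u @ l @ v" and ?w' = "u @ r @ v"
  have run: "run ?w \<rho>" "\<rho> 0 = []" and sep: "separating ?w \<rho>"
    using cr by (auto simp: component_run_def)
  obtain \<rho>' where r': "run ?w' \<rho>'" "\<rho>' 0 = []" "total_weight ?w' \<rho>' = total_weight ?w \<rho>"
    "\<And>t. t \<le> length u \<Longrightarrow> \<rho>' t = \<rho> t" 
    "\<And>t. \<rho>' (length u + length r + t) = \<rho> (length u + length l + t)"
    using transport[OF sm dr run] by metis
  \<comment> \<open>Distinct components of the new diagram stay apart in \<open>\<rho>'\<close>: they are told apart by the colouring
    \<open>\<sigma>\<close> of the new diagram by its own components, and \<open>\<sigma>\<close> can be carried back to the old diagram.\<close>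
  obtain \<sigma> where s: "run ?w' \<sigma>" "\<sigma> 0 = []" 
    "\<And>x. x \<in> points ?w' \<Longrightarrow> point_col \<sigma> x = component ?w' x"
    using run_by_components[OF dr] by metis
  obtain \<sigma>' where s': "run ?w \<sigma>'" "\<sigma>' 0 = []" 
    "\<And>t. t \<le> length u \<Longrightarrow> \<sigma>' t = \<sigma> t" 
    "\<And>t. \<sigma>' (length u + length l + t) = \<sigma> (length u + length r + t)"
    using transport[OF smove_sym[OF sm] dl s(1,2)] by metis
  have "separating ?w' \<rho>'"
    unfolding separating_def
  proof (intro ballI impI)
    fix x y assume x: "x \<in> points ?w'" and y: "y \<in> points ?w'"
      and xy: "point_col \<rho>' x = point_col \<rho>' y"
    have *: "\<exists>z\<in>points ?w. point_col \<rho> z = point_col \<rho>' x \<and> point_col \<sigma>' z = component ?w' x"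
      if x: "x \<in> points ?w'" for x
    proof -
      obtain x1 where x1: "x1 \<in> points ?w'" "outer u r (fst x1)" "point_col \<sigma> x1 = point_col \<sigma> x"
        using inner_point[OF smove_sym[OF sm] s(1,2) x] by metis
      then have c: "component ?w' x1 = component ?w' x" using s(3) x by metis
      have "point_col \<rho>' x1 = point_col \<rho>' x" by (rule col_constant[OF dr r'(1,2) x c])
      moreover have "transfer u r l x1 \<in> points ?w" "point_col \<rho> (transfer u r l x1) = point_col \<rho>' x1"
        by (rule transfer_point[OF r'(1,2) run]; use r' x1 in simp)+
      moreover have "point_col \<sigma>' (transfer u r l x1) = point_col \<sigma> x1"
        by (rule transfer_point(2)[OF s(1,2) s'(1,2)]; use s' x1 in simp)
      ultimately show ?thesis using c s(3)[OF x1(1)] by auto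
    qed
    obtain z where z: "z \<in> points ?w" "point_col \<rho> z = point_col \<rho>' x" "point_col \<sigma>' z = component ?w' x"
      using *[OF x] by metis
    obtain z' where z': "z' \<in> points ?w" "point_col \<rho> z' = point_col \<rho>' y" "point_col \<sigma>' z' = component ?w' y"
      using *[OF y] by metis
    have "component ?w z = component ?w z'"
      by (rule separatingD[OF sep z(1) z'(1)]) (simp only: z(2) z'(2) xy)
    then have "point_col \<sigma>' z = point_col \<sigma>' z'" by (rule col_constant[OF dl s'(1,2) z'(1)])
    then show "component ?w' x = component ?w' y" using z z' by simp
  qed
  then have "component_run ?w' \<rho>'" using r' by (simp add: component_run_def)
  moreover have "point_col \<rho>' ` points ?w' = point_col \<rho> ` points ?w"
  proof (intro subset_antisym image_subsetI)
    fix x assume "x \<in> points ?w'"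
    then obtain x1 where x1: "x1 \<in> points ?w'" "outer u r (fst x1)" "point_col \<rho>' x1 = point_col \<rho>' x"
      using inner_point[OF smove_sym[OF sm] r'(1,2)] by metis
    have "transfer u r l x1 \<in> points ?w" "point_col \<rho> (transfer u r l x1) = point_col \<rho>' x1"
      by (rule transfer_point[OF r'(1,2) run]; use r' x1 in simp)+
    then show "point_col \<rho>' x \<in> point_col \<rho> ` points ?w" using x1 by (metis imageI)
  next
    fix x assume "x \<in> points ?w"
    then obtain x1 where x1: "x1 \<in> points ?w" "outer u l (fst x1)" "point_col \<rho> x1 = point_col \<rho> x"
      using inner_point[OF sm run] by metis
    have "transfer u l r x1 \<in> points ?w'" "point_col \<rho>' (transfer u l r x1) = point_col \<rho> x1"
      by (rule transfer_point[OF run r'(1,2)]; use r' x1 in simp)+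
    then show "point_col \<rho> x \<in> point_col \<rho>' ` points ?w'" using x1 by (metis imageI)
  qed
  ultimately show ?thesis using that r'(3) by blast
qed

lemma equivalent_transport:
  assumes "(w, w') \<in> equivalent" "component_run w \<rho>"
  obtains \<rho>' where "component_run w' \<rho>'" "total_weight w' \<rho>' = total_weight w \<rho>"
    "point_col \<rho>' ` points w' = point_col \<rho> ` points w"
proof -
  have "equivclp local_move w w'" using assms(1) by (simp add: equivalent_def)
  then have "\<exists>\<rho>'. component_run w' \<rho>' \<and> total_weight w' \<rho>' = total_weight w \<rho> \<and> 
      point_col \<rho>' ` points w' = point_col \<rho> ` points w"
  proof (induction rule: equivclp_induct)
    case base
    then show ?case using assms(2) by blast
  next
    case (step y z)
    then obtain \<rho>' where r: "component_run y \<rho>'" "total_weight y \<rho>' = total_weight w \<rho>" 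
      "point_col \<rho>' ` points y = point_col \<rho> ` points w" by blast
    from step(2) obtain u l r v where "y = u @ l @ v" "z = u @ r @ v" "smove l r" "diagram y" "diagram z"
      by (auto simp: smove_def elim!: local_move.cases)
    then show ?case using local_transport[of l r u v \<rho>'] r by metis
  qed
  then show ?thesis using that by blast
qed

section \<open>Linking data and writhes read off a decoration\<close>

definition over_sum :: "diag \<Rightarrow> (nat \<times> nat) set \<Rightarrow> (nat \<times> nat) set \<Rightarrow> int" where
  "over_sum w P Q = (\<Sum>c\<in>passes_over w P Q. crossing_sign w c)"

definition colour_class :: "diag \<Rightarrow> (nat \<Rightarrow> 'c strand list) \<Rightarrow> 'c \<Rightarrow> (nat \<times> nat) set" where
  "colour_class w \<rho> a = {x \<in> points w. point_col \<rho> x = a}"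

lemma colour_class_component:
  assumes "diagram w" "component_run w \<rho>" "x \<in> points w"
  shows "colour_class w \<rho> (point_col \<rho> x) = component w x"
proof -
  have r: "run w \<rho>" "\<rho> 0 = []" "separating w \<rho>" using assms(2) by (auto simp: component_run_def)
  show ?thesis
  proof (intro subset_antisym subsetI)
    fix y assume "y \<in> colour_class w \<rho> (point_col \<rho> x)"
    then have "component w y = component w x"
      by (intro separatingD[OF r(3) _ assms(3)]) (simp_all only: colour_class_def mem_Collect_eq)
    then show "y \<in> component w x" using component_refl by metis
  next
    fix y assume y: "y \<in> component w x"
    then show "y \<in> colour_class w \<rho> (point_col \<rho> x)"
      using component_subset[OF assms(1,3)] y
        col_constant[OF assms(1) r(1,2) assms(3) component_eq[OF assms(1,3) y]]
      unfolding colour_class_def by blast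
  qed
qed

text \<open>The potential is the label before a passage; subtracting the sign passes to the label
  after the over-passage, where the arc to the under-passage begins.\<close>

definition crossing_index :: "diag \<Rightarrow> (nat \<Rightarrow> 'c strand list) \<Rightarrow> nat \<Rightarrow> int" where
  "crossing_index w \<rho> c = potential w \<rho> (under_point w c) - potential w \<rho> (over_point w c) - crossing_sign w c"

lemma jump_over_under:
  assumes "X \<subseteq> classical w" "c \<in> X"
  shows "jump w X (over_point w c) = crossing_sign w c" "jump w X (under_point w c) = - crossing_sign w c"
proof -
  have ne: "snd (over_point w c) \<noteq> snd (under_point w c)" by (simp add: over_point_def under_point_def)
  have eq: "(c, snd (over_point w c)) = over_point w c" "(c, snd (under_point w c)) = under_point w c"
    by (simp_all add: prod_eq_iff)
  show "jump w X (over_point w c) = crossing_sign w c"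
    using jump_at[OF assms(1), of c "snd (over_point w c)"] assms(2) ne unfolding eq by simp
  show "jump w X (under_point w c) = - crossing_sign w c"
    using jump_at[OF assms(1), of c "snd (under_point w c)"] assms(2) ne unfolding eq by simp
qed

lemma weight_classical:
  assumes d: "diagram w" and run: "run w \<rho>" "\<rho> 0 = []" and c: "c \<in> classical w"
  shows "weight (w ! c) (\<rho> c) (a, b, n) =
     (if point_col \<rho> (over_point w c) = a \<and> point_col \<rho> (under_point w c) = b \<and>
         n = (if a = b then crossing_index w \<rho> c else 0) \<and> \<not> (a = b \<and> n = 0)
      then crossing_sign w c else 0)"
proof -
  let ?C = "same_col w (point_col \<rho>)"
  obtain k i where k: "w ! c = (Cross k, i)" "k \<noteq> Virtual" "c < length w" "Suc i < length (row w c)"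
    using classical_piece[OF d c] by metis
  have rows: "map fst (\<rho> c) = row w c" using run_row[OF run, of c] k(3) by simp
  have l: "length (\<rho> c) = length (row w c)" using arg_cong[OF rows, of length] by simp
  have r: "row w c ! i = fst (\<rho> c ! i)" "row w c ! Suc i = fst (\<rho> c ! Suc i)"
    unfolding rows[symmetric] using k(4) l by simp_all
  define g where "g = ssign k (\<rho> c ! i) (\<rho> c ! Suc i)"
  define V where "V = over_strand k (\<rho> c ! i) (\<rho> c ! Suc i)"
  define U where "U = over_strand k (\<rho> c ! Suc i) (\<rho> c ! i)"
  have sgn: "crossing_sign w c = g"
    using k r by (simp add: crossing_sign_def g_def ssign_def)
  have o: "\<rho> c ! snd (over_point w c) = V" "\<rho> c ! snd (under_point w c) = U"
    using k by (auto simp: over_point_def under_point_def V_def U_def over_strand_def)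
  have ro: "row w c ! snd (over_point w c) = fst V" "row w c ! snd (under_point w c) = fst U"
    using k r by (auto simp: over_point_def under_point_def V_def U_def over_strand_def)
  have col: "point_col \<rho> (over_point w c) = fst (snd V)" "point_col \<rho> (under_point w c) = fst (snd U)"
    by (simp_all add: point_col_def o)
  have ind: "sindex g V U = (if fst (snd V) = fst (snd U) then crossing_index w \<rho> c else 0)"
  proof (cases "fst (snd V) = fst (snd U)")
    case True
    then have "c \<in> ?C" using c col by (simp add: same_col_def)
    from jump_over_under[OF same_col_subset this] True show ?thesis
      by (simp add: sindex_def crossing_index_def potential_def o ro sgn)
  qed (simp add: sindex_def)
  show ?thesis unfolding col sgn
    using k(2) ind by (auto simp: k(1) event_def g_def[symmetric] V_def[symmetric] U_def[symmetric] Let_def)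
qed

lemma weight_not_classical:
  assumes "t < length w" "t \<notin> classical w" shows "weight (w ! t) (\<rho> t) key = 0"
proof -
  obtain x i where x: "w ! t = (x, i)" by force
  moreover have "k = Virtual" if "x = Cross k" for k
    using assms x that by (cases k) (auto simp: classical_def)
  ultimately show ?thesis by (cases x) auto
qed

lemma total_classical:
  assumes d: "diagram w" and run: "run w \<rho>" "\<rho> 0 = []"
  shows "total_weight w \<rho> (a, b, n) = (\<Sum>c\<in>{c\<in>classical w. point_col \<rho> (over_point w c) = a \<and> point_col \<rho> (under_point w c) = b \<and>
         n = (if a = b then crossing_index w \<rho> c else 0) \<and> \<not> (a = b \<and> n = 0)}. crossing_sign w c)"
proof -
  have "total_weight w \<rho> (a, b, n) = (\<Sum>t\<in>classical w. weight (w ! t) (\<rho> t) (a, b, n))"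
    unfolding total_weight_def
  proof (intro sum.mono_neutral_right)
    show "\<forall>t\<in>{..<length w} - classical w. weight (w ! t) (\<rho> t) (a, b, n) = 0"
      using weight_not_classical by blast
  qed (auto simp: classical_def)
  also have "\<dots> = (\<Sum>c\<in>classical w. if point_col \<rho> (over_point w c) = a \<and> point_col \<rho> (under_point w c) = b \<and>
         n = (if a = b then crossing_index w \<rho> c else 0) \<and> \<not> (a = b \<and> n = 0)
      then crossing_sign w c else 0)"
    by (intro sum.cong refl weight_classical[OF d run])
  finally show ?thesis by (simp add: sum.inter_filter)
qed

lemma crossing_sign_cases: "crossing_sign w c = 1 \<or> crossing_sign w c = - 1"
  by (simp add: crossing_sign_def)

lemma sum_crossing_sign:
  assumes "finite X"
  shows "(\<Sum>d\<in>X. crossing_sign w d * of_bool (Q d)) = 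
    int (card {d \<in> X. crossing_sign w d = 1 \<and> Q d}) - int (card {d \<in> X. crossing_sign w d = - 1 \<and> Q d})"
proof -
  have "(\<Sum>d\<in>X. crossing_sign w d * of_bool (Q d)) = 
     (\<Sum>d\<in>X. of_bool (crossing_sign w d = 1 \<and> Q d) - of_bool (crossing_sign w d = - 1 \<and> Q d))"
    using crossing_sign_cases[of w] by (intro sum.cong) auto
  then show ?thesis using assms by (simp add: sum_subtractf sum.inter_filter[symmetric] of_bool_def)
qed

lemma crossings_on_subset: "crossings_on w P \<subseteq> classical w"
  by (auto simp: crossings_on_def)

lemma finite_crossings_on [simp]: "finite (crossings_on w P)"
  using crossings_on_subset finite_classical finite_subset by blast

lemma component_arcs:
  assumes d: "diagram w" and P: "P \<in> components w" and c: "c \<in> crossings_on w P"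
  defines "A \<equiv> open_arc w (over_point w c) (under_point w c)"
    and "B \<equiv> open_arc w (under_point w c) (over_point w c)"
  shows "P = {over_point w c, under_point w c} \<union> A \<union> B" "A \<inter> B = {}"
    "over_point w c \<notin> A" "under_point w c \<notin> A" "over_point w c \<notin> B" "under_point w c \<notin> B"
    "over_point w c \<in> points w" "P = component w (over_point w c)"
    "(\<Sum>z\<in>P. J z) = J (over_point w c) + J (under_point w c) + (\<Sum>z\<in>A. J z) + (\<Sum>z\<in>B. (J z :: int))"
proof -
  have o: "over_point w c \<in> P" "under_point w c \<in> P" using c by (auto simp: crossings_on_def)
  obtain x where x: "x \<in> points w" "P = component w x" using P by (auto simp: components_def)
  show pt: "over_point w c \<in> points w" using o x component_subset[OF d x(1)] by auto
  show P': "P = component w (over_point w c)" using component_eq[OF d x(1)] o x by auto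
  have u: "under_point w c \<in> range (\<lambda>k. (next_point w ^^ k) (over_point w c))"
    using o(2) unfolding P' component_def .
  note s = sum_two_arcs[OF orbit_facts[OF d] pt u over_neq_under]
  show "P = {over_point w c, under_point w c} \<union> A \<union> B" "A \<inter> B = {}"
    "over_point w c \<notin> A" "under_point w c \<notin> A" "over_point w c \<notin> B" "under_point w c \<notin> B"
    using s(2-7) unfolding A_def B_def open_arc_eq_arc P' component_def by auto
  show "(\<Sum>z\<in>P. J z) = J (over_point w c) + J (under_point w c) + (\<Sum>z\<in>A. J z) + (\<Sum>z\<in>B. J z)"
    using s(1)[of J] unfolding A_def B_def open_arc_eq_arc P' component_def by simp
qed

text \<open>A chord with both ends in the arc from the over- to the under-passage of
  \<open>c\<close> contributes two jumps that cancel. A chord with one end in it crosses the chord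
  of \<open>c\<close>: from right to left if the end is its over-passage, which contributes the
  sign, and from left to right otherwise, which contributes the negated sign. The chord of
  \<open>c\<close> itself has no end in the open arc.\<close>

lemma Ind_eq_sum_jump:
  assumes d: "diagram w" and P: "P \<in> components w" and c: "c \<in> crossings_on w P"
  shows "Ind w P c = (\<Sum>z\<in>open_arc w (over_point w c) (under_point w c). jump w (crossings_on w P) z)"
proof -
  let ?A = "open_arc w (over_point w c) (under_point w c)" and ?B = "open_arc w (under_point w c) (over_point w c)"
  note arcs = component_arcs[OF d P c]
  have finP: "finite P" using arcs(7,8) component_subset[OF d] finite_points finite_subset by metis
  have finA: "finite ?A" using arcs(1) finP by (metis finite_Un)
  have "Ind w P c = (\<Sum>e\<in>crossings_on w P. crossing_sign w e * of_bool (right_to_left w c e)) -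
       (\<Sum>e\<in>crossings_on w P. crossing_sign w e * of_bool (left_to_right w c e))"
    unfolding sum_crossing_sign[OF finite_crossings_on] by (simp add: Ind_def Let_def)
  also have "\<dots> = (\<Sum>e\<in>crossings_on w P. crossing_sign w e * (of_bool (over_point w e \<in> ?A) - of_bool (under_point w e \<in> ?A)))"
    unfolding sum_subtractf[symmetric] right_diff_distrib[symmetric]
  proof (intro sum.cong refl arg_cong2[where f = "(*)"])
    fix e assume e: "e \<in> crossings_on w P"
    then have m: "over_point w e \<in> P" "under_point w e \<in> P" by (auto simp: crossings_on_def)
    show "of_bool (right_to_left w c e) - of_bool (left_to_right w c e) =
        (of_bool (over_point w e \<in> ?A) - of_bool (under_point w e \<in> ?A) :: int)"
    proof (cases "e = c")
      case True
      then show ?thesis using arcs(3-6) by (simp add: right_to_left_def left_to_right_def)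
    next
      case False
      have "fst (over_point w e) \<noteq> fst (over_point w c)" using False by simp
      then have "over_point w e \<notin> {over_point w c, under_point w c}" "under_point w e \<notin> {over_point w c, under_point w c}"
        using fst_over_under_point by (metis insertE singletonD)+
      then have "over_point w e \<in> ?A \<longleftrightarrow> over_point w e \<notin> ?B" "under_point w e \<in> ?A \<longleftrightarrow> under_point w e \<notin> ?B"
        using m arcs(1,2) by auto
      then show ?thesis by (simp add: right_to_left_def left_to_right_def)
    qed
  qed
  also have "\<dots> = (\<Sum>z\<in>?A. jump w (crossings_on w P) z)"
    using sum_jump[OF finA crossings_on_subset] by simp
  finally show ?thesis .
qed

text \<open>On a component, crossings with equal colours are just its self-crossings, so their jumps
  along the arc telescope to a difference of potentials.\<close>

lemma Ind_eq_crossing_index: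
  assumes d: "diagram w" and cr: "component_run w \<rho>" and x: "x \<in> points w"
    and c: "c \<in> crossings_on w (component w x)"
  shows "Ind w (component w x) c = crossing_index w \<rho> c"
proof -
  let ?P = "component w x" and ?C = "same_col w (point_col \<rho>)"
  let ?A = "open_arc w (over_point w c) (under_point w c)"
  have run: "run w \<rho>" "\<rho> 0 = []" using cr by (auto simp: component_run_def)
  have P: "?P \<in> components w" using x by (simp add: components_def)
  note arcs = component_arcs[OF d P c]
  have cls: "?P = colour_class w \<rho> (point_col \<rho> x)" using colour_class_component[OF d cr x] by simp
  have same: "t \<in> crossings_on w ?P \<longleftrightarrow> t \<in> ?C" if "over_point w t \<in> ?P \<or> under_point w t \<in> ?P" for t
    using that over_under_points[OF d, of t] unfolding cls
    by (auto simp: crossings_on_def same_col_def colour_class_def)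
  have cC: "c \<in> ?C" using c same[of c] by (auto simp: crossings_on_def)
  have "jump w (crossings_on w ?P) z = jump w ?C z" if "z \<in> ?A" for z
  proof -
    obtain t p where z: "z = (t, p)" by force
    have "z \<in> ?P" using that arcs(1) by auto
    then have "t \<in> crossings_on w ?P \<longleftrightarrow> t \<in> ?C" if "p = snd (over_point w t) \<or> p = snd (under_point w t)"
      using that same[of t] unfolding z by (metis fst_over_under_point prod.collapse)
    then show ?thesis unfolding z by (auto simp: jump_at[OF same_col_subset] jump_at[OF crossings_on_subset])
  qed
  then have "Ind w ?P c = (\<Sum>z\<in>?A. jump w ?C z)" using Ind_eq_sum_jump[OF d P c] by simp
  also have "\<dots> = potential w \<rho> (under_point w c) - potential w \<rho> (over_point w c) - jump w ?C (over_point w c)"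
    unfolding open_arc_eq_arc
  proof (rule arc_telescope[OF orbit_facts[OF d]])
    show "under_point w c \<in> range (\<lambda>k. (next_point w ^^ k) (over_point w c))"
      using c arcs(8) by (simp add: crossings_on_def component_def)
  qed (assumption | rule run_next(2)[OF d run] arcs(7) over_neq_under)+
  finally show ?thesis using jump_over_under(1)[OF same_col_subset cC] by (simp add: crossing_index_def)
qed

lemma total_over_sum:
  assumes d: "diagram w" and cr: "component_run w \<rho>" and "a \<noteq> b"
  shows "total_weight w \<rho> (a, b, 0) = over_sum w (colour_class w \<rho> a) (colour_class w \<rho> b)"
proof -
  have run: "run w \<rho>" "\<rho> 0 = []" using cr by (auto simp: component_run_def)
  show ?thesis unfolding over_sum_def total_classical[OF d run]
    by (rule sum.cong) (use assms(3) over_under_points[OF d] in \<open>auto simp: passes_over_def colour_class_def\<close>)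
qed

lemma total_writhe_at:
  assumes d: "diagram w" and cr: "component_run w \<rho>" and "k \<noteq> 0" and x: "x \<in> points w" "a = point_col \<rho> x"
  shows "total_weight w \<rho> (a, a, k) = writhe k w (colour_class w \<rho> a)"
proof -
  have run: "run w \<rho>" "\<rho> 0 = []" using cr by (auto simp: component_run_def)
  have cls: "colour_class w \<rho> a = component w x" using colour_class_component[OF d cr x(1)] x(2) by simp
  have "c \<in> crossings_on w (colour_class w \<rho> a) \<longleftrightarrow> c \<in> classical w \<and> point_col \<rho> (over_point w c) = a \<and>
     point_col \<rho> (under_point w c) = a" for c
    using over_under_points[OF d, of c] by (auto simp: crossings_on_def colour_class_def)
  moreover have "Ind w (colour_class w \<rho> a) c = crossing_index w \<rho> c" if "c \<in> crossings_on w (colour_class w \<rho> a)" for c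
    using Ind_eq_crossing_index[OF d cr x(1)] that cls by simp
  ultimately show ?thesis unfolding writhe_def total_classical[OF d run]
    by (intro sum.cong) (use assms(3) in auto)
qed

text \<open>The colours of the initial decoration are the components of \<open>v\<close> themselves.
  After transport to \<open>w\<close>, the class of colour \<open>P\<close> is the component of
  \<open>w\<close> that corresponds to \<open>P\<close>, which provides the bijection.\<close>

lemma equivalent_invariants:
  assumes "(v, w) \<in> equivalent"
  obtains g where "bij_betw g (components v) (components w)"
    "\<And>P Q. P \<in> components v \<Longrightarrow> Q \<in> components v \<Longrightarrow> P \<noteq> Q \<Longrightarrow> over_sum w (g P) (g Q) = over_sum v P Q"
    "\<And>P k. P \<in> components v \<Longrightarrow> k \<noteq> 0 \<Longrightarrow> writhe k w (g P) = writhe k v P"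
proof -
  have dia: "diagram v" "diagram w" using assms by (auto simp: equivalent_def)
  obtain \<rho> where r: "run v \<rho>" "\<rho> 0 = []" and pc: "\<And>x. x \<in> points v \<Longrightarrow> point_col \<rho> x = component v x"
    using run_by_components[OF dia(1)] by metis
  have cr: "component_run v \<rho>" using r pc by (simp add: component_run_def separating_def)
  obtain \<rho>' where cr': "component_run w \<rho>'" and tot: "total_weight w \<rho>' = total_weight v \<rho>"
    and im: "point_col \<rho>' ` points w = point_col \<rho> ` points v"
    using equivalent_transport[OF assms cr] by metis
  have comps: "point_col \<rho> ` points v = components v" using pc by (simp add: components_def)
  have cls: "colour_class v \<rho> P = P" if "P \<in> components v" for P
    using that colour_class_component[OF dia(1) cr] pc by (auto simp: components_def)
  let ?g = "colour_class w \<rho>'"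
  have ex: "\<exists>x\<in>points w. point_col \<rho>' x = P \<and> ?g P = component w x" if "P \<in> components v" for P
    using that comps im colour_class_component[OF dia(2) cr'] by (metis (no_types, lifting) imageE)
  show ?thesis
  proof
    show "bij_betw ?g (components v) (components w)"
    proof (rule bij_betw_imageI)
      show "inj_on ?g (components v)"
      proof (rule inj_onI)
        fix P Q assume "P \<in> components v" "Q \<in> components v" "?g P = ?g Q"
        moreover from this obtain x where "x \<in> points w" "point_col \<rho>' x = P" using ex by metis
        ultimately show "P = Q" by (auto simp: colour_class_def)
      qed
      show "?g ` components v = components w"
      proof
        show "?g ` components v \<subseteq> components w" using ex by (force simp: components_def)
        show "components w \<subseteq> ?g ` components v"
        proof
          fix R assume "R \<in> components w"
          then obtain x where x: "x \<in> points w" "R = component w x" by (auto simp: components_def)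
          then have "R = ?g (point_col \<rho>' x)" "point_col \<rho>' x \<in> components v"
            using colour_class_component[OF dia(2) cr' x(1)] im comps by auto
          then show "R \<in> ?g ` components v" by blast
        qed
      qed
    qed
    fix P assume P: "P \<in> components v"
    show "over_sum w (?g P) (?g Q) = over_sum v P Q" if "Q \<in> components v" "P \<noteq> Q" for Q
      using total_over_sum[OF dia(1) cr that(2)] total_over_sum[OF dia(2) cr' that(2)] tot cls P that by simp
    show "writhe k w (?g P) = writhe k v P" if "k \<noteq> 0" for k
    proof -
      obtain x where "x \<in> points v" "P = point_col \<rho> x" using P comps by (metis imageE)
      moreover obtain y where "y \<in> points w" "P = point_col \<rho>' y" using ex[OF P] by metis
      ultimately show ?thesis
        using total_writhe_at[OF dia(1) cr that] total_writhe_at[OF dia(2) cr' that] tot cls P by metis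
    qed
  qed
qed

lemma trivial_invariants:
  assumes "trivial w" "P \<in> components w"
  shows "Q \<in> components w \<Longrightarrow> P \<noteq> Q \<Longrightarrow> over_sum w P Q = 0" "k \<noteq> 0 \<Longrightarrow> writhe k w P = 0"
proof -
  obtain z where z: "(w, z) \<in> equivalent" "crossingless z" using assms by (auto simp: trivial_def)
  have "fst (z ! c) \<noteq> Cross k" if "c < length z" for c k
    using z(2) nth_mem[OF that] by (simp add: crossingless_def)
  then have "classical z = {}" by (auto simp: classical_def)
  then have "over_sum z X Y = 0" "writhe k z X = 0" for X Y
    by (simp_all add: over_sum_def passes_over_def writhe_def crossings_on_def)
  then show "Q \<in> components w \<Longrightarrow> P \<noteq> Q \<Longrightarrow> over_sum w P Q = 0" "k \<noteq> 0 \<Longrightarrow> writhe k w P = 0"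
    using equivalent_invariants[OF z(1)] assms(2) by metis+
qed

section \<open>Deformations of virtual tangles\<close>

lemma attach_local: "acts_locally (\<lambda>i s t. attach (x, i) s = Some t) (legs_below x) (legs_above x)"
  unfolding acts_locally_def
proof (intro allI impI)
  fix i s t assume "attach (x, i) s = Some t"
  then show "\<exists>p m m' q. s = p @ m @ q \<and> t = p @ m' @ q \<and> length p = i \<and> length m = legs_below x \<and>
      length m' = legs_above x \<and> (\<forall>p q. attach (x, length p) (p @ m @ q) = Some (p @ m' @ q))"
  proof (cases rule: attach_decompose)
    case (Cup b p q)
    then show ?thesis by (intro exI[of _ p] exI[of _ "[]"] exI[of _ "[b, \<not> b]"] exI[of _ q]) simp
  next
    case (Cap a b p q)
    then show ?thesis by (intro exI[of _ p] exI[of _ "[a, b]"] exI[of _ "[]"] exI[of _ q]) simp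
  next
    case (Cross k a b p q)
    then show ?thesis by (intro exI[of _ p] exI[of _ "[a, b]"] exI[of _ "[b, a]"] exI[of _ q]) simp
  qed
qed

lemma attach_height:
  assumes "i + legs_above x \<le> j"
  shows "attach_all [(x, i), (y, j)] s = Some t \<longleftrightarrow>
    attach_all [(y, j - legs_above x + legs_below x), (x, i)] s = Some t"
proof -
  have "attach_all [z, z'] s = Some t \<longleftrightarrow> (\<exists>s1. attach z s = Some s1 \<and> attach z' s1 = Some t)" for z z'
    by (auto split: Option.bind_splits)
  moreover have "(\<exists>s1. attach (x, i) s = Some s1 \<and> attach (y, j) s1 = Some t) \<longleftrightarrow>
      (\<exists>s1. attach (y, j - legs_above x + legs_below x) s = Some s1 \<and> attach (x, i) s1 = Some t)"
    by (rule height_swap[OF attach_local attach_local assms])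
  ultimately show ?thesis by simp
qed

definition fits :: "diag \<Rightarrow> bool list \<Rightarrow> bool" where
  "fits l s \<longleftrightarrow> attach_all l s \<noteq> None"

text \<open>Equal upper rows allow a step to be performed below any further pieces.\<close>

definition tangle_step :: "bool list \<Rightarrow> diag \<Rightarrow> diag \<Rightarrow> bool" where
  "tangle_step s l r \<longleftrightarrow> (\<exists>u a b v. l = u @ a @ v \<and> r = u @ b @ v \<and> smove a b \<and>
     attach_all l s \<noteq> None \<and> attach_all r s = attach_all l s)"

text \<open>
  The condition spares all later lemmas from tracking rows: moves that insert pieces apply only
  to rows that are long enough.
\<close>

definition deforms :: "bool list \<Rightarrow> diag \<Rightarrow> diag \<Rightarrow> bool" where
  "deforms s l r \<longleftrightarrow> (fits l s \<longrightarrow> (tangle_step s)\<^sup>*\<^sup>* l r)"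

definition deforms_always :: "diag \<Rightarrow> diag \<Rightarrow> bool" (infix "\<leadsto>" 50) where
  "l \<leadsto> r \<longleftrightarrow> (\<forall>s. deforms s l r)"

lemma tangle_steps_attach: "(tangle_step s)\<^sup>*\<^sup>* l r \<Longrightarrow> attach_all r s = attach_all l s"
  by (induction rule: rtranclp_induct) (auto simp: tangle_step_def)

lemma deforms_trans: "deforms s l m \<Longrightarrow> deforms s m r \<Longrightarrow> deforms s l r"
  using tangle_steps_attach[of s l m] by (auto simp: deforms_def fits_def)

lemma deforms_always_refl [simp]: "l \<leadsto> l"
  by (simp add: deforms_always_def deforms_def)

lemma deforms_always_trans [trans]: "l \<leadsto> m \<Longrightarrow> m \<leadsto> r \<Longrightarrow> l \<leadsto> r"
  unfolding deforms_always_def using deforms_trans by blast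

lemma tangle_steps_context:
  assumes "(tangle_step s') \<^sup>*\<^sup>* l r" "attach_all u s = Some s'" "fits (u @ l @ v) s"
  shows "(tangle_step s)\<^sup>*\<^sup>* (u @ l @ v) (u @ r @ v)"
  using assms(1)
proof (induction rule: rtranclp_induct)
  case (step y z)
  have y: "attach_all y s' = attach_all l s'" using step(1) by (rule tangle_steps_attach)
  from step(2) obtain u' a b v' where yz: "y = u' @ a @ v'" "z = u' @ b @ v'" "smove a b"
     "attach_all z s' = attach_all y s'" by (auto simp: tangle_step_def)
  have "attach_all (u @ y @ v) s = attach_all (u @ l @ v) s" "attach_all (u @ z @ v) s = attach_all (u @ y @ v) s"
    using y yz(4) assms(2) by (simp_all add: attach_all_append)
  then have "tangle_step s (u @ y @ v) (u @ z @ v)"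
    unfolding tangle_step_def using yz(1-3) assms(3)
    by (intro exI[of _ "u @ u'"] exI[of _ a] exI[of _ b] exI[of _ "v' @ v"]) (simp add: fits_def)
  then show ?case using step(3) by simp
qed simp

lemma deforms_context: "attach_all u s = Some s' \<Longrightarrow> deforms s' l r \<Longrightarrow> deforms s (u @ l @ v) (u @ r @ v)"
  unfolding deforms_def using tangle_steps_context[of s' l r u s v]
  by (auto simp: fits_def attach_all_append split: Option.bind_splits)

lemma deforms_suffix: "deforms s l r \<Longrightarrow> deforms s (l @ v) (r @ v)"
  using deforms_context[of "[]" s s l r v] by simp

lemma deforms_always_context: "l \<leadsto> r \<Longrightarrow> u @ l @ v \<leadsto> u @ r @ v"
proof -
  assume a: "l \<leadsto> r"
  have "deforms s (u @ l @ v) (u @ r @ v)" for s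
  proof (cases "attach_all u s")
    case None
    then show ?thesis by (simp add: deforms_def fits_def attach_all_append)
  next
    case (Some s')
    then show ?thesis using a deforms_context by (simp add: deforms_always_def)
  qed
  then show ?thesis by (simp add: deforms_always_def)
qed

text \<open>The context serves moves that insert a bigon: a neighbouring maximum or minimum
  guarantees that the row has the strands it needs.\<close>

lemma deforms_always_moveI:
  assumes "smove l r" "\<And>s t. attach_all (u @ l @ v) s = Some t \<Longrightarrow> attach_all (u @ r @ v) s = Some t"
  shows "u @ l @ v \<leadsto> u @ r @ v"
proof -
  have "tangle_step s (u @ l @ v) (u @ r @ v)" if "fits (u @ l @ v) s" for s
    unfolding tangle_step_def using assms that
    by (intro exI[of _ u] exI[of _ l] exI[of _ r] exI[of _ v]) (auto simp: fits_def)
  then show ?thesis by (auto simp: deforms_always_def deforms_def)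
qed

lemmas deforms_always_move = deforms_always_moveI[of _ _ "[]" "[]", unfolded append_Nil append_Nil2]

abbreviation (input) virt :: "nat \<Rightarrow> piece \<times> nat" where "virt k \<equiv> (Cross Virtual, k)"

lemma deform_height:
  assumes "i + legs_above x \<le> j"
  shows "[(x, i), (y, j)] \<leadsto> [(y, j - legs_above x + legs_below x), (x, i)]"
    "[(y, j - legs_above x + legs_below x), (x, i)] \<leadsto> [(x, i), (y, j)]"
  using attach_height[OF assms] move.height[OF assms]
  by (intro deforms_always_move; simp add: smove_def)+

lemma deform_crossings:
  assumes "i + 2 \<le> j"
  shows "[virt i, virt j] \<leadsto> [virt j, virt i]" "[virt j, virt i] \<leadsto> [virt i, virt j]"
proof -
  have "j - legs_above (Cross Virtual) + legs_below (Cross Virtual) = j" using assms by simp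
  then show "[virt i, virt j] \<leadsto> [virt j, virt i]" "[virt j, virt i] \<leadsto> [virt i, virt j]"
    using deform_height[of i "Cross Virtual" j "Cross Virtual"] assms by (metis legs_above.simps(3))+
qed

lemma deform_crossing_cap: "[virt (Suc (Suc k)), (Cap, 0)] \<leadsto> [(Cap, 0), virt k]"
  using deform_height(2)[of 0 Cap k "Cross Virtual"] by simp

lemma deform_cup_crossing: "i \<le> k \<Longrightarrow> [(Cup b, i), virt (Suc (Suc k))] \<leadsto> [virt k, (Cup b, i)]"
  using deform_height(1)[of i "Cup b" "Suc (Suc k)" "Cross Virtual"] by simp

lemma deform_cup_cap: "[(Cup b, 2), (Cap, 0)] \<leadsto> [(Cap, 0), (Cup b, 0)]"
  using deform_height(2)[of 0 Cap 0 "Cup b"] by (simp add: numeral_2_eq_2)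

text \<open>While the circle at the far left is open, it merely displaces the other piece by its two
  strands.\<close>

lemma deform_circle: "[(x, j), (Cup b, 0), (Cap, 0)] \<leadsto> [(Cup b, 0), (Cap, 0), (x, j)]"
proof -
  have "[(x, j)] @ [(Cup b, 0)] \<leadsto> [(Cup b, 0)] @ [(x, j + 2)]"
    using deform_height(2)[of 0 "Cup b" "j + 2" x] by simp
  from deforms_always_context[OF this, of "[]" "[(Cap, 0)]"]
  have "[(x, j), (Cup b, 0), (Cap, 0)] \<leadsto> [(Cup b, 0), (x, j + 2), (Cap, 0)]" by simp
  also have "[(x, j + 2), (Cap, 0)] \<leadsto> [(Cap, 0), (x, j)]"
    using deform_height(2)[of 0 Cap j x] by simp
  from deforms_always_context[OF this, of "[(Cup b, 0)]" "[]"]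
  have "[(Cup b, 0), (x, j + 2), (Cap, 0)] \<leadsto> [(Cup b, 0), (Cap, 0), (x, j)]" by simp
  finally show ?thesis .
qed

lemma deform_zigzag_left: "[(Cup b, Suc i), (Cap, i)] \<leadsto> []"
proof (rule deforms_always_move)
  fix s t assume a: "attach_all [(Cup b, Suc i), (Cap, i)] s = Some t"
  have i: "i < length s \<and> s ! i = (\<not> b)" using zigzag_fits(2)[of b i s] unfolding a by simp
  then obtain p c q where s: "s = p @ c # q" "i = length p" using split_at_1[of i s] by blast
  with i have "c = (\<not> b)" by simp
  then show "attach_all [] s = Some t" using a by (auto simp add: s nth_append)
qed (simp add: smove_def move.intros)

lemma deform_kink_cup: "[(Cup b, i), virt i] \<leadsto> [(Cup (\<not> b), i)]"
proof (rule deforms_always_move)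
  fix s t assume a: "attach_all [(Cup b, i), virt i] s = Some t"
  then have "i \<le> length s" by (auto split: if_splits)
  then obtain p q where "s = p @ q" "i = length p"
    by (metis append_take_drop_id length_take min.absorb2)
  then show "attach_all [(Cup (\<not> b), i)] s = Some t" using a by simp
qed (simp add: smove_def move.intros)

lemma deform_bigon: "[virt i, virt i] \<leadsto> []"
proof (rule deforms_always_move)
  fix s t assume a: "attach_all [virt i, virt i] s = Some t"
  then obtain p x y q where "s = p @ x # y # q" "i = length p" using split_at_2[of i s] by (auto split: if_splits)
  then show "attach_all [] s = Some t" using a by simp
next
  show "smove [virt i, virt i] []" using move.bigon[of Virtual i] by (simp add: smove_def)
qed

lemma deform_braid: "[virt k, virt (Suc k), virt k] \<leadsto> [virt (Suc k), virt k, virt (Suc k)]"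
proof (rule deforms_always_move)
  fix s t assume a: "attach_all [virt k, virt (Suc k), virt k] s = Some t"
  then have "Suc (Suc k) < length s" by (auto split: if_splits)
  then obtain p x y z q where "s = p @ x # y # z # q" "k = length p" using split_at_3[of k s] by blast
  then show "attach_all [virt (Suc k), virt k, virt (Suc k)] s = Some t" using a by (simp add: nth_append)
qed (simp add: smove_def move.intros)

lemma deform_slide_cup: "[(Cup b, i), virt (Suc i)] \<leadsto> [(Cup b, Suc i), virt i]" (is "?l \<leadsto> ?r")
    and deform_slide_cup': "[(Cup b, Suc i), virt i] \<leadsto> [(Cup b, i), virt (Suc i)]"
proof -
  have *: "attach_all ?l s = attach_all ?r s" for s
  proof (cases "i < length s")
    case True
    then obtain p x q where "s = p @ x # q" "i = length p" using split_at_1 by blast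
    then show ?thesis by (simp add: nth_append)
  qed simp
  have "smove ?l ?r" using move.slide_cup[of b i Virtual] by (simp add: smove_def)
  then show "?l \<leadsto> ?r" "?r \<leadsto> ?l" using * smove_sym by (auto intro!: deforms_always_move)
qed

lemma deform_slide_cap: "[virt i, (Cap, Suc i)] \<leadsto> [virt (Suc i), (Cap, i)]"
proof (rule deforms_always_move)
  fix s t assume a: "attach_all [virt i, (Cap, Suc i)] s = Some t"
  then have "Suc (Suc i) < length s" by (auto split: if_splits)
  then obtain p x y z q where "s = p @ x # y # z # q" "i = length p" using split_at_3[of i s] by blast
  then show "attach_all [virt (Suc i), (Cap, i)] s = Some t" using a by (auto simp add: nth_append split: if_splits)
next
  show "smove [virt i, (Cap, Suc i)] [virt (Suc i), (Cap, i)]"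
    using move.slide_cap[of Virtual i] by (simp add: smove_def)
qed

lemma deform_kink_cap: "[virt i, (Cap, i)] \<leadsto> [(Cap, i)]"
proof (rule deforms_always_move)
  fix s t assume a: "attach_all [virt i, (Cap, i)] s = Some t"
  then obtain p x y q where "s = p @ x # y # q" "i = length p" using split_at_2[of i s] by (auto split: if_splits)
  then show "attach_all [(Cap, i)] s = Some t" using a by (auto split: if_splits)
qed (simp add: smove_def move.intros)

text \<open>A virtual bigon is inserted below the maximum, and the maximum slides to the left across
  the upper of its crossings.\<close>

lemma deform_cap_down: "[(Cap, Suc i)] \<leadsto> [virt i, virt (Suc i), (Cap, i)]"
proof -
  have "[] @ [] @ [(Cap, Suc i)] \<leadsto> [] @ [virt i, virt i] @ [(Cap, Suc i)]"
  proof (rule deforms_always_moveI)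
    fix s t assume a: "attach_all ([] @ [] @ [(Cap, Suc i)]) s = Some t"
    then obtain p x y z q where "s = p @ x # y # z # q" "i = length p"
      using split_at_3[of i s] by (auto split: if_splits)
    then show "attach_all ([] @ [virt i, virt i] @ [(Cap, Suc i)]) s = Some t"
      using a by (auto simp add: nth_append split: if_splits)
  qed (use move.bigon[of Virtual i] in \<open>simp add: smove_def\<close>)
  also have "[] @ [virt i, virt i] @ [(Cap, Suc i)] \<leadsto> [virt i, virt (Suc i), (Cap, i)]"
    using deforms_always_context[OF deform_slide_cap[of i], of "[virt i]" "[]"] by simp
  finally show ?thesis by simp
qed

lemma deform_cup_down: "[(Cup b, Suc i)] \<leadsto> [(Cup b, i), virt (Suc i), virt i]"
proof -
  have "[(Cup b, Suc i)] @ [] @ [] \<leadsto> [(Cup b, Suc i)] @ [virt i, virt i] @ []"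
  proof (rule deforms_always_moveI)
    fix s t assume a: "attach_all ([(Cup b, Suc i)] @ [] @ []) s = Some t"
    then have "i < length s" by (auto split: if_splits)
    then obtain p x q where s: "s = p @ x # q" "i = length p" using split_at_1 by blast
    then have t: "t = p @ x # b # (\<not> b) # q" using a by simp
    show "attach_all ([(Cup b, Suc i)] @ [virt i, virt i] @ []) s = Some t" unfolding s t by (simp add: nth_append)
  qed (use move.bigon[of Virtual i] in \<open>simp add: smove_def\<close>)
  also have "[(Cup b, Suc i)] @ [virt i, virt i] @ [] \<leadsto> [(Cup b, i), virt (Suc i), virt i]"
    using deforms_always_context[OF deform_slide_cup'[of b i], of "[]" "[virt i]"] by simp
  finally show ?thesis by simp
qed

section \<open>Diagrams with only virtual crossings are trivial\<close>

definition virts :: "nat list \<Rightarrow> diag" where "virts ks = map (\<lambda>k. (Cross Virtual, k)) ks"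

lemma virts_simps [simp]: "virts [] = []" "virts (k # ks) = virt k # virts ks" "virts (ks @ ls) = virts ks @ virts ls"
  by (simp_all add: virts_def)

text \<open>Brings strand \<open>i\<close> to position \<open>k\<close>, for \<open>k \<le> i\<close>.\<close>

definition pull :: "nat \<Rightarrow> nat \<Rightarrow> diag" where "pull k i = virts (rev [k..<i])"

lemma pull_same [simp]: "pull k k = []"
  by (simp add: pull_def)

lemma pull_Suc: "k \<le> i \<Longrightarrow> pull k (Suc i) = virt i # pull k i"
  by (simp add: pull_def)

lemma context_at: "l \<leadsto> r \<Longrightarrow> x = u @ l @ v \<Longrightarrow> y = u @ r @ v \<Longrightarrow> x \<leadsto> y"
  using deforms_always_context by simp

section \<open>Moving virtual crossings and minima past a maximum\<close>

lemma crossing_past: "(\<And>j. j \<in> set ks \<Longrightarrow> j + 2 \<le> k) \<Longrightarrow> virt k # virts ks \<leadsto> virts ks @ [virt k]"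
proof (induction ks)
  case (Cons j ks)
  have "virt k # virts (j # ks) \<leadsto> virt j # virt k # virts ks"
    by (rule context_at[OF deform_crossings(2)[of j k], of _ "[]" "virts ks"]) (use Cons in auto)
  also have "\<dots> \<leadsto> virts (j # ks) @ [virt k]"
    by (rule context_at[OF Cons.IH, of _ "[virt j]" "[]"]) (use Cons in auto)
  finally show ?case .
qed simp

lemma crossing_past': "(\<And>j. j \<in> set ks \<Longrightarrow> k + 2 \<le> j) \<Longrightarrow> virt k # virts ks \<leadsto> virts ks @ [virt k]"
proof (induction ks)
  case (Cons j ks)
  have "virt k # virts (j # ks) \<leadsto> virt j # virt k # virts ks"
    by (rule context_at[OF deform_crossings(1)[of k j], of _ "[]" "virts ks"]) (use Cons in auto)
  also have "\<dots> \<leadsto> virts (j # ks) @ [virt k]"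
    by (rule context_at[OF Cons.IH, of _ "[virt j]" "[]"]) (use Cons in auto)
  finally show ?case .
qed simp

lemma pull_append: "q \<le> k \<Longrightarrow> k \<le> i \<Longrightarrow> pull q i = pull k i @ pull q k"
  using upt_add_eq_append[of q k "i - k"] by (simp add: pull_def)

text \<open>The strand that ends at position \<open>q\<close> is traced down through the new
  crossing. The crossing lies to the right of its start, or lengthens the pull by one step, or
  cancels its first crossing, or is carried through it by the braid relation. What remains above
  involves other strands only, hence positions beyond \<open>q\<close>.\<close>

lemma crossing_pull:
  assumes "q \<le> k" "q \<le> i"
  shows "\<exists>i' X. q \<le> i' \<and> (\<forall>x\<in>set X. Suc q \<le> x) \<and> virt k # pull q i \<leadsto> pull q i' @ virts X"
proof -
  consider "i < k" | "k = i" | "i = Suc k" | "k + 2 \<le> i" by linarith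
  then show ?thesis
  proof cases
    case 1
    have "virt k # pull q i \<leadsto> pull q i @ [virt k]"
      unfolding pull_def by (rule crossing_past) (use 1 in auto)
    then show ?thesis using assms 1 by (intro exI[of _ i] exI[of _ "[k]"]) simp
  next
    case 2
    then show ?thesis using assms by (intro exI[of _ "Suc k"] exI[of _ "[]"]) (simp add: pull_Suc)
  next
    case 3
    have "virt k # pull q i \<leadsto> pull q k"
      by (rule context_at[OF deform_bigon[of k], of _ "[]" "pull q k"]) (use 3 assms in \<open>simp_all add: pull_Suc\<close>)
    then show ?thesis using assms by (intro exI[of _ k] exI[of _ "[]"]) simp
  next
    case 4
    have p: "pull q i = pull (k + 2) i @ virt (Suc k) # virt k # pull q k"
      using 4 assms pull_append[of q "k + 2" i] by (simp add: pull_Suc)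
    have "virt k # pull q i \<leadsto> pull (k + 2) i @ virt k # virt (Suc k) # virt k # pull q k"
    proof (rule context_at[of "virt k # pull (k + 2) i" "pull (k + 2) i @ [virt k]" _ "[]"])
      show "virt k # pull (k + 2) i \<leadsto> pull (k + 2) i @ [virt k]"
        unfolding pull_def by (rule crossing_past') auto
    qed (simp_all add: p)
    also have "\<dots> \<leadsto> pull (k + 2) i @ virt (Suc k) # virt k # virt (Suc k) # pull q k"
      by (rule context_at[OF deform_braid[of k], of _ "pull (k + 2) i" "pull q k"]) simp_all
    also have "\<dots> \<leadsto> pull q i @ [virt (Suc k)]"
    proof (rule context_at[of "virt (Suc k) # pull q k" "pull q k @ [virt (Suc k)]" _ "pull (k + 2) i @ [virt (Suc k), virt k]" "[]"])
      show "virt (Suc k) # pull q k \<leadsto> pull q k @ [virt (Suc k)]"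
        unfolding pull_def by (rule crossing_past) auto
    qed (simp_all add: p)
    finally show ?thesis using assms by (intro exI[of _ i] exI[of _ "[Suc k]"]) simp
  qed
qed

lemma crossings_pull:
  assumes "\<forall>k\<in>set ks. q \<le> k" "q \<le> i"
  shows "\<exists>i' X. q \<le> i' \<and> (\<forall>x\<in>set X. Suc q \<le> x) \<and> virts ks @ pull q i \<leadsto> pull q i' @ virts X"
  using assms
proof (induction ks)
  case Nil
  then show ?case by (intro exI[of _ i] exI[of _ "[]"]) simp
next
  case (Cons k ks)
  then obtain i' X where 1: "q \<le> i'" "\<forall>x\<in>set X. Suc q \<le> x" "virts ks @ pull q i \<leadsto> pull q i' @ virts X" by auto
  obtain j Y where 2: "q \<le> j" "\<forall>x\<in>set Y. Suc q \<le> x" "virt k # pull q i' \<leadsto> pull q j @ virts Y"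
    using crossing_pull[of q k i'] Cons.prems 1(1) by auto
  have "virts (k # ks) @ pull q i \<leadsto> virt k # pull q i' @ virts X"
    by (rule context_at[OF 1(3), of _ "[virt k]" "[]"]) simp_all
  also have "\<dots> \<leadsto> pull q j @ virts (Y @ X)"
    by (rule context_at[OF 2(3), of _ "[]" "virts X"]) simp_all
  finally show ?case using 1 2 by (intro exI[of _ j] exI[of _ "Y @ X"]) auto
qed

lemma crossings_cap: "\<forall>k\<in>set ks. 2 \<le> k \<Longrightarrow> \<exists>X. virts ks @ [(Cap, 0)] \<leadsto> (Cap, 0) # virts X"
proof (induction ks)
  case Nil
  then show ?case by (intro exI[of _ "[]"]) simp
next
  case (Cons k ks)
  then obtain X where X: "virts ks @ [(Cap, 0)] \<leadsto> (Cap, 0) # virts X" by auto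
  have "2 \<le> k" using Cons.prems by simp
  then have k: "Suc (Suc (k - 2)) = k" by linarith
  have "virts (k # ks) @ [(Cap, 0)] \<leadsto> virt k # (Cap, 0) # virts X"
    by (rule context_at[OF X, of _ "[virt k]" "[]"]) simp_all
  also have "\<dots> \<leadsto> (Cap, 0) # virts ((k - 2) # X)"
    by (rule context_at[OF deform_crossing_cap[of "k - 2"], of _ "[]" "virts X"]) (simp_all add: k)
  finally show ?case by blast
qed

text \<open>A maximum joining two distant strands.\<close>

definition long_cap :: "nat \<Rightarrow> nat \<Rightarrow> diag" where
  "long_cap i j = pull 0 i @ pull 1 j @ [(Cap, 0)]"

text \<open>The two strands joined by the maximum are pulled out one after the other. The crossings
  left over then lie at positions 2 and higher and rise above the maximum.\<close>

lemma crossings_long_cap: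
  assumes "1 \<le> j"
  shows "\<exists>i' j' X. 1 \<le> j' \<and> virts ks @ long_cap i j \<leadsto> long_cap i' j' @ virts X"
proof -
  obtain i' X where 1: "\<forall>x\<in>set X. Suc 0 \<le> x" "virts ks @ pull 0 i \<leadsto> pull 0 i' @ virts X"
    using crossings_pull[of ks 0 i] by auto
  obtain j' Y where 2: "1 \<le> j'" "\<forall>x\<in>set Y. Suc 1 \<le> x" "virts X @ pull 1 j \<leadsto> pull 1 j' @ virts Y"
    using crossings_pull[of X 1 j] 1 assms by auto
  obtain Z where 3: "virts Y @ [(Cap, 0)] \<leadsto> (Cap, 0) # virts Z"
    using crossings_cap[of Y] 2(2) by (auto simp: numeral_2_eq_2)
  have "virts ks @ long_cap i j \<leadsto> pull 0 i' @ virts X @ pull 1 j @ [(Cap, 0)]"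
    by (rule context_at[OF 1(2), of _ "[]" "pull 1 j @ [(Cap, 0)]"]) (simp_all add: long_cap_def)
  also have "\<dots> \<leadsto> pull 0 i' @ pull 1 j' @ virts Y @ [(Cap, 0)]"
    by (rule context_at[OF 2(3), of _ "pull 0 i'" "[(Cap, 0)]"]) simp_all
  also have "\<dots> \<leadsto> long_cap i' j' @ virts Z"
    by (rule context_at[OF 3, of _ "pull 0 i' @ pull 1 j'" "[]"]) (simp_all add: long_cap_def)
  finally show ?thesis using 2 by blast
qed

lemma cup_crossings: "\<forall>k\<in>set ks. i \<le> k \<Longrightarrow> (Cup b, i) # virts (map (\<lambda>k. k + 2) ks) \<leadsto> virts ks @ [(Cup b, i)]"
proof (induction ks)
  case (Cons k ks)
  have "(Cup b, i) # virts (map (\<lambda>k. k + 2) (k # ks)) \<leadsto> virt k # (Cup b, i) # virts (map (\<lambda>k. k + 2) ks)"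
    by (rule context_at[OF deform_cup_crossing[of i k b], of _ "[]" "virts (map (\<lambda>k. k + 2) ks)"]) (use Cons in auto)
  also have "\<dots> \<leadsto> virts (k # ks) @ [(Cup b, i)]"
    by (rule context_at[OF Cons.IH, of _ "[virt k]" "[]"]) (use Cons in auto)
  finally show ?case .
qed simp

lemma cup_pull_far: "k \<le> i \<Longrightarrow> (Cup b, k) # pull (k + 2) (i + 2) \<leadsto> pull k i @ [(Cup b, k)]"
proof -
  assume "k \<le> i"
  have "[k + 2..<i + 2] = map (\<lambda>k. k + 2) [k..<i]" by (rule nth_equalityI) (simp_all del: upt_Suc)
  then have "rev [k + 2..<i + 2] = map (\<lambda>k. k + 2) (rev [k..<i])" by (simp only: rev_map)
  then show ?thesis using cup_crossings[of "rev [k..<i]" k b] unfolding pull_def by auto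
qed

text \<open>The pulled strand crosses both legs of the minimum. Sliding the minimum across it makes
  the two crossings a bigon, so the minimum ends on the right of the strand.\<close>

lemma cup_pull: "k \<le> i \<Longrightarrow> (Cup b, k) # pull k (i + 2) \<leadsto> pull k i @ [(Cup b, Suc k)]"
proof -
  assume k: "k \<le> i"
  have p: "pull k (i + 2) = pull (k + 2) (i + 2) @ [virt (Suc k), virt k]"
  proof -
    have "pull k (k + 2) = [virt (Suc k), virt k]" by (simp add: pull_Suc)
    moreover have "pull k (i + 2) = pull (k + 2) (i + 2) @ pull k (k + 2)"
      by (rule pull_append) (use k in auto)
    ultimately show ?thesis by metis
  qed
  have "(Cup b, k) # pull k (i + 2) \<leadsto> pull k i @ (Cup b, k) # [virt (Suc k), virt k]"
    by (rule context_at[OF cup_pull_far[OF k, of b], of _ "[]" "[virt (Suc k), virt k]"]) (simp_all add: p[simplified])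
  also have "\<dots> \<leadsto> pull k i @ (Cup b, Suc k) # [virt k, virt k]"
    by (rule context_at[OF deform_slide_cup[of b k], of _ "pull k i" "[virt k]"]) simp_all
  also have "\<dots> \<leadsto> pull k i @ [(Cup b, Suc k)]"
    by (rule context_at[OF deform_bigon[of k], of _ "pull k i @ [(Cup b, Suc k)]" "[]"]) simp_all
  finally show ?thesis .
qed

text \<open>The maximum joins the left leg of the minimum either to the right leg, which gives a
  circle, or to another strand, in which case the minimum travels up to the maximum and cancels it
  as a zigzag.\<close>

lemma cup_long_cap_0:
  assumes "1 \<le> j"
  shows "(\<exists>X. (Cup b, 0) # long_cap 0 j \<leadsto> virts X) \<or> (Cup b, 0) # long_cap 0 j \<leadsto> [(Cup b, 0), (Cap, 0)]"
proof (cases "j = 1")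
  case True
  then show ?thesis by (simp add: long_cap_def)
next
  case False
  then obtain m where j: "j = m + 2" using assms by (metis add.commute le_Suc_ex le_antisym not_less_eq_eq one_add_one plus_nat.simps(2) One_nat_def numeral_2_eq_2)
  have p: "pull 1 (m + 2) = pull 2 (m + 2) @ [virt 1]"
  proof -
    have "pull 1 2 = [virt 1]" by (simp add: pull_def numeral_2_eq_2)
    moreover have "pull 1 (m + 2) = pull 2 (m + 2) @ pull 1 2" by (rule pull_append) auto
    ultimately show ?thesis by metis
  qed
  have "(Cup b, 0) # long_cap 0 j \<leadsto> pull 0 m @ [(Cup b, 0), virt 1, (Cap, 0)]"
    by (rule context_at[OF cup_pull_far[of 0 m b], of _ "[]" "[virt 1, (Cap, 0)]"]) (simp_all add: p[simplified] long_cap_def j numeral_2_eq_2)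
  also have "\<dots> \<leadsto> pull 0 m @ [(Cup b, 1), virt 0, (Cap, 0)]"
    by (rule context_at[OF deform_slide_cup[of b 0], of _ "pull 0 m" "[(Cap, 0)]"]) simp_all
  also have "\<dots> \<leadsto> pull 0 m @ [(Cup b, 1), (Cap, 0)]"
    by (rule context_at[OF deform_kink_cap[of 0], of _ "pull 0 m @ [(Cup b, 1)]" "[]"]) simp_all
  also have "\<dots> \<leadsto> pull 0 m"
    by (rule context_at[OF deform_zigzag_left[of b 0], of _ "pull 0 m" "[]"]) simp_all
  finally show ?thesis unfolding pull_def by blast
qed

text \<open>The three outcomes: maximum and minimum share one leg and cancel, share both and form a
  circle, or share none and exchange heights. Positions 0 and 1 are the legs of the minimum; a pull
  starting at its right leg makes a kink that can be undone.\<close>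

lemma cup_long_cap:
  assumes "1 \<le> j"
  shows "(\<exists>X. (Cup b, 0) # long_cap i j \<leadsto> virts X) \<or> (\<exists>b'. (Cup b, 0) # long_cap i j \<leadsto> [(Cup b', 0), (Cap, 0)]) \<or>
    (\<exists>i' j'. 1 \<le> j' \<and> (Cup b, 0) # long_cap i j \<leadsto> long_cap i' j' @ [(Cup b, 0)])"
proof -
  consider "i = 0" | "i = 1" | m where "i = m + 2"
    by (metis One_nat_def add_2_eq_Suc' not0_implies_Suc)
  then show ?thesis
  proof cases
    case 1
    then show ?thesis using cup_long_cap_0[OF assms] by blast
  next
    case 2
    have "(Cup b, 0) # long_cap i j \<leadsto> (Cup (\<not> b), 0) # long_cap 0 j"
      by (rule context_at[OF deform_kink_cup[of b 0], of _ "[]" "long_cap 0 j"]) (simp_all add: 2 long_cap_def pull_Suc)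
    then show ?thesis using cup_long_cap_0[OF assms, of "\<not> b"] deforms_always_trans by blast
  next
    case (3 m)
    have start: "(Cup b, 0) # long_cap i j \<leadsto> pull 0 m @ (Cup b, 1) # pull 1 j @ [(Cap, 0)]"
      by (rule context_at[OF cup_pull[of 0 m b], of _ "[]" "pull 1 j @ [(Cap, 0)]"]) (simp_all add: long_cap_def 3)
    consider "j = 1" | "j = 2" | n where "j = n + 2" "1 \<le> n"
      using assms by (metis One_nat_def Suc_le_eq add_2_eq_Suc' gr0_conv_Suc less_eq_Suc_le not0_implies_Suc numeral_2_eq_2)
    then show ?thesis
    proof cases
      case 1
      have "pull 0 m @ (Cup b, 1) # pull 1 j @ [(Cap, 0)] \<leadsto> pull 0 m"
        by (rule context_at[OF deform_zigzag_left[of b 0], of _ "pull 0 m" "[]"]) (simp_all add: 1)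
      then show ?thesis using start deforms_always_trans unfolding pull_def by blast
    next
      case 2
      have "pull 0 m @ (Cup b, 1) # pull 1 j @ [(Cap, 0)] \<leadsto> pull 0 m @ [(Cup (\<not> b), 1), (Cap, 0)]"
        by (rule context_at[OF deform_kink_cup[of b 1], of _ "pull 0 m" "[(Cap, 0)]"]) (simp_all add: 2 numeral_2_eq_2 pull_Suc)
      also have "\<dots> \<leadsto> pull 0 m"
        by (rule context_at[OF deform_zigzag_left[of "\<not> b" 0], of _ "pull 0 m" "[]"]) simp_all
      finally show ?thesis using start deforms_always_trans unfolding pull_def by blast
    next
      case (3 n)
      have "pull 0 m @ (Cup b, 1) # pull 1 j @ [(Cap, 0)] \<leadsto> pull 0 m @ pull 1 n @ [(Cup b, 2), (Cap, 0)]"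
        by (rule context_at[OF cup_pull[OF 3(2), of b], of _ "pull 0 m" "[(Cap, 0)]"]) (simp_all add: 3 numeral_2_eq_2)
      also have "\<dots> \<leadsto> long_cap m n @ [(Cup b, 0)]"
        by (rule context_at[OF deform_cup_cap[of b], of _ "pull 0 m @ pull 1 n" "[]"]) (simp_all add: long_cap_def)
      finally show ?thesis using start deforms_always_trans 3(2) by blast
    qed
  qed
qed

lemma cup_down: "\<exists>X. [(Cup b, i)] \<leadsto> (Cup b, 0) # virts X"
proof (induction i)
  case 0
  then show ?case by (intro exI[of _ "[]"]) simp
next
  case (Suc i)
  then obtain X where X: "[(Cup b, i)] \<leadsto> (Cup b, 0) # virts X" by blast
  have "[(Cup b, Suc i)] \<leadsto> [(Cup b, i), virt (Suc i), virt i]" by (rule deform_cup_down)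
  also have "\<dots> \<leadsto> (Cup b, 0) # virts (X @ [Suc i, i])"
    by (rule context_at[OF X, of _ "[]" "[virt (Suc i), virt i]"]) simp_all
  finally show ?case by blast
qed

lemma cap_down: "\<exists>X. [(Cap, i)] \<leadsto> virts X @ [(Cap, 0)]"
proof (induction i)
  case 0
  then show ?case by (intro exI[of _ "[]"]) simp
next
  case (Suc i)
  then obtain X where X: "[(Cap, i)] \<leadsto> virts X @ [(Cap, 0)]" by blast
  have "[(Cap, Suc i)] \<leadsto> [virt i, virt (Suc i), (Cap, i)]" by (rule deform_cap_down)
  also have "\<dots> \<leadsto> virts ([i, Suc i] @ X) @ [(Cap, 0)]"
    by (rule context_at[OF X, of _ "[virt i, virt (Suc i)]" "[]"]) simp_all
  finally show ?case by blast
qed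

definition virtual_only :: "diag \<Rightarrow> bool" where
  "virtual_only w \<longleftrightarrow> (\<forall>x\<in>set w. \<forall>k. fst x = Cross k \<longrightarrow> k = Virtual)"

definition capless :: "diag \<Rightarrow> bool" where
  "capless w \<longleftrightarrow> virtual_only w \<and> (\<forall>x\<in>set w. fst x \<noteq> Cap)"

lemma virtual_only_simps [simp]: "virtual_only []" "virtual_only (u @ v) \<longleftrightarrow> virtual_only u \<and> virtual_only v"
  "virtual_only (x # v) \<longleftrightarrow> (\<forall>k. fst x = Cross k \<longrightarrow> k = Virtual) \<and> virtual_only v" "virtual_only (virts X)"
  by (auto simp: virtual_only_def virts_def)

lemma capless_simps [simp]: "capless []" "capless (u @ v) \<longleftrightarrow> capless u \<and> capless v"
  "capless (x # v) \<longleftrightarrow> fst x \<noteq> Cap \<and> (\<forall>k. fst x = Cross k \<longrightarrow> k = Virtual) \<and> capless v" "capless (virts X)"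
  by (auto simp: capless_def virts_def virtual_only_def)

lemma circle_down: "u @ [(Cup b, 0), (Cap, 0)] \<leadsto> [(Cup b, 0), (Cap, 0)] @ u"
proof (induction u)
  case (Cons x u)
  obtain y j where x: "x = (y, j)" by force
  have "(x # u) @ [(Cup b, 0), (Cap, 0)] \<leadsto> x # [(Cup b, 0), (Cap, 0)] @ u"
    by (rule context_at[OF Cons.IH, of _ "[x]" "[]"]) simp_all
  also have "\<dots> \<leadsto> [(Cup b, 0), (Cap, 0)] @ x # u"
    by (rule context_at[OF deform_circle[of y j b], of _ "[]" u]) (simp_all add: x)
  finally show ?case .
qed simp

lemma deforms_always_imp: "l \<leadsto> r \<Longrightarrow> deforms s l r"
  by (simp add: deforms_always_def)

text \<open>The maximum descends through \<open>u\<close> piece by piece. It must cancel a minimum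
  or close a circle on the way, since neither a maximum nor a crossing can be attached to the empty
  row; this makes the base case vacuous.\<close>

lemma absorb_long_cap:
  assumes "capless u" "1 \<le> j"
  shows "\<exists>r. capless r \<and> (deforms [] (u @ long_cap i j) r \<or> (\<exists>b. deforms [] (u @ long_cap i j) ([(Cup b, 0), (Cap, 0)] @ r)))"
  using assms
proof (induction u arbitrary: i j rule: rev_induct)
  case Nil
  have "\<not> fits (long_cap i j) []"
  proof (cases "long_cap i j")
    case Nil then show ?thesis by (simp add: long_cap_def)
  next
    case (Cons x w)
    then have "x \<in> set (long_cap i j)" by simp
    then have "fst x = Cap \<or> fst x = Cross Virtual" by (auto simp: long_cap_def pull_def virts_def)
    then have "attach x [] = None" by (cases x) auto
    then show ?thesis using Cons by (simp add: fits_def)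
  qed
  then show ?case by (intro exI[of _ "[]"]) (simp add: deforms_def)
next
  case (snoc x u)
  \<comment> \<open>The case in which the maximum merely passes \<open>x\<close>: the pieces
    \<open>v\<close> left above it contain no maximum, and the descent continues in
    \<open>u\<close>.\<close>
  have go: ?case if st: "(u @ [x]) @ long_cap i j \<leadsto> u @ long_cap i' j' @ v" and v: "capless v" and j': "1 \<le> j'" for i' j' v
  proof -
    obtain r where r: "capless r" "deforms [] (u @ long_cap i' j') r \<or> (\<exists>b. deforms [] (u @ long_cap i' j') ([(Cup b, 0), (Cap, 0)] @ r))"
      using snoc.IH[of j' i'] snoc.prems j' by auto
    have "deforms [] (u @ long_cap i' j' @ v) (r @ v) \<or> (\<exists>b. deforms [] (u @ long_cap i' j' @ v) ([(Cup b, 0), (Cap, 0)] @ r @ v))"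
      using r(2) deforms_suffix[of "[]" "u @ long_cap i' j'" _ v] by fastforce
    then show ?thesis using deforms_trans[OF deforms_always_imp[OF st]] r(1) v
      by (intro exI[of _ "r @ v"]) auto
  qed
  obtain y k where x: "x = (y, k)" by force
  show ?case
  proof (cases y)
    case (Cross c)
    then have x': "x = virt k" using snoc.prems x by simp
    obtain i' j' X where X: "1 \<le> j'" "virts [k] @ long_cap i j \<leadsto> long_cap i' j' @ virts X"
      using crossings_long_cap[OF snoc.prems(2)] by blast
    show ?thesis
      by (rule go[of i' j' "virts X", OF _ _ X(1)], rule context_at[OF X(2), of _ u "[]"]) (simp_all add: x')
  next
    case Cap
    then show ?thesis using snoc.prems x by simp
  next
    case (Cup b)
    obtain ks where ks: "[(Cup b, k)] \<leadsto> (Cup b, 0) # virts ks" using cup_down by blast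
    obtain i' j' X where X: "1 \<le> j'" "virts ks @ long_cap i j \<leadsto> long_cap i' j' @ virts X"
      using crossings_long_cap[OF snoc.prems(2)] by blast
    have "(u @ [x]) @ long_cap i j \<leadsto> u @ (Cup b, 0) # virts ks @ long_cap i j"
      by (rule context_at[OF ks, of _ u "long_cap i j"]) (simp_all add: x Cup)
    also have "\<dots> \<leadsto> u @ (Cup b, 0) # long_cap i' j' @ virts X"
      by (rule context_at[OF X(2), of _ "u @ [(Cup b, 0)]" "[]"]) simp_all
    finally have st: "(u @ [x]) @ long_cap i j \<leadsto> u @ (Cup b, 0) # long_cap i' j' @ virts X" .
    have st2: "(u @ [x]) @ long_cap i j \<leadsto> u @ z @ virts X" if "(Cup b, 0) # long_cap i' j' \<leadsto> z" for z
      using st deforms_always_trans context_at[OF that, of _ u "virts X"] by simp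
    from cup_long_cap[OF X(1), of b i'] show ?thesis
    proof (elim disjE exE conjE)
      fix Y assume "(Cup b, 0) # long_cap i' j' \<leadsto> virts Y"
      from st2[OF this] show ?thesis using snoc.prems
        by (intro exI[of _ "u @ virts Y @ virts X"]) (auto intro: deforms_always_imp)
    next
      fix b' assume "(Cup b, 0) # long_cap i' j' \<leadsto> [(Cup b', 0), (Cap, 0)]"
      from st2[OF this] have "(u @ [x]) @ long_cap i j \<leadsto> u @ [(Cup b', 0), (Cap, 0)] @ virts X" .
      also have "\<dots> \<leadsto> [(Cup b', 0), (Cap, 0)] @ u @ virts X"
        by (rule context_at[OF circle_down[of u b'], of _ "[]" "virts X"]) simp_all
      finally show ?thesis using snoc.prems
        by (intro exI[of _ "u @ virts X"]) (auto intro: deforms_always_imp)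
    next
      fix i'' j'' assume *: "1 \<le> j''" "(Cup b, 0) # long_cap i' j' \<leadsto> long_cap i'' j'' @ [(Cup b, 0)]"
      from st2[OF *(2)] show ?thesis by (intro go[of i'' j'' "(Cup b, 0) # virts X"] *(1)) simp_all
    qed
  qed
qed

text \<open>Without maxima the rows never shrink, so a closed diagram without maxima has no pieces
  at all.\<close>

lemma capless_length: "capless w \<Longrightarrow> attach_all w s = Some t \<Longrightarrow> length s \<le> length t \<and> (t = [] \<longrightarrow> w = [])"
proof (induction w arbitrary: s)
  case (Cons x w)
  from Cons.prems obtain s1 where s1: "attach x s = Some s1" "attach_all w s1 = Some t"
    by (auto split: Option.bind_splits)
  have "length s \<le> length s1 \<and> s1 \<noteq> []"
    using s1(1) Cons.prems(1) by (cases "(x, s)" rule: attach.cases) (auto split: if_splits)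
  moreover have "length s1 \<le> length t" using Cons.IH[OF _ s1(2)] Cons.prems(1) by simp
  ultimately show ?case by auto
qed simp

definition caps :: "diag \<Rightarrow> nat" where "caps w = length (filter (\<lambda>x. fst x = Cap) w)"

lemma caps_capless: "capless w \<Longrightarrow> caps w = 0"
  by (auto simp: caps_def capless_def filter_empty_conv)

text \<open>Each round absorbs the lowest maximum into the part below it, which has none. A circle
  that arises is brought to the very bottom; it has no crossing, and the induction goes on with the
  rest of the diagram.\<close>

lemma deforms_crossingless:
  assumes "virtual_only w" "attach_all w [] = Some []"
  shows "\<exists>z. crossingless z \<and> deforms [] w z"
  using assms
proof (induction "caps w" arbitrary: w rule: less_induct)
  case less
  show ?case
  proof (cases "capless w")
    case True
    then have "w = []" using capless_length[OF True less.prems(2)] by simp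
    then show ?thesis by (intro exI[of _ "[]"]) (simp add: crossingless_def deforms_def)
  next
    case False
    then have "\<exists>x\<in>set w. fst x = Cap" using less.prems(1) by (auto simp: capless_def)
    then obtain u x v where w: "w = u @ x # v" "fst x = Cap" "\<forall>y\<in>set u. fst y \<noteq> Cap"
      using split_list_first_prop[of w "\<lambda>x. fst x = Cap"] by blast
    then obtain i where x: "x = (Cap, i)" by (metis prod.collapse)
    have u: "capless u" and v: "virtual_only v" using w less.prems(1) by (simp_all add: capless_def)
    obtain ks where ks: "[(Cap, i)] \<leadsto> virts ks @ [(Cap, 0)]" using cap_down by blast
    have lc: "[(Cap, 0)] = long_cap 0 1" by (simp add: long_cap_def)
    have st: "w \<leadsto> (u @ virts ks) @ long_cap 0 1 @ v"
      by (rule context_at[OF ks, of _ u v]) (simp_all add: w x lc)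
    obtain r where r: "capless r" "deforms [] ((u @ virts ks) @ long_cap 0 1) r \<or>
        (\<exists>b. deforms [] ((u @ virts ks) @ long_cap 0 1) ([(Cup b, 0), (Cap, 0)] @ r))"
      using absorb_long_cap[of "u @ virts ks" 1 0] u by auto
    have caps: "caps (r @ v) < caps w"
      using caps_capless[OF r(1)] caps_capless[OF u] by (simp add: caps_def w)
    have vo: "virtual_only (r @ v)" using r(1) v by (simp add: capless_def)
    have fw: "fits w []" using less.prems by (simp add: fits_def)
    from r(2) show ?thesis
    proof (elim disjE exE)
      assume "deforms [] ((u @ virts ks) @ long_cap 0 1) r"
      from deforms_trans[OF deforms_always_imp[OF st]] deforms_suffix[OF this, of v]
      have d: "deforms [] w (r @ v)" by simp
      then have "attach_all (r @ v) [] = Some []" using tangle_steps_attach fw less.prems(2) by (simp add: deforms_def)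
      from less.hyps[OF caps vo this] show ?thesis using deforms_trans[OF d] by blast
    next
      fix b assume "deforms [] ((u @ virts ks) @ long_cap 0 1) ([(Cup b, 0), (Cap, 0)] @ r)"
      from deforms_trans[OF deforms_always_imp[OF st]] deforms_suffix[OF this, of v]
      have d: "deforms [] w ([(Cup b, 0), (Cap, 0)] @ r @ v)" by simp
      have circ: "attach_all [(Cup b, 0), (Cap, 0)] [] = Some []" by simp
      have "attach_all ([(Cup b, 0), (Cap, 0)] @ r @ v) [] = Some []"
        using d tangle_steps_attach fw less.prems(2) by (simp add: deforms_def del: append.simps)
      then have "attach_all (r @ v) [] = Some []"
        unfolding attach_all_append[of "[(Cup b, 0), (Cap, 0)]"] circ by simp
      from less.hyps[OF caps vo this] obtain z where z: "crossingless z" "deforms [] (r @ v) z" by blast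
      have "deforms [] ([(Cup b, 0), (Cap, 0)] @ r @ v) ([(Cup b, 0), (Cap, 0)] @ z)"
        using deforms_context[OF circ z(2), of "[]"] by simp
      from deforms_trans[OF d this] show ?thesis using z(1)
        by (intro exI[of _ "[(Cup b, 0), (Cap, 0)] @ z"]) (auto simp: crossingless_def)
    qed
  qed
qed

lemma virtual_only_trivial:
  assumes "virtual_only w" "diagram w"
  shows "trivial w"
proof -
  obtain z where z: "crossingless z" "deforms [] w z" using deforms_crossingless assms by (auto simp: diagram_def)
  have "(tangle_step [])\<^sup>*\<^sup>* w z" using z(2) assms(2) by (simp add: deforms_def fits_def diagram_def)
  then have "diagram z \<and> equivclp local_move w z"
  proof (induction rule: rtranclp_induct)
    case base
    then show ?case using assms(2) by simp
  next
    case (step y z)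
    from step(2) obtain u a b v where yz: "y = u @ a @ v" "z = u @ b @ v" "smove a b" "attach_all z [] = attach_all y []"
      by (auto simp: tangle_step_def)
    have z: "diagram z" using yz(4) step(3) by (simp add: diagram_def)
    have "local_move y z \<or> local_move z y"
      using yz z step(3) by (auto simp: smove_def intro: local_move.intros)
    then show ?case using step(3) z by (metis equivclp_into_equivclp)
  qed
  then show ?thesis using z(1) assms(2) by (auto simp: trivial_def equivalent_def)
qed

section \<open>Virtualizing and changing crossings\<close>

text \<open>Agreement up to the kinds of crossings, which is what virtualizing and crossing changes
  preserve: rows, components and arcs coincide.\<close>

definition same_shape :: "diag \<Rightarrow> diag \<Rightarrow> bool" where
  "same_shape w w' \<longleftrightarrow> length w' = length w \<and> (\<forall>t<length w. snd (w' ! t) = snd (w ! t) \<and>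
     (fst (w' ! t) = fst (w ! t) \<or> (\<exists>k k'. fst (w ! t) = Cross k \<and> fst (w' ! t) = Cross k')))"

text \<open>Lists of equal length also agree on positions beyond their ends, which \<^const>\<open>next_point\<close> may read.\<close>

lemma nth_beyond: "length w \<le> t \<Longrightarrow> w ! t = [] ! (t - length w)"
  by (induction w arbitrary: t) (auto simp: nth_Cons split: nat.split)

lemma same_shape_piece:
  assumes "same_shape w w'"
  shows "attach (w' ! t) = attach (w ! t)" "ascend (w' ! t) = ascend (w ! t)" "descend (w' ! t) = descend (w ! t)"
proof -
  have "attach (w' ! t) = attach (w ! t) \<and> ascend (w' ! t) = ascend (w ! t) \<and> descend (w' ! t) = descend (w ! t)"
  proof (cases "t < length w")
    case False
    then show ?thesis using assms nth_beyond[of w t] nth_beyond[of w' t] by (simp add: same_shape_def)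
  next
    case True
    then have "snd (w' ! t) = snd (w ! t)"
      "fst (w' ! t) = fst (w ! t) \<or> (\<exists>k k'. fst (w ! t) = Cross k \<and> fst (w' ! t) = Cross k')"
      using assms by (simp_all add: same_shape_def)
    then show ?thesis by (cases "w ! t"; cases "w' ! t") (auto simp: fun_eq_iff)
  qed
  then show "attach (w' ! t) = attach (w ! t)" "ascend (w' ! t) = ascend (w ! t)" "descend (w' ! t) = descend (w ! t)"
    by auto
qed

lemma same_shape_attach:
  assumes "same_shape w w'" shows "attach_all (take t w') [] = attach_all (take t w) []"
proof (induction t)
  case (Suc t)
  have l: "length w' = length w" using assms by (simp add: same_shape_def)
  show ?case
  proof (cases "t < length w")
    case True
    have "attach_all [w' ! t] = attach_all [w ! t]"
      using same_shape_piece(1)[OF assms, of t] by (simp add: fun_eq_iff)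
    then show ?thesis using Suc l True by (simp add: take_Suc_conv_app_nth attach_all_append)
  qed (use Suc l in simp)
qed simp

lemma same_shape_row: "same_shape w w' \<Longrightarrow> row w' t = row w t"
  by (simp add: row_def same_shape_attach)

lemma same_shape_diagram: "same_shape w w' \<Longrightarrow> diagram w \<Longrightarrow> diagram w'"
  using same_shape_attach[of w w' "length w"] by (simp add: diagram_def same_shape_def)

lemma same_shape_next_point: assumes "same_shape w w'" shows "next_point w' = next_point w"
  by (auto simp: next_point_def fun_eq_iff same_shape_row[OF assms] same_shape_piece[OF assms])

lemma same_shape_components:
  assumes "same_shape w w'" shows "component w' = component w" "components w' = components w" "open_arc w' = open_arc w"
proof -
  have "points w' = points w" using assms by (simp add: points_def same_shape_row[OF assms]) (simp add: same_shape_def)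
  then show "component w' = component w" "components w' = components w" "open_arc w' = open_arc w"
    by (simp_all add: fun_eq_iff component_def components_def open_arc_def same_shape_next_point[OF assms])
qed

lemma length_at_pieces [simp]: "length (at_pieces f S w) = length w"
  by (simp add: at_pieces_def)

lemma nth_at_pieces: "t < length w \<Longrightarrow>
   at_pieces f S w ! t = (if t \<in> S then f (fst (w ! t)) else fst (w ! t), snd (w ! t))"
  by (simp add: at_pieces_def)

lemma at_pieces_empty [simp]: "at_pieces f {} w = w"
  by (rule nth_equalityI) (simp_all add: nth_at_pieces)

definition modify :: "nat set \<Rightarrow> nat set \<Rightarrow> diag \<Rightarrow> diag" where
  "modify S T w = change_crossings T (virtualize S w)"

lemma length_modify [simp]: "length (modify S T w) = length w"
  by (simp add: modify_def)

lemma nth_modify: "t < length w \<Longrightarrow> modify S T w ! t = 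
   ((if t \<in> T then change_crossing else id) ((if t \<in> S then make_virtual else id) (fst (w ! t))), snd (w ! t))"
  by (simp add: modify_def nth_at_pieces)

lemma same_shape_modify: "same_shape w (modify S T w)"
proof -
  have "fst (modify S T w ! t) = fst (w ! t) \<or> (\<exists>k k'. fst (w ! t) = Cross k \<and> fst (modify S T w ! t) = Cross k')"
    if "t < length w" for t
    using that by (cases "fst (w ! t)") (auto simp: nth_modify)
  then show ?thesis by (simp add: same_shape_def nth_modify)
qed

lemma virtualize_modify: "virtualize S w = modify S {} w"
  by (simp add: modify_def)

lemma classicalE:
  assumes "c \<in> classical w" obtains k i where "w ! c = (Cross k, i)" "k \<noteq> Virtual" "c < length w"
  using assms by (cases "w ! c") (auto simp: classical_def)

lemma flip_eq: "flip k = Virtual \<longleftrightarrow> k = Virtual" "k \<noteq> Virtual \<Longrightarrow> flip k = Over \<longleftrightarrow> k \<noteq> Over"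
  by (cases k; simp)+

lemma classical_iff: "c \<in> classical w \<longleftrightarrow> c < length w \<and> (\<exists>k. fst (w ! c) = Cross k \<and> k \<noteq> Virtual)"
proof -
  have "p \<in> {Cross Over, Cross Under} \<longleftrightarrow> (\<exists>k. p = Cross k \<and> k \<noteq> Virtual)" for p
  proof (cases p)
    case (Cross k)
    then show ?thesis by (cases k) auto
  qed auto
  then show ?thesis by (simp add: classical_def)
qed

lemma classical_modify: "classical (modify S T w) = classical w - S"
proof -
  have "c \<in> classical (modify S T w) \<longleftrightarrow> c \<in> classical w - S" for c
    by (cases "fst (w ! c)"; cases "c \<in> S"; cases "c \<in> T") (auto simp: classical_iff nth_modify flip_eq)
  then show ?thesis by blast
qed

lemma modify_crossing:
  assumes "c \<in> classical w" "c \<notin> S"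
  shows "over_point (modify S T w) c = (if c \<in> T then under_point w c else over_point w c)"
    "under_point (modify S T w) c = (if c \<in> T then over_point w c else under_point w c)"
    "crossing_sign (modify S T w) c = (if c \<in> T then - crossing_sign w c else crossing_sign w c)"
proof -
  obtain k i where k: "w ! c = (Cross k, i)" "k \<noteq> Virtual" "c < length w" using classicalE[OF assms(1)] .
  have m: "modify S T w ! c = (Cross (if c \<in> T then flip k else k), i)"
    using k assms(2) by (simp add: nth_modify)
  show "over_point (modify S T w) c = (if c \<in> T then under_point w c else over_point w c)"
    "under_point (modify S T w) c = (if c \<in> T then over_point w c else under_point w c)"
    "crossing_sign (modify S T w) c = (if c \<in> T then - crossing_sign w c else crossing_sign w c)"
    unfolding over_point_def under_point_def crossing_sign_def m k(1) same_shape_row[OF same_shape_modify]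
    using k(2) by (auto simp: flip_eq)
qed

lemma passes_over_modify:
  "passes_over (modify S T w) P Q = (passes_over w P Q - S - T) \<union> (passes_over w Q P \<inter> T - S)"
proof -
  have "c \<in> passes_over (modify S T w) P Q \<longleftrightarrow> c \<in> (passes_over w P Q - S - T) \<union> (passes_over w Q P \<inter> T - S)" for c
    by (cases "c \<in> classical w - S") (auto simp: passes_over_def classical_modify modify_crossing)
  then show ?thesis by blast
qed

lemma finite_passes_over [simp]: "finite (passes_over w P Q)"
  by (rule finite_subset[OF _ finite_classical[of w]]) (auto simp: passes_over_def)

abbreviation sign_sum :: "diag \<Rightarrow> nat set \<Rightarrow> int" where
  "sign_sum w X \<equiv> sum (crossing_sign w) X"

lemma passes_over_disjoint: "P \<inter> Q = {} \<Longrightarrow> passes_over w P Q \<inter> passes_over w Q P = {}"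
  by (auto simp: passes_over_def)

text \<open>A changed crossing with \<open>P\<close> over leaves this sum; one with \<open>Q\<close>
  over joins it with the negated sign. Either way the sum falls by the original sign. The
  \<open>T\<close> terms are symmetric in \<open>P\<close> and \<open>Q\<close>, so crossing changes
  keep the difference of the two one-sided sums.\<close>

lemma over_sum_modify:
  assumes "P \<inter> Q = {}" "T \<inter> S = {}"
  shows "over_sum (modify S T w) P Q = over_sum w P Q - sign_sum w (passes_over w P Q \<inter> S) -
     sign_sum w (passes_over w P Q \<inter> T) - sign_sum w (passes_over w Q P \<inter> T)"
proof -
  let ?A = "passes_over w P Q" and ?B = "passes_over w Q P"
  have cl: "?A \<subseteq> classical w" "?B \<subseteq> classical w" by (auto simp: passes_over_def)
  have "over_sum (modify S T w) P Q = sign_sum (modify S T w) (?A - S - T) + sign_sum (modify S T w) (?B \<inter> T - S)"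
    unfolding over_sum_def passes_over_modify using passes_over_disjoint[OF assms(1)]
    by (intro sum.union_disjoint) auto
  also have "sign_sum (modify S T w) (?A - S - T) = sign_sum w (?A - S - T)"
    using cl by (intro sum.cong) (auto simp: modify_crossing)
  also have "sign_sum (modify S T w) (?B \<inter> T - S) = - sign_sum w (?B \<inter> T)"
    unfolding sum_negf[symmetric]
  proof (rule sum.cong)
    show "?B \<inter> T - S = ?B \<inter> T" using assms(2) by blast
    fix c assume "c \<in> ?B \<inter> T"
    then have "c \<in> classical w" "c \<notin> S" "c \<in> T" using cl assms(2) by auto
    then show "crossing_sign (modify S T w) c = - crossing_sign w c" by (simp add: modify_crossing)
  qed
  also have "sign_sum w (?A - S - T) = sign_sum w ?A - sign_sum w (?A \<inter> S) - sign_sum w (?A \<inter> T)"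
  proof -
    have "?A = (?A - S - T) \<union> (?A \<inter> S) \<union> (?A \<inter> T)" by auto
    moreover have "sign_sum w ((?A - S - T) \<union> (?A \<inter> S) \<union> (?A \<inter> T)) = sign_sum w (?A - S - T) + sign_sum w (?A \<inter> S) + sign_sum w (?A \<inter> T)"
      using assms(2) by (subst sum.union_disjoint, auto)+
    ultimately show ?thesis by simp
  qed
  finally show ?thesis by (simp add: over_sum_def)
qed

lemma abs_crossing_sign [simp]: "\<bar>crossing_sign w c\<bar> = 1"
  by (simp add: crossing_sign_def)

lemma sign_sum_bound: "\<bar>sign_sum w X\<bar> \<le> int (card X)"
  using sum_abs[of "crossing_sign w" X] by simp

section \<open>Span and linking numbers in terms of the one-sided sums\<close>

lemma pair_span_eq: "pair_span w P Q = nat \<bar>over_sum w P Q - over_sum w Q P\<bar>"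
proof -
  have "over_sum w P Q = int (card {c \<in> passes_over w P Q. crossing_sign w c = 1}) -
      int (card {c \<in> passes_over w P Q. crossing_sign w c = - 1})" for P Q
    using sum_crossing_sign[of "passes_over w P Q" w "\<lambda>_. True"] by (simp add: over_sum_def)
  then show ?thesis by (simp add: pair_span_def Let_def)
qed

lemma pair_span_commute: "pair_span w P Q = pair_span w Q P"
  by (simp add: pair_span_eq abs_minus_commute)

lemma linking_number_eq: "P \<inter> Q = {} \<Longrightarrow> linking_number w P Q = real_of_int (over_sum w P Q + over_sum w Q P) / 2"
  using passes_over_disjoint[of P Q w] by (simp add: linking_number_def over_sum_def sum.union_disjoint)

lemma linking_number_commute: "linking_number w P Q = linking_number w Q P"
  by (simp add: linking_number_def Un_commute)

lemma ell_commute: "ell w P Q = ell w Q P"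
  by (simp add: ell_def Lambda_def Un_commute pair_span_commute linking_number_commute)

text \<open>The distance of 0 from the interval between the two one-sided linking numbers.\<close>

definition link_dist :: "diag \<Rightarrow> (nat \<times> nat) set \<Rightarrow> (nat \<times> nat) set \<Rightarrow> int" where
  "link_dist w P Q = (let x = over_sum w P Q; y = over_sum w Q P in max 0 (max (min x y) (- max x y)))"

lemma link_dist_commute: "link_dist w P Q = link_dist w Q P"
  unfolding link_dist_def Let_def by (simp add: min.commute max.commute)

lemma finite_Lambda: "finite (Lambda w P Q)"
  by (rule finite_subset[of _ "Pow (crossings_on w (P \<union> Q))"]) (auto simp: Lambda_def)

text \<open>As \<open>ell\<close> is a minimum, one set in \<open>Lambda\<close> bounds it.
  Virtualizing positive crossings with \<open>P\<close> over lowers the larger sum, virtualizing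
  negative ones with \<open>Q\<close> over raises the smaller; every step narrows the gap by 1, so
  exactly span many are used.\<close>

lemma ell_le_aux:
  assumes "P \<inter> Q = {}" "over_sum w Q P \<le> over_sum w P Q"
  shows "ell w P Q \<le> real_of_int (link_dist w P Q)"
proof -
  let ?x = "over_sum w P Q" and ?y = "over_sum w Q P"
  let ?R = "{c \<in> passes_over w P Q. crossing_sign w c = 1}" and ?L = "{c \<in> passes_over w Q P. crossing_sign w c = - 1}"
  have x: "?x = int (card ?R) - int (card {c \<in> passes_over w P Q. crossing_sign w c = - 1})"
    using sum_crossing_sign[of "passes_over w P Q" w "\<lambda>_. True"] by (simp add: over_sum_def)
  have y: "?y = int (card {c \<in> passes_over w Q P. crossing_sign w c = 1}) - int (card ?L)"
    using sum_crossing_sign[of "passes_over w Q P" w "\<lambda>_. True"] by (simp add: over_sum_def)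
  \<comment> \<open>The linking number to be reached is the point of the interval from \<open>?y\<close> to \<open>?x\<close> closest to 0.\<close>
  define \<tau> where "\<tau> = max ?y (min 0 ?x)"
  have \<tau>: "?y \<le> \<tau>" "\<tau> \<le> ?x" "\<bar>\<tau>\<bar> = link_dist w P Q" using assms(2) by (auto simp: \<tau>_def link_dist_def Let_def)
  define a where "a = nat (?x - \<tau>)"
  define b where "b = nat (\<tau> - ?y)"
  have ab: "int a = ?x - \<tau>" "int b = \<tau> - ?y" using \<tau> by (simp_all add: a_def b_def)
  \<comment> \<open>Enough crossings exist: for \<open>?x \<le> 0\<close> the choice gives
    \<open>\<tau> = ?x\<close> and \<open>a = 0\<close>, and for \<open>?x > 0\<close> it gives
    \<open>\<tau> \<ge> 0\<close>, so that \<open>a \<le> ?x \<le> card ?R\<close>. The case of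
    \<open>b\<close> is symmetric.\<close>
  have "a \<le> card ?R" "b \<le> card ?L" using x y ab by (auto simp: \<tau>_def)
  obtain A where A: "A \<subseteq> ?R" "card A = a" using obtain_subset_with_card_n[OF \<open>a \<le> card ?R\<close>] by blast
  obtain B where B: "B \<subseteq> ?L" "card B = b" using obtain_subset_with_card_n[OF \<open>b \<le> card ?L\<close>] by blast
  have fin: "finite A" "finite B" using A B by (auto intro: finite_subset[OF _ finite_passes_over])
  have dis: "passes_over w P Q \<inter> passes_over w Q P = {}" by (rule passes_over_disjoint) fact
  let ?S = "A \<union> B"
  have int: "passes_over w P Q \<inter> ?S = A" "passes_over w Q P \<inter> ?S = B" using A B dis by auto
  have "sign_sum w A = (\<Sum>c\<in>A. 1)" by (rule sum.cong) (use A in auto)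
  moreover have "sign_sum w B = (\<Sum>c\<in>B. - 1)" by (rule sum.cong) (use B in auto)
  ultimately have sgn: "sign_sum w A = ?x - \<tau>" "sign_sum w B = ?y - \<tau>" using A B ab by simp_all
  have new: "over_sum (virtualize ?S w) P Q = \<tau>" "over_sum (virtualize ?S w) Q P = \<tau>"
    using over_sum_modify[of P Q "{}" ?S w, unfolded int] over_sum_modify[of Q P "{}" ?S w, unfolded int] assms(1) sgn
    unfolding virtualize_modify by auto
  have "A \<inter> B = {}" using A B dis by auto
  then have "card ?S = a + b" using fin A B by (simp add: card_Un_disjoint)
  also have "\<dots> = pair_span w P Q" using ab assms(2) unfolding pair_span_eq by linarith
  finally have "?S \<in> Lambda w P Q"
    using A B new by (auto simp: Lambda_def pair_span_eq crossings_on_def passes_over_def)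
  then have "ell w P Q \<le> \<bar>linking_number (virtualize ?S w) P Q\<bar>"
    unfolding ell_def by (intro Min_le) (auto simp: finite_Lambda)
  also have "\<dots> = real_of_int \<bar>\<tau>\<bar>" unfolding linking_number_eq[OF assms(1)] new by simp
  finally show ?thesis using \<tau>(3) by simp
qed

lemma ell_le:
  assumes "P \<inter> Q = {}"
  shows "ell w P Q \<le> real_of_int (link_dist w P Q)"
proof (cases "over_sum w Q P \<le> over_sum w P Q")
  case True
  then show ?thesis using ell_le_aux assms by blast
next
  case False
  then show ?thesis using ell_le_aux[of Q P w] assms ell_commute[of w P Q] link_dist_commute[of w P Q]
    by (simp add: Int_commute)
qed

text \<open>Both one-sided sums equal a virtualized part plus the same \<open>t\<close>, the sign
  sum of the changed crossings. The span is thus the difference of the virtualized parts. In case of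
  equality these have extreme values of opposite signs, which puts \<open>t\<close> between the two
  sums; so the absolute value of \<open>t\<close> is at least the distance of 0 from that interval,
  and it is at most the number of changed crossings.\<close>

lemma pair_bounds:
  assumes "P \<inter> Q = {}" "T \<inter> S = {}" "over_sum (modify S T w) P Q = 0" "over_sum (modify S T w) Q P = 0"
  defines "X \<equiv> passes_over w P Q \<union> passes_over w Q P"
  shows "pair_span w P Q \<le> card (X \<inter> S)"
    "pair_span w P Q = card (X \<inter> S) \<Longrightarrow> link_dist w P Q \<le> int (card (X \<inter> T))"
proof -
  let ?A = "passes_over w P Q" and ?B = "passes_over w Q P"
  have dis: "?A \<inter> ?B = {}" by (rule passes_over_disjoint) fact
  define t where "t = sign_sum w (?A \<inter> T) + sign_sum w (?B \<inter> T)"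
  have eqs: "over_sum w P Q = sign_sum w (?A \<inter> S) + t" "over_sum w Q P = sign_sum w (?B \<inter> S) + t"
    using over_sum_modify[of P Q T S w] over_sum_modify[of Q P T S w] assms(1-4) by (auto simp: t_def Int_commute)
  have c: "card (X \<inter> Z) = card (?A \<inter> Z) + card (?B \<inter> Z)" for Z
    unfolding X_def Int_Un_distrib2 using dis by (intro card_Un_disjoint) auto
  have b: "\<bar>sign_sum w (?A \<inter> Z)\<bar> \<le> int (card (?A \<inter> Z))" "\<bar>sign_sum w (?B \<inter> Z)\<bar> \<le> int (card (?B \<inter> Z))" for Z
    by (rule sign_sum_bound)+
  have t: "\<bar>t\<bar> \<le> int (card (X \<inter> T))" using b[of T] unfolding c t_def by linarith
  show "pair_span w P Q \<le> card (X \<inter> S)" using b[of S] eqs unfolding c pair_span_eq by linarith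
  show "link_dist w P Q \<le> int (card (X \<inter> T))" if "pair_span w P Q = card (X \<inter> S)"
    using that b[of S] eqs t unfolding c pair_span_eq link_dist_def Let_def
    by (cases "over_sum w P Q \<le> over_sum w Q P") linarith+
qed

text \<open>Changing a crossing swaps its passages and negates its sign, so the jumps stay. For the
  changed crossing itself the other arc becomes the relevant one. The jumps of all points of the
  component sum to 0, and so do the two at the crossing, hence the sums over the two arcs are
  opposite.\<close>

lemma Ind_modify:
  assumes d: "diagram w" and P: "P \<in> components w" and TS: "crossings_on w P \<inter> S = {}" and c: "c \<in> crossings_on w P"
  shows "crossings_on (modify S T w) P = crossings_on w P"
    "Ind (modify S T w) P c = (if c \<in> T then - Ind w P c else Ind w P c)"
proof -
  let ?w = "modify S T w" and ?X = "crossings_on w P"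
  note shape = same_shape_components[OF same_shape_modify[of w S T]]
  have d': "diagram ?w" using same_shape_diagram[OF same_shape_modify d] .
  have X: "e \<in> classical w" "e \<notin> S" if "e \<in> ?X" for e using that TS by (auto simp: crossings_on_def)
  have "e \<in> crossings_on ?w P \<longleftrightarrow> e \<in> ?X" for e
    using TS by (cases "e \<in> classical w - S") (auto simp: crossings_on_def classical_modify modify_crossing)
  then show on: "crossings_on ?w P = ?X" by blast
  have jump: "jump ?w ?X z = jump w ?X z" for z
    unfolding jump_def by (intro sum.cong refl) (auto simp: modify_crossing X)
  let ?A = "open_arc w (over_point w c) (under_point w c)" and ?B = "open_arc w (under_point w c) (over_point w c)"
  have I: "Ind w P c = (\<Sum>z\<in>?A. jump w ?X z)" by (rule Ind_eq_sum_jump[OF d P c])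
  have I': "Ind ?w P c = (\<Sum>z\<in>open_arc w (over_point ?w c) (under_point ?w c). jump w ?X z)"
    using Ind_eq_sum_jump[OF d', of P c] P c by (simp add: shape on jump)
  obtain x where "x \<in> points w" "P = component w x" using P by (auto simp: components_def)
  then have "finite P" using finite_subset[OF component_subset[OF d] finite_points] by simp
  then have "(\<Sum>z\<in>P. jump w ?X z) = 0"
    using sum_jump[OF _ crossings_on_subset[of w P], of P] by (simp add: crossings_on_def)
  then have "(\<Sum>z\<in>?A. jump w ?X z) + (\<Sum>z\<in>?B. jump w ?X z) = 0"
    using component_arcs(9)[OF d P c, of "jump w ?X"] jump_over_under[OF crossings_on_subset c] by simp
  then show "Ind ?w P c = (if c \<in> T then - Ind w P c else Ind w P c)"
    using I I' X[OF c] by (simp add: modify_crossing)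
qed

lemma total_writhe_le:
  assumes d: "diagram w" and P: "P \<in> components w" and TS: "crossings_on w P \<inter> S = {}"
    and zero: "\<And>k. k \<noteq> 0 \<Longrightarrow> writhe k (modify S T w) P = 0"
  shows "total_writhe w P \<le> 2 * int (card (crossings_on w P \<inter> T))"
proof -
  let ?w = "modify S T w" and ?X = "crossings_on w P"
  let ?K = "{k. k \<noteq> 0 \<and> writhe k w P \<noteq> 0}"
  have fin: "finite ?K"
  proof (rule finite_subset)
    show "?K \<subseteq> Ind w P ` ?X"
    proof
      fix k assume "k \<in> ?K"
      then have "{c \<in> ?X. Ind w P c = k} \<noteq> {}" unfolding writhe_def by (metis (mono_tags, lifting) mem_Collect_eq sum.empty)
      then show "k \<in> Ind w P ` ?X" by blast
    qed
  qed simp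
  have X: "c \<in> classical w" "c \<notin> S" if "c \<in> ?X" for c using that TS by (auto simp: crossings_on_def)
  have wr: "writhe k w P = (\<Sum>c\<in>?X. crossing_sign w c * of_bool (Ind w P c = k))" for k
    unfolding writhe_def by (simp add: sum.inter_filter of_bool_def if_distrib cong: if_cong)
  have wr': "writhe k ?w P = (\<Sum>c\<in>?X. crossing_sign ?w c * of_bool (Ind ?w P c = k))" for k
  proof (cases "?X = {}")
    case True
    have "e \<notin> crossings_on ?w P" for e
      using True by (cases "e \<in> classical w - S") (auto simp: crossings_on_def classical_modify modify_crossing split: if_splits)
    then show ?thesis using True unfolding writhe_def by simp
  next
    case False
    then have "crossings_on ?w P = ?X" using Ind_modify(1)[OF d P TS] by blast
    then show ?thesis unfolding writhe_def by (simp add: sum.inter_filter of_bool_def if_distrib cong: if_cong)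
  qed
  \<comment> \<open>A changed crossing of index m loses its sign at \<open>k = m\<close> and brings
    in the negated sign at \<open>k = - m\<close>: a drop by its original sign in both
    places.\<close>
  have bound: "\<bar>writhe k w P\<bar> \<le> (\<Sum>c\<in>?X \<inter> T. of_bool (Ind w P c = k) + of_bool (- Ind w P c = k))" if "k \<noteq> 0" for k
  proof -
    have "writhe k w P = writhe k w P - writhe k ?w P" using zero[OF that] by simp
    also have "\<dots> = (\<Sum>c\<in>?X. of_bool (c \<in> T) * (crossing_sign w c * (of_bool (Ind w P c = k) + of_bool (- Ind w P c = k))))"
      unfolding wr wr' sum_subtractf[symmetric]
      by (intro sum.cong refl) (auto simp: modify_crossing X Ind_modify(2)[OF d P TS] algebra_simps)
    also have "\<dots> = (\<Sum>c\<in>?X \<inter> T. crossing_sign w c * (of_bool (Ind w P c = k) + of_bool (- Ind w P c = k)))"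
      by (rule sum.mono_neutral_cong_right) auto
    finally have "\<bar>writhe k w P\<bar> \<le> (\<Sum>c\<in>?X \<inter> T. \<bar>crossing_sign w c * (of_bool (Ind w P c = k) + of_bool (- Ind w P c = k))\<bar>)"
      by (simp only: sum_abs)
    also have "\<dots> = (\<Sum>c\<in>?X \<inter> T. of_bool (Ind w P c = k) + of_bool (- Ind w P c = k))"
      by (simp add: abs_mult)
    finally show ?thesis .
  qed
  have "total_writhe w P \<le> (\<Sum>k\<in>?K. \<Sum>c\<in>?X \<inter> T. of_bool (Ind w P c = k) + of_bool (- Ind w P c = k))"
    unfolding total_writhe_def using bound by (intro sum_mono) auto
  also have "\<dots> = (\<Sum>c\<in>?X \<inter> T. \<Sum>k\<in>?K. of_bool (Ind w P c = k) + of_bool (- Ind w P c = k))"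
    by (rule sum.swap)
  \<comment> \<open>For fixed \<open>c\<close> each of the two indicator sums over \<open>k\<close>
    is at most 1.\<close>
  also have "\<dots> \<le> (\<Sum>c\<in>?X \<inter> T. 2)"
    using fin by (intro sum_mono) (simp add: sum.distrib of_bool_def)
  finally show ?thesis by simp
qed

section \<open>The lower bound\<close>

lemma equivalent_sym: "(v, w) \<in> equivalent \<Longrightarrow> (w, v) \<in> equivalent"
  using equivclp_sym by (auto simp: equivalent_def)

lemma equivalent_trans: "(u, v) \<in> equivalent \<Longrightarrow> (v, w) \<in> equivalent \<Longrightarrow> (u, w) \<in> equivalent"
  using equivclp_trans by (auto simp: equivalent_def)

lemma virtual_link_equivalent:
  assumes "L \<in> virtual_links" "v \<in> L" "w \<in> L" shows "(v, w) \<in> equivalent"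
proof -
  obtain u where "L = equivalent `` {u}" using assms(1) by (auto simp: virtual_links_def quotient_def)
  then show ?thesis using assms(2,3) equivalent_sym equivalent_trans by blast
qed

lemma components_disjoint:
  assumes "diagram w" "P \<in> components w" "Q \<in> components w" "P \<noteq> Q" shows "P \<inter> Q = {}"
proof (rule ccontr)
  assume "P \<inter> Q \<noteq> {}"
  then obtain z where z: "z \<in> P" "z \<in> Q" by blast
  obtain x y where "x \<in> points w" "P = component w x" "y \<in> points w" "Q = component w y"
    using assms(2,3) by (auto simp: components_def)
  then show False using component_eq[OF assms(1), of x z] component_eq[OF assms(1), of y z] z assms(4) by simp
qed

definition pairs :: "nat \<Rightarrow> (nat \<times> nat) set" where
  "pairs n = {(i, j). 1 \<le> i \<and> i < j \<and> j \<le> n}"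

lemma finite_pairs [simp]: "finite (pairs n)"
  by (rule finite_subset[of _ "{1..n} \<times> {1..n}"]) (auto simp: pairs_def)

text \<open>The sets \<open>X p\<close> are pairwise disjoint, so the bounds for single pairs add
  up. Equality in the first coordinate forces equality for every pair, as the second bound for a
  pair requires, and it uses up \<open>S\<close> on linking crossings.\<close>

lemma unknottable_bound:
  assumes d: "diagram w" and C: "bij_betw C {1..n} (components w)" and u: "unknottable a b w"
  shows "diag_span w n C \<le> a"
    "diag_span w n C = a \<Longrightarrow>
      (\<Sum>(i, j)\<in>pairs n. real_of_int (link_dist w (C i) (C j))) +
      1 / 2 * (\<Sum>i = 1..n. real_of_int (total_writhe w (C i))) \<le> real b"
proof -
  obtain S T where S: "S \<subseteq> classical w" "card S = a" and T: "T \<subseteq> classical w - S" "card T = b"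
    and triv: "trivial (modify S T w)"
    using u by (auto simp: unknottable_def modify_def)
  have fin: "finite S" "finite T" using S(1) T(1) finite_subset[OF _ finite_classical] by blast+
  have TS: "T \<inter> S = {}" using T by blast
  note shape = same_shape_components[OF same_shape_modify[of w S T]]
  have Cin: "C i \<in> components w" if "i \<in> {1..n}" for i using C that by (meson bij_betwE)
  have disj: "C i \<inter> C j = {}" "C i \<noteq> C j" if "i \<in> {1..n}" "j \<in> {1..n}" "i \<noteq> j" for i j
    using components_disjoint[OF d Cin Cin] C that by (meson bij_betw_imp_inj_on inj_onD)+
  define X where "X p = passes_over w (C (fst p)) (C (snd p)) \<union> passes_over w (C (snd p)) (C (fst p))" for p
  define J where "J = pairs n \<union> (\<lambda>i. (i, i)) ` {1..n}"
  have finJ: "finite J" and J: "pairs n \<subseteq> J" by (simp_all add: J_def)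
  have X_disj: "X p \<inter> X q = {}" if "p \<in> J" "q \<in> J" "p \<noteq> q" for p q
  proof -
    obtain i j k l where pq: "p = (i, j)" "q = (k, l)" by (metis prod.exhaust)
    have ij: "i \<le> j" "k \<le> l" "{i, j, k, l} \<subseteq> {1..n}" using that by (auto simp: pq J_def pairs_def)
    have eq: "x = y" if "z \<in> C x" "z \<in> C y" "x \<in> {i, j, k, l}" "y \<in> {i, j, k, l}" for x y z
      using disj(1)[of x y] that ij(3) by blast
    have "i = k \<and> j = l \<or> i = l \<and> j = k" if "c \<in> X p \<inter> X q" for c
      using that eq unfolding X_def pq passes_over_def by (simp, metis)
    then show ?thesis using ij(1,2) that(3) by (fastforce simp: pq)
  qed
  have sum_card: "(\<Sum>p\<in>K. card (X p \<inter> Z)) = card (\<Union>p\<in>K. X p \<inter> Z)" if "K \<subseteq> J" "finite Z" for K Z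
    using X_disj that finite_subset[OF that(1) finJ] by (intro card_UN_disjoint[symmetric]) blast+
  have sum_le: "(\<Sum>p\<in>K. card (X p \<inter> Z)) \<le> card Z" if "K \<subseteq> J" "finite Z" for K Z
    unfolding sum_card[OF that] using that(2) by (intro card_mono) auto
  have pb: "pair_span w (C i) (C j) \<le> card (X (i, j) \<inter> S)"
    "pair_span w (C i) (C j) = card (X (i, j) \<inter> S) \<Longrightarrow>
       link_dist w (C i) (C j) \<le> int (card (X (i, j) \<inter> T))"
    if "(i, j) \<in> pairs n" for i j
  proof -
    have ij: "i \<in> {1..n}" "j \<in> {1..n}" "i \<noteq> j" using that by (auto simp: pairs_def)
    have z: "over_sum (modify S T w) (C i) (C j) = 0" "over_sum (modify S T w) (C j) (C i) = 0"
      using trivial_invariants(1)[OF triv] Cin ij disj(2) by (simp_all add: shape)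
    show "pair_span w (C i) (C j) \<le> card (X (i, j) \<inter> S)"
      using pair_bounds(1)[OF disj(1)[OF ij] TS z] by (simp add: X_def)
    show "link_dist w (C i) (C j) \<le> int (card (X (i, j) \<inter> T))"
      if "pair_span w (C i) (C j) = card (X (i, j) \<inter> S)"
      using pair_bounds(2)[OF disj(1)[OF ij] TS z] that by (simp add: X_def)
  qed
  have span: "diag_span w n C = (\<Sum>(i, j)\<in>pairs n. pair_span w (C i) (C j))"
    by (simp add: diag_span_def pairs_def)
  have le: "diag_span w n C \<le> (\<Sum>p\<in>pairs n. card (X p \<inter> S))"
    unfolding span using pb(1) by (intro sum_mono) auto
  with sum_le[OF J fin(1)] S(2) show "diag_span w n C \<le> a" by linarith
  assume eq: "diag_span w n C = a"
  with le sum_le[OF J fin(1)] S(2) have eqs: "(\<Sum>p\<in>pairs n. card (X p \<inter> S)) = card S"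
    "(\<Sum>(i, j)\<in>pairs n. pair_span w (C i) (C j)) = (\<Sum>p\<in>pairs n. card (X p \<inter> S))"
    unfolding span by linarith+
  \<comment> \<open>All virtualized crossings are linking crossings; the writhe bound applies
    because no self-crossing has been removed.\<close>
  have Sl: "(\<Union>p\<in>pairs n. X p \<inter> S) = S"
    by (rule card_subset_eq[OF fin(1)]) (use eqs(1) sum_card[OF J fin(1)] in auto)
  have tight: "pair_span w (C i) (C j) = card (X (i, j) \<inter> S)" if "(i, j) \<in> pairs n" for i j
  proof (rule ccontr)
    assume "pair_span w (C i) (C j) \<noteq> card (X (i, j) \<inter> S)"
    then have "(\<Sum>(i, j)\<in>pairs n. pair_span w (C i) (C j)) < (\<Sum>p\<in>pairs n. card (X p \<inter> S))"
      using pb(1) that by (intro sum_strict_mono_ex1)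
        (auto intro!: bexI[of _ "(i, j)"] simp: order.not_eq_order_implies_strict)
    then show False using eqs(2) by simp
  qed
  have self: "total_writhe w (C i) \<le> 2 * int (card (X (i, i) \<inter> T))" if i: "i \<in> {1..n}" for i
  proof -
    have on: "crossings_on w (C i) = X (i, i)" by (auto simp: crossings_on_def X_def passes_over_def)
    have "X (i, i) \<inter> X p = {}" if "p \<in> pairs n" for p
      using X_disj[of "(i, i)" p] i that by (auto simp: J_def pairs_def)
    then have "X (i, i) \<inter> S = {}" using Sl by blast
    then show ?thesis
      using total_writhe_le[OF d Cin[OF i], of S T] trivial_invariants(2)[OF triv] Cin[OF i]
      by (simp add: shape on)
  qed
  have "(\<Sum>p\<in>J. card (X p \<inter> T)) = (\<Sum>p\<in>pairs n. card (X p \<inter> T)) + (\<Sum>i = 1..n. card (X (i, i) \<inter> T))"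
  proof -
    have "pairs n \<inter> (\<lambda>i. (i, i)) ` {1..n} = {}" by (auto simp: pairs_def)
    then show ?thesis unfolding J_def by (simp add: sum.union_disjoint sum.reindex inj_on_def)
  qed
  with sum_le[OF subset_refl fin(2)] T(2)
  have Tsum: "(\<Sum>p\<in>pairs n. card (X p \<inter> T)) + (\<Sum>i = 1..n. card (X (i, i) \<inter> T)) \<le> b" by simp
  have "(\<Sum>(i, j)\<in>pairs n. real_of_int (link_dist w (C i) (C j)))
      \<le> (\<Sum>p\<in>pairs n. real (card (X p \<inter> T)))"
  proof (intro sum_mono, clarify)
    fix i j assume "(i, j) \<in> pairs n"
    from pb(2)[OF this tight[OF this]]
    show "real_of_int (link_dist w (C i) (C j)) \<le> real (card (X (i, j) \<inter> T))"
      by linarith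
  qed
  also have "\<dots> = real (\<Sum>p\<in>pairs n. card (X p \<inter> T))" by simp
  finally have 1: "(\<Sum>(i, j)\<in>pairs n. real_of_int (link_dist w (C i) (C j)))
      \<le> real (\<Sum>p\<in>pairs n. card (X p \<inter> T))" .
  have "(\<Sum>i = 1..n. real_of_int (total_writhe w (C i))) \<le> (\<Sum>i = 1..n. 2 * real (card (X (i, i) \<inter> T)))"
  proof (intro sum_mono)
    fix i assume "i \<in> {1..n}"
    from self[OF this] show "real_of_int (total_writhe w (C i)) \<le> 2 * real (card (X (i, i) \<inter> T))" by linarith
  qed
  also have "\<dots> = 2 * real (\<Sum>i = 1..n. card (X (i, i) \<inter> T))" by (simp add: sum_distrib_left)
  finally show "(\<Sum>(i, j)\<in>pairs n. real_of_int (link_dist w (C i) (C j))) +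
      1 / 2 * (\<Sum>i = 1..n. real_of_int (total_writhe w (C i))) \<le> real b"
    using 1 Tsum by linarith
qed

lemma unknottable_exists:
  assumes "diagram w" shows "\<exists>u. unknottable (fst u) (snd u) w"
proof -
  let ?w = "modify (classical w) {} w"
  have "classical ?w = {}" by (simp add: classical_modify)
  moreover have "virtual_only ?w"
    unfolding virtual_only_def
  proof (intro ballI allI impI)
    fix x k assume "x \<in> set ?w" "fst x = Cross k"
    then obtain c where "c < length ?w" "fst (?w ! c) = Cross k" by (metis in_set_conv_nth)
    then show "k = Virtual" using \<open>classical ?w = {}\<close> classical_iff[of c ?w] by auto
  qed
  then have "trivial ?w" using virtual_only_trivial same_shape_diagram[OF same_shape_modify assms] by blast
  then have "unknottable (card (classical w)) 0 w"
    unfolding unknottable_def modify_def by (intro exI[of _ "classical w"] exI[of _ "{}"]) simp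
  then show ?thesis by (intro exI[of _ "(card (classical w), 0)"]) simp
qed

theorem theorem2p2:
  fixes L :: "diag set" and D :: diag and n :: nat and C :: "nat \<Rightarrow> (nat \<times> nat) set"
  assumes "L \<in> virtual_links" and "D \<in> L"
    and "bij_betw C {1..n} (components D)"
  shows "(real (diag_span D n C),
          (\<Sum>(i, j) \<in> {(i, j). 1 \<le> i \<and> i < j \<and> j \<le> n}. ell D (C i) (C j))
            + 1 / 2 * (\<Sum>i = 1..n. real_of_int (total_writhe D (C i))))
         \<le> map_prod real real (unknotting_index L)"
proof -
  have "\<exists>u. \<exists>w\<in>L. u = diag_unknotting_index w" using assms(2) by blast
  from LeastI_ex[OF this] obtain w where w: "w \<in> L" "unknotting_index L = diag_unknotting_index w"
    unfolding unknotting_index_def by blast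
  have eqv: "(D, w) \<in> equivalent" by (rule virtual_link_equivalent[OF assms(1,2) w(1)])
  then have d: "diagram D" "diagram w" by (auto simp: equivalent_def)
  obtain a b where ab: "unknotting_index L = (a, b)" by force
  have un: "unknottable a b w"
    using LeastI_ex[OF unknottable_exists[OF d(2)]] w(2) ab
    unfolding diag_unknotting_index_def by (metis fst_conv snd_conv)
  obtain g where g: "bij_betw g (components D) (components w)"
    "\<And>P Q. P \<in> components D \<Longrightarrow> Q \<in> components D \<Longrightarrow> P \<noteq> Q \<Longrightarrow> over_sum w (g P) (g Q) = over_sum D P Q"
    "\<And>P k. P \<in> components D \<Longrightarrow> k \<noteq> 0 \<Longrightarrow> writhe k w (g P) = writhe k D P"
    using equivalent_invariants[OF eqv] by metis
  let ?C = "g \<circ> C"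
  have C': "bij_betw ?C {1..n} (components w)" using bij_betw_trans[OF assms(3) g(1)] .
  have Cin: "C i \<in> components D" if "i \<in> {1..n}" for i using assms(3) that by (meson bij_betwE)
  have Cne: "C i \<noteq> C j" if "i \<in> {1..n}" "j \<in> {1..n}" "i \<noteq> j" for i j
    using assms(3) that by (meson bij_betw_imp_inj_on inj_onD)
  have pair: "over_sum w (?C i) (?C j) = over_sum D (C i) (C j)" "over_sum w (?C j) (?C i) = over_sum D (C j) (C i)"
    "C i \<inter> C j = {}"
    if "(i, j) \<in> pairs n" for i j
  proof -
    have ij: "i \<in> {1..n}" "j \<in> {1..n}" "i \<noteq> j" using that by (auto simp: pairs_def)
    show "over_sum w (?C i) (?C j) = over_sum D (C i) (C j)" "over_sum w (?C j) (?C i) = over_sum D (C j) (C i)"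
      using g(2) Cin Cne ij by auto
    show "C i \<inter> C j = {}" using components_disjoint[OF d(1) Cin[OF ij(1)] Cin[OF ij(2)]] Cne[OF ij] .
  qed
  have span: "diag_span w n ?C = diag_span D n C"
    unfolding diag_span_def pairs_def[symmetric]
    by (intro sum.cong refl) (use pair in \<open>auto simp: pair_span_eq\<close>)
  have writhe: "total_writhe w (?C i) = total_writhe D (C i)" if "i \<in> {1..n}" for i
  proof -
    have "writhe k w (?C i) = writhe k D (C i)" if "k \<noteq> 0" for k using g(3)[OF Cin that] \<open>i \<in> {1..n}\<close> by simp
    then have "{k. k \<noteq> 0 \<and> writhe k w (?C i) \<noteq> 0} = {k. k \<noteq> 0 \<and> writhe k D (C i) \<noteq> 0}" by auto
    then show ?thesis unfolding total_writhe_def using \<open>\<And>k. k \<noteq> 0 \<Longrightarrow> writhe k w (?C i) = writhe k D (C i)\<close>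
      by (intro sum.cong) auto
  qed
  \<comment> \<open>The passage from \<open>D\<close> to \<open>w\<close> is made with
    \<open>link_dist\<close>, a function of the invariant one-sided linking numbers;
    \<open>ell\<close> is compared with it in \<open>D\<close>.\<close>
  have "(\<Sum>(i, j)\<in>pairs n. ell D (C i) (C j)) \<le>
      (\<Sum>(i, j)\<in>pairs n. real_of_int (link_dist w (?C i) (?C j)))"
  proof (intro sum_mono, clarify)
    fix i j assume "(i, j) \<in> pairs n"
    from ell_le[OF pair(3)[OF this], of D] pair(1,2)[OF this]
    show "ell D (C i) (C j) \<le> real_of_int (link_dist w (?C i) (?C j))" by (simp add: link_dist_def)
  qed
  moreover have "(\<Sum>i = 1..n. real_of_int (total_writhe w (?C i))) = (\<Sum>i = 1..n. real_of_int (total_writhe D (C i)))"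
    by (intro sum.cong refl) (simp only: writhe)
  ultimately show ?thesis
    using unknottable_bound[OF d(2) C' un] unfolding ab span pairs_def[symmetric]
    by (cases "diag_span D n C = a") (simp_all add: less_eq_prod_def)
qed

end
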